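(* Let $C_1,C_2$ be two analytic half-disks in $\mathbb C^2$, i.e. $C_k=u_k(\Delta^+)$, where $u_k:\Delta^+\to\mathbb C^2$ is an embedding, smooth up to $\partial_0\Delta^+$ and holomorphic (in the standard sense) in the interior of $\Delta^+$. Assume that $u_1(0)=u_2(0)=0$, that $du_1(0)[e_1]=\pm du_2(0)[e_1]$, where $e_1=(1,0)$, and that the order of tangency of $C_1$ with $C_2$ at zero is finite and equal to $d$. Then: (i) the index of intersection of $C_1$ with $C_2$ at zero is equal to $d$; in particular it is positive; (ii) this index is equal to $1$ if and only if $C_1$ intersects $C_2$ at zero transversely.
   Context: $\Delta^{\pm}=\{\zeta\in\mathbb C:|\zeta|<1,\ \pm\operatorname{Im}\zeta\ge0\}$, $\partial_0\Delta^+=(-1,1)$; "smooth" means $\mathcal C^\infty$. Order of tangency and index of intersection are defined for real half-disks. Let $M_k=u_k(\Delta^+)\subset\mathbb R^4$ be smoothly embedded (up to the edge) oriented half-disks with $u_1(0)=u_2(0)=p_0$, whose oriented tangent planes at $p_0$ coincide and whose tangent vectors $du_k(0)[\partial_x]$ are collinear. Write $\mathbb R^4=\mathbb R^2_{x_1,y_1}\oplus\mathbb R^2_{x_2,y_2}$. By an orientation preserving local diffeomorphism, and after shrinking, one brings $M_1$ to the form $\{(x_1,y_1,0,0):x_1^2+y_1^2<1,\ y_1\ge0\}$, $p_0=0$, and $M_2$ to the form of a graph $(x_2,y_2)=\phi(x_1,y_1)$ with $\phi$ smooth up to the edge, $\phi(0)=0$, over $\Delta^+$ (the case when $M_1,M_2$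 "touch", $du_2(0)[\partial_x]$ a positive multiple of $du_1(0)[\partial_x]$) or over $\Delta^-$ (the case when $M_1,M_2$ "meet", $du_2(0)[\partial_x]$ a negative multiple of $du_1(0)[\partial_x]$). The order of tangency is finite and equal to $d$ if $$\phi(x_1,0)=(r_1x_1^d,r_2x_1^d)+O(|x_1|^{d+1}),\qquad r_1^2+r_2^2\neq0 .$$ In the case of analytic half-disks in $\mathbb C^2$, after shrinking and a biholomorphic change making $C_1\subset\mathbb C_{z_1}\times\{0\}$ and $C_2$ a graph $z_2=\phi(z_1)$ with $\phi$ holomorphic inside and smooth up to the boundary, $d$ is the order of the first non-zero term of the Taylor expansion $\phi(z_1)=az_1^d+O(|z_1|^{d+1})$ at $0$. Index: write $\phi(x_1,0)=x_1^d\rho(x_1)$ with $\rho(0)=(r_1,r_2)\neq0$. Both $M_1$ and $M_2$ are attached by their edges to the smooth surface $W=\{(x_1,0,\alpha\rho(x_1)):x_1\in(-1,1),\alpha\in\mathbb R\}$. Let $\Psi(t,\tau,\alpha,\beta)$ be an orientation preserving local diffeomorphism of $(\mathbb R^4,0)$ with $\Psi(t,\tau,\alpha,0)=(t,\tau,\alpha\rho(t))$. After applying $\Psi^{-1}$ (and shrinking) $M_1$ is still of the form $\{(x_1,y_1,0,0):x_1^2+y_1^2<1,y_1\ge0\}$ and $M_2$ is a graph of $\phi=(\phi_1,\phi_2)$ over $\Delta^+$ (respectively $\Delta^-$) with $\phi_2(x_1,0)=0$. Extend $M_1$ to the disk $\widetilde M_1=\{(x_1,y_1,0,0):x_1^2+y_1^2<1\}$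 and $M_2$ to the graph $\widetilde M_2$ over $\widetilde M_1$ of the map $\tilde\phi$ which equals $\phi$ where $\phi$ is defined and is given by $\tilde\phi_1(x_1,y_1)=\phi_1(x_1,-y_1)$, $\tilde\phi_2(x_1,y_1)=-\phi_2(x_1,-y_1)$ on the other half-disk. The index of intersection of $M_1$ and $M_2$ at $p_0$ is the local intersection index at $0$ of $\widetilde M_1$ with the Lipschitz surface $\widetilde M_2$ (i.e. the algebraic number of intersection points near $0$ of $\widetilde M_1$ with a small smooth perturbation of $\widetilde M_2$). *)

theory Defs
  imports "HOL-Analysis.Analysis"
begin

text \<open>
  Real 4-space is the type \<^typ>\<open>complex \<times> complex\<close>, where the point
  \<open>(x\<^sub>1 + \<i> y\<^sub>1, x\<^sub>2 + \<i> y\<^sub>2)\<close> has the real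
  coordinates \<open>x\<^sub>1, y\<^sub>1, x\<^sub>2, y\<^sub>2\<close>, in this order. All derivatives are
  real Frechet derivatives.
\<close>

subsection \<open>Smooth maps\<close>

text \<open>\<open>Ck_on\<close> is meant for open sets, where \<^const>\<open>differentiable_on\<close> is differentiability
  at every point.\<close>

fun Ck_on :: "nat \<Rightarrow> 'a::real_normed_vector set \<Rightarrow> ('a \<Rightarrow> 'b::real_normed_vector) \<Rightarrow> bool" where
  "Ck_on 0 S f \<longleftrightarrow> continuous_on S f"
| "Ck_on (Suc k) S f \<longleftrightarrow>
     f differentiable_on S \<and> (\<forall>v. Ck_on k S (\<lambda>x. frechet_derivative f (at x) v))"

definition smooth_on :: "'a::real_normed_vector set \<Rightarrow> ('a \<Rightarrow> 'b::real_normed_vector) \<Rightarrow> bool" where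
  "smooth_on S f \<longleftrightarrow> open S \<and> (\<forall>k. Ck_on k S f)"

text \<open>Smoothness on a set that need not be open, in particular on a half-disk up to its edge.\<close>

definition smooth_up_to :: "'a::real_normed_vector set \<Rightarrow> ('a \<Rightarrow> 'b::real_normed_vector) \<Rightarrow> bool" where
  "smooth_up_to S f \<longleftrightarrow> (\<exists>V g. S \<subseteq> V \<and> smooth_on V g \<and> (\<forall>x\<in>S. g x = f x))"

subsection \<open>Orientation\<close>

definition real_coords :: "complex \<times> complex \<Rightarrow> real^4" where
  "real_coords p = vector [Re (fst p), Im (fst p), Re (snd p), Im (snd p)]"

definition det4 :: "complex \<times> complex \<Rightarrow> complex \<times> complex \<Rightarrow> complex \<times> complex \<Rightarrow> complex \<times> complex \<Rightarrow> real"
  where "det4 a b c d =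
    det (vector [real_coords a, real_coords b, real_coords c, real_coords d] :: real^4^4)"

definition orientation_preserving_diffeo ::
    "(complex \<times> complex) set \<Rightarrow> (complex \<times> complex \<Rightarrow> complex \<times> complex) \<Rightarrow> bool" where
  "orientation_preserving_diffeo U F \<longleftrightarrow>
     smooth_on U F \<and> inj_on F U \<and> smooth_on (F ` U) (inv_into U F) \<and>
     (\<forall>p\<in>U. let D = frechet_derivative F (at p) in
        det4 (D (1, 0)) (D (\<i>, 0)) (D (0, 1)) (D (0, \<i>)) > 0)"

subsection \<open>Half-disks\<close>

text \<open>For \<open>s = 1\<close> and \<open>s = -1\<close> this is the upper and the lower half-disk of radius \<open>r\<close>,
  with the edge included.\<close>

definition half_disk :: "real \<Rightarrow> real \<Rightarrow> complex set" where
  "half_disk s r = {\<zeta>. cmod \<zeta> < r \<and> 0 \<le> s * Im \<zeta>}"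

abbreviation \<Delta>plus :: "complex set" where
  "\<Delta>plus \<equiv> half_disk 1 1"

definition embedded_half_disk :: "(complex \<Rightarrow> complex \<times> complex) \<Rightarrow> bool" where
  "embedded_half_disk u \<longleftrightarrow>
     smooth_up_to \<Delta>plus u \<and>
     (\<exists>v. homeomorphism \<Delta>plus (u ` \<Delta>plus) u v) \<and>
     (\<forall>\<zeta>\<in>\<Delta>plus. inj (frechet_derivative u (at \<zeta> within \<Delta>plus)))"

definition analytic_half_disk :: "(complex \<Rightarrow> complex \<times> complex) \<Rightarrow> bool" where
  "analytic_half_disk u \<longleftrightarrow>
     embedded_half_disk u \<and>
     (\<lambda>\<zeta>. fst (u \<zeta>)) holomorphic_on {\<zeta>. cmod \<zeta> < 1 \<and> 0 < Im \<zeta>} \<and>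
     (\<lambda>\<zeta>. snd (u \<zeta>)) holomorphic_on {\<zeta>. cmod \<zeta> < 1 \<and> 0 < Im \<zeta>}"

definition diff0 :: "(complex \<Rightarrow> complex \<times> complex) \<Rightarrow> complex \<Rightarrow> complex \<times> complex" where
  "diff0 u = frechet_derivative u (at 0 within \<Delta>plus)"

definition transverse_at_0 :: "(complex \<Rightarrow> complex \<times> complex) \<Rightarrow> (complex \<Rightarrow> complex \<times> complex) \<Rightarrow> bool" where
  "transverse_at_0 u1 u2 \<longleftrightarrow> {a + b |a b. a \<in> range (diff0 u1) \<and> b \<in> range (diff0 u2)} = UNIV"

subsection \<open>Order of tangency\<close>

text \<open>The value is \<open>1\<close> if the half-disks touch, and \<open>-1\<close> if they meet.\<close>

definition edge_sign :: "(complex \<Rightarrow> complex \<times> complex) \<Rightarrow> (complex \<Rightarrow> complex \<times> complex) \<Rightarrow> real" where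
  "edge_sign u1 u2 = (if \<exists>c>0. diff0 u2 1 = c *\<^sub>R diff0 u1 1 then 1 else -1)"

text \<open>
  \<open>F\<close> is a local diffeomorphism that, after shrinking both half-disks to the open set \<open>U\<close>, flattens
  the first one and makes the second one the graph of \<open>\<phi>\<close>. The condition on the derivative says
  that \<open>F\<close> takes the edge of the first half-disk, and hence the half-disk itself, to the flat one
  with its standard orientation.
\<close>

definition normal_form ::
    "(complex \<Rightarrow> complex \<times> complex) \<Rightarrow> (complex \<Rightarrow> complex \<times> complex) \<Rightarrow>
     (complex \<times> complex) set \<Rightarrow> (complex \<times> complex \<Rightarrow> complex \<times> complex) \<Rightarrow>
     real \<Rightarrow> (complex \<Rightarrow> complex) \<Rightarrow> bool" where
  "normal_form u1 u2 U F r \<phi> \<longleftrightarrow>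
     orientation_preserving_diffeo U F \<and> u1 0 \<in> U \<and> F (u1 0) = 0 \<and> 0 < r \<and>
     F ` (u1 ` \<Delta>plus \<inter> U) = (\<lambda>z. (z, 0)) ` half_disk 1 r \<and>
     0 < Re (fst (frechet_derivative F (at (u1 0)) (diff0 u1 1))) \<and>
     F ` (u2 ` \<Delta>plus \<inter> U) = (\<lambda>z. (z, \<phi> z)) ` half_disk (edge_sign u1 u2) r \<and>
     smooth_up_to (half_disk (edge_sign u1 u2) r) \<phi> \<and> \<phi> 0 = 0"

definition has_tangency_order ::
    "(complex \<Rightarrow> complex \<times> complex) \<Rightarrow> (complex \<Rightarrow> complex \<times> complex) \<Rightarrow> nat \<Rightarrow> bool" where
  "has_tangency_order u1 u2 d \<longleftrightarrow>
     (\<exists>U F r \<phi> c. normal_form u1 u2 U F r \<phi> \<and> c \<noteq> 0 \<and>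
        (\<lambda>x::real. \<phi> (of_real x) - of_real x ^ d * c) \<in> O[at 0](\<lambda>x. of_real x ^ (d + 1)))"

subsection \<open>Local intersection index\<close>

definition intersection_sign ::
    "(complex \<Rightarrow> complex \<times> complex) \<Rightarrow> (complex \<Rightarrow> complex \<times> complex) \<Rightarrow> complex \<Rightarrow> complex \<Rightarrow> real" where
  "intersection_sign f h a b =
     sgn (det4 (frechet_derivative f (at a) 1) (frechet_derivative f (at a) \<i>)
               (frechet_derivative h (at b) 1) (frechet_derivative h (at b) \<i>))"

text \<open>
  The local index at \<open>0\<close> of a smooth surface \<open>f\<close> with a continuous surface \<open>g\<close>, both parametrized
  near \<open>0\<close>: every smooth perturbation \<open>h\<close> of \<open>g\<close> that is small enough and transverse to \<open>f\<close> has
  \<open>k\<close> intersection points with \<open>f\<close> near \<open>0\<close>, counted with sign.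
\<close>

definition has_local_index ::
    "(complex \<Rightarrow> complex \<times> complex) \<Rightarrow> (complex \<Rightarrow> complex \<times> complex) \<Rightarrow> int \<Rightarrow> bool" where
  "has_local_index f g k \<longleftrightarrow>
     (\<exists>\<epsilon>0>0. \<forall>\<epsilon>. 0 < \<epsilon> \<and> \<epsilon> < \<epsilon>0 \<longrightarrow>
       (\<exists>\<delta>>0. \<forall>h.
          let X = {(a, b). a \<in> ball 0 \<epsilon> \<and> b \<in> ball 0 \<epsilon> \<and> f a = h b} in
          smooth_on (ball 0 \<epsilon>) h \<and> (\<forall>b\<in>ball 0 \<epsilon>. dist (h b) (g b) < \<delta>) \<and>
          (\<forall>(a, b)\<in>X. intersection_sign f h a b \<noteq> 0) \<longrightarrow>
          finite X \<and> (\<Sum>(a, b)\<in>X. intersection_sign f h a b) = of_int k))"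

subsection \<open>Index of intersection of half-disks\<close>

text \<open>The extension to the full disk of a function on the half-disk of sign \<open>s\<close>.\<close>

definition reflect_ext :: "real \<Rightarrow> (complex \<Rightarrow> complex) \<Rightarrow> complex \<Rightarrow> complex" where
  "reflect_ext s \<phi> z =
     (if 0 \<le> s * Im z then \<phi> z
      else Complex (Re (\<phi> (cnj z))) (- Im (\<phi> (cnj z))))"

text \<open>
  \<open>k\<close> is the index computed from one choice of the data: a normal form \<open>F\<close>, with \<open>\<phi>\<close> equal to
  \<open>x ^ d * \<rho> x\<close> on the edge, and a local diffeomorphism \<open>\<Psi>\<close> of a neighbourhood \<open>V\<close> of \<open>0\<close> that
  parametrizes the surface of all \<open>(x, \<alpha> * \<rho> x)\<close>. Composing \<open>F\<close> with the inverse of \<open>\<Psi>\<close> and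
  shrinking to \<open>U'\<close> yields the normal form whose \<open>\<phi>'\<close> is real on the edge.
\<close>

definition has_intersection_index ::
    "(complex \<Rightarrow> complex \<times> complex) \<Rightarrow> (complex \<Rightarrow> complex \<times> complex) \<Rightarrow> int \<Rightarrow> bool" where
  "has_intersection_index u1 u2 k \<longleftrightarrow>
     (\<exists>U F r \<phi> d \<rho> V \<Psi> U' r' \<phi>'.
        normal_form u1 u2 U F r \<phi> \<and>
        smooth_on {-r<..<r} \<rho> \<and> \<rho> (0::real) \<noteq> 0 \<and>
        (\<forall>x\<in>{-r<..<r}. \<phi> (of_real x) = of_real x ^ d * \<rho> x) \<and>
        orientation_preserving_diffeo V \<Psi> \<and> 0 \<in> V \<and> \<Psi> 0 = 0 \<and>
        (\<forall>t \<tau> \<alpha>. t \<in> {-r<..<r} \<and> (Complex t \<tau>, of_real \<alpha>) \<in> V \<longrightarrow>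
           \<Psi> (Complex t \<tau>, of_real \<alpha>) = (Complex t \<tau>, of_real \<alpha> * \<rho> t)) \<and>
        U' \<subseteq> U \<and> F ` U' \<subseteq> \<Psi> ` V \<and>
        normal_form u1 u2 U' (inv_into V \<Psi> \<circ> F) r' \<phi>' \<and>
        (\<forall>x\<in>{-r'<..<r'}. Im (\<phi>' (of_real x)) = 0) \<and>
        has_local_index (\<lambda>z. (z, 0)) (\<lambda>z. (z, reflect_ext (edge_sign u1 u2) \<phi>' z)) k)"

definition intersection_index ::
    "(complex \<Rightarrow> complex \<times> complex) \<Rightarrow> (complex \<Rightarrow> complex \<times> complex) \<Rightarrow> int" where
  "intersection_index u1 u2 = (THE k. has_intersection_index u1 u2 k)"

end

theory Submission
  imports Defs "HOL-Complex_Analysis.Complex_Analysis"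
begin

text \<open>
  Both disks extend smoothly across the edge, and holomorphy on one side makes their Taylor
  expansions holomorphic. Let \<open>v\<close> span the common tangent line and \<open>w\<close> be complex orthogonal to \<open>v\<close>.
  After a polynomial reparametrization \<open>\<sigma>\<close> of the first disk, \<open>u\<^sub>2(z) - u\<^sub>1(\<sigma>(z))\<close> is
  \<open>a z\<^sup>e w\<close> up to order \<open>e + 1\<close>. A normal form \<open>F\<close> sends the first disk, continued across the
  edge, to the plane up to a flat error, so in every normal form the graph function is
  \<open>\<phi>(z) = A(a (s T z)\<^sup>e) + O(|z|\<^bsup>e+1\<^esup>)\<close> with real-linear \<open>A\<close>, \<open>T\<close> that preserve orientation. Hence
  \<open>e\<close> is the order of tangency \<open>d\<close>. If \<open>\<phi>\<close> is real on the edge, then \<open>\<phi>(z) = c z\<^sup>d e\<^bsup>L(z)\<^esup>\<close> on the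
  half-disk, with \<open>c\<close> real and \<open>L\<close> continuous and real on the edge. By reflection the extension has
  this form on a full punctured disk, so its degree around \<open>0\<close>, which is the local index, is \<open>d\<close>.
  Since the tangent lines coincide, \<open>d \<ge> 2\<close> and the disks are never transverse: both sides of
  (ii) are false.
\<close>

subsection \<open>Smooth maps\<close>

text \<open>The polynomial \<open>\<sigma>\<close> need not keep the half-disk above the edge, and
  below the edge the extensions are merely smooth: there a normal form says nothing about the
  continued first disk. What survives is that its normal component vanishes to every order at 0.
  This is why expansions are stated as Landau estimates on full neighbourhoods and not as identities
  on half-disks.

  Order of tangency and index are both defined through the existence of suitable charts, so
  uniqueness requires the expansion in every normal form. The maps A and T depend on the chart, but
  their orientation does not. The local index quantifies over all transverse perturbations; if there
  were none, every integer would qualify, so one has to be constructed.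

  Degrees are handled by comparing functions up to factors with a continuous logarithm. This
  relation is multiplicative, needs only continuity, and makes sense on punctured disks as well as
  on circles, so the same calculus treats reflection, perturbation and the counting of
  zeros.\<close>

lemma Ck_on_imp_continuous_on: "Ck_on k S f \<Longrightarrow> continuous_on S f"
  by (cases k) (auto intro: differentiable_imp_continuous_on)

lemma Ck_on_subset: "Ck_on k S f \<Longrightarrow> T \<subseteq> S \<Longrightarrow> Ck_on k T f"
proof (induction k arbitrary: f)
  case (Suc k)
  then show ?case by (auto intro: differentiable_on_subset)
qed (auto intro: continuous_on_subset)

lemma Ck_on_cong:
  assumes "open S" "\<And>x. x \<in> S \<Longrightarrow> f x = g x" "Ck_on k S f"
  shows "Ck_on k S g"
  using assms(2,3)
proof (induction k arbitrary: f g)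
  case 0
  then show ?case by (metis Ck_on.simps(1) continuous_on_cong)
next
  case (Suc k)
  have d: "f differentiable (at x)" if "x \<in> S" for x
    using Suc.prems(2) that assms(1) by (auto simp: differentiable_on_eq_differentiable_at)
  have eq: "frechet_derivative g (at x) = frechet_derivative f (at x)" if "x \<in> S" for x
    using frechet_derivative_transform_within_open[OF d[OF that] assms(1) that] Suc.prems(1) by simp
  have "g differentiable_on S"
    using Suc.prems by (metis Ck_on.simps(2) differentiable_on_def differentiable_transform_within
        zero_less_one)
  moreover have "Ck_on k S (\<lambda>x. frechet_derivative g (at x) v)" for v
    by (rule Suc.IH[of "\<lambda>x. frechet_derivative f (at x) v"]) (use eq Suc.prems in auto)
  ultimately show ?case by simp
qed

text \<open>Lets the derivative be supplied in closed form, so that each induction on the order of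
  differentiability can name it explicitly.\<close>

lemma Ck_on_SucI:
  assumes "open S" "\<And>x. x \<in> S \<Longrightarrow> (f has_derivative D x) (at x)"
    "\<And>v. Ck_on k S (\<lambda>x. D x v)"
  shows "Ck_on (Suc k) S f"
proof -
  have "frechet_derivative f (at x) = D x" if "x \<in> S" for x
    using frechet_derivative_at[OF assms(2)[OF that]] by simp
  then have "Ck_on k S (\<lambda>x. frechet_derivative f (at x) v)" for v
    by (intro Ck_on_cong[OF assms(1) _ assms(3)[of v]]) simp
  moreover have "f differentiable_on S"
    using assms by (auto simp: differentiable_on_eq_differentiable_at differentiable_def)
  ultimately show ?thesis by simp
qed

lemma Ck_on_Suc_has_derivative:
  "open S \<Longrightarrow> Ck_on (Suc k) S f \<Longrightarrow> x \<in> S \<Longrightarrow> (f has_derivative frechet_derivative f (at x)) (at x)"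
  by (auto simp: differentiable_on_eq_differentiable_at frechet_derivative_works)

lemma Ck_on_SucD: "Ck_on (Suc k) S f \<Longrightarrow> Ck_on k S f"
proof (induction k arbitrary: f)
  case 0
  then show ?case by (auto intro: differentiable_imp_continuous_on)
next
  case (Suc k)
  then show ?case by (metis Ck_on.simps(2))
qed

lemma Ck_on_const: "open S \<Longrightarrow> Ck_on k S (\<lambda>x. c)"
  by (induction k arbitrary: c) auto

lemma Ck_on_bounded_linear:
  assumes "open S" "bounded_linear f"
  shows "Ck_on k S f"
proof (cases k)
  case 0
  then show ?thesis using assms by (simp add: linear_continuous_on)
next
  case (Suc n)
  show ?thesis unfolding Suc
    by (rule Ck_on_SucI[OF assms(1), of f "\<lambda>_. f"])
      (use assms bounded_linear_imp_has_derivative Ck_on_const in auto)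
qed

lemma Ck_on_add:
  assumes "open S" "Ck_on k S f" "Ck_on k S g"
  shows "Ck_on k S (\<lambda>x. f x + g x)"
  using assms(2,3)
proof (induction k arbitrary: f g)
  case 0
  then show ?case by (auto intro: continuous_intros)
next
  case (Suc k)
  show ?case
    by (rule Ck_on_SucI[OF assms(1) has_derivative_add])
      (use Suc assms(1) in \<open>auto intro!: Ck_on_Suc_has_derivative\<close>)
qed

lemma Ck_on_bilinear:
  assumes "open S" "bounded_bilinear B" "Ck_on k S f" "Ck_on k S g"
  shows "Ck_on k S (\<lambda>x. B (f x) (g x))"
  using assms(3,4)
proof (induction k arbitrary: f g)
  case 0
  then show ?case using assms(2) by (auto intro: bounded_bilinear.continuous_on)
next
  case (Suc k)
  show ?case
  proof (rule Ck_on_SucI[OF assms(1)])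
    fix x assume x: "x \<in> S"
    show "((\<lambda>x. B (f x) (g x)) has_derivative
      (\<lambda>h. B (f x) (frechet_derivative g (at x) h) + B (frechet_derivative f (at x) h) (g x))) (at x)"
      by (rule bounded_bilinear.FDERIV[OF assms(2)])
        (use Suc.prems assms(1) x Ck_on_Suc_has_derivative in blast)+
  next
    fix v
    show "Ck_on k S (\<lambda>x. B (f x) (frechet_derivative g (at x) v) + B (frechet_derivative f (at x) v) (g x))"
      by (intro Ck_on_add assms Suc.IH)
        (use Suc.prems Ck_on_SucD[OF Suc.prems(1)] Ck_on_SucD[OF Suc.prems(2)] in auto)
  qed
qed

lemma Ck_on_sum:
  assumes "open S" "finite I" "\<And>i. i \<in> I \<Longrightarrow> Ck_on k S (f i)"
  shows "Ck_on k S (\<lambda>x. \<Sum>i\<in>I. f i x)"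
  using assms(2,3)
  by (induction I rule: finite_induct) (auto intro!: Ck_on_add Ck_on_const assms(1))

lemma Ck_on_linear_compose:
  assumes "open S" "bounded_linear L" "Ck_on k S f"
  shows "Ck_on k S (\<lambda>x. L (f x))"
  using assms(3)
proof (induction k arbitrary: f)
  case 0
  then show ?case using assms(2) by (simp add: bounded_linear.continuous_on)
next
  case (Suc k)
  show ?case
    by (rule Ck_on_SucI[OF assms(1) bounded_linear.has_derivative[OF assms(2)]])
      (use Suc assms(1) in \<open>auto intro!: Ck_on_Suc_has_derivative\<close>)
qed

lemma linear_basis_expansion:
  fixes L :: "'a::euclidean_space \<Rightarrow> 'b::real_vector"
  assumes "linear L"
  shows "L x = (\<Sum>b\<in>Basis. (x \<bullet> b) *\<^sub>R L b)"
proof -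
  have "L x = L (\<Sum>b\<in>Basis. (x \<bullet> b) *\<^sub>R b)" by (simp add: euclidean_representation)
  then show ?thesis by (simp add: linear_sum[OF assms] linear_scale[OF assms])
qed

text \<open>In the chain rule both the base point and the argument of the outer derivative vary.
  Expanding the argument in a basis turns the derivative into a sum of products to which the
  induction hypothesis applies; hence the Euclidean middle space.\<close>

lemma Ck_on_compose:
  fixes f :: "'b::euclidean_space \<Rightarrow> 'c::real_normed_vector"
    and g :: "'a::real_normed_vector \<Rightarrow> 'b"
  assumes "open S" "open T" "Ck_on k T f" "Ck_on k S g" "g ` S \<subseteq> T"
  shows "Ck_on k S (\<lambda>x. f (g x))"
  using assms(3,4)
proof (induction k arbitrary: f)
  case 0
  then show ?case using assms(5) by (auto intro: continuous_on_compose2)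
next
  case (Suc k)
  let ?Df = "\<lambda>y. frechet_derivative f (at y)" and ?Dg = "\<lambda>x. frechet_derivative g (at x)"
  have df: "(f has_derivative ?Df (g x)) (at (g x))" if "x \<in> S" for x
    using Ck_on_Suc_has_derivative[OF assms(2) Suc.prems(1)] assms(5) that by blast
  have dg: "(g has_derivative ?Dg x) (at x)" if "x \<in> S" for x
    using Ck_on_Suc_has_derivative[OF assms(1) Suc.prems(2)] that by blast
  have "Ck_on (Suc k) S (\<lambda>x. f (g x))"
  proof (rule Ck_on_SucI[OF assms(1)])
    fix x assume x: "x \<in> S"
    have "((\<lambda>x. f (g x)) has_derivative (\<lambda>v. ?Df (g x) (?Dg x v))) (at x)"
      using has_derivative_compose[OF dg[OF x] df[OF x]] .
    moreover have "?Df (g x) (?Dg x v) = (\<Sum>b\<in>Basis. (?Dg x v \<bullet> b) *\<^sub>R ?Df (g x) b)" for v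
      using linear_basis_expansion[OF has_derivative_linear[OF df[OF x]]] .
    ultimately show "((\<lambda>x. f (g x)) has_derivative
        (\<lambda>v. \<Sum>b\<in>Basis. (?Dg x v \<bullet> b) *\<^sub>R ?Df (g x) b)) (at x)" by simp
  next
    fix v
    have "Ck_on k S (\<lambda>x. (?Dg x v \<bullet> b) *\<^sub>R ?Df (g x) b)" for b
      by (intro Ck_on_bilinear[OF assms(1) bounded_bilinear_scaleR]
          Ck_on_linear_compose[OF assms(1) bounded_linear_inner_left]
          Suc.IH[of "\<lambda>y. ?Df y b"] Ck_on_SucD[OF Suc.prems(2)])
        (use Suc.prems in auto)
    then show "Ck_on k S (\<lambda>x. \<Sum>b\<in>Basis. (?Dg x v \<bullet> b) *\<^sub>R ?Df (g x) b)"
      by (intro Ck_on_sum assms(1)) auto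
  qed
  then show ?case .
qed

lemma Ck_on_Pair:
  assumes "open S" "Ck_on k S f" "Ck_on k S g"
  shows "Ck_on k S (\<lambda>x. (f x, g x))"
proof -
  have "Ck_on k S (\<lambda>x. (f x, 0) + (0, g x))"
    by (intro Ck_on_add assms Ck_on_linear_compose[OF _ bounded_linear_Pair]) 
      (auto intro!: Ck_on_linear_compose[where L="\<lambda>y. (y, 0)"]
        Ck_on_linear_compose[where L="\<lambda>y. (0, y)"] assms bounded_linear_Pair bounded_linear_ident)
  then show ?thesis by simp
qed

lemma Ck_on_inverse:
  fixes S :: "'a::real_normed_field set"
  assumes "open S" "0 \<notin> S"
  shows "Ck_on k S inverse"
proof (induction k)
  case 0
  then show ?case using assms by (auto intro: continuous_intros)
next
  case (Suc k)
  show ?case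
  proof (rule Ck_on_SucI[OF assms(1)])
    show "(inverse has_derivative (\<lambda>h. - (inverse x * h * inverse x))) (at x)" if "x \<in> S" for x
      using has_derivative_inverse'[of x] that assms(2) by metis
    have "Ck_on k S (\<lambda>x. - v * (inverse x * inverse x))" for v
      by (intro Ck_on_linear_compose[OF assms(1) bounded_linear_mult_right]
          Ck_on_bilinear[OF assms(1) bounded_bilinear_mult] Suc)
    then show "Ck_on k S (\<lambda>x. - (inverse x * v * inverse x))" for v
      by (simp add: mult_ac)
  qed
qed

lemma Ck_on_exp: "Ck_on k UNIV (exp :: complex \<Rightarrow> complex)"
proof (induction k)
  case 0
  then show ?case by (auto intro: continuous_intros)
next
  case (Suc k)
  show ?case
  proof (rule Ck_on_SucI)
    show "((exp :: complex \<Rightarrow> complex) has_derivative (*) (exp x)) (at x)" for x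
      using DERIV_exp has_field_derivative_def by blast
    show "Ck_on k UNIV (\<lambda>x::complex. exp x * v)" for v
      by (intro Ck_on_linear_compose[OF open_UNIV bounded_linear_mult_left] Suc)
  qed auto
qed

section \<open>Calculus of smooth maps on open sets\<close>

lemma smooth_onD: "smooth_on S f \<Longrightarrow> Ck_on k S f"
  by (simp add: smooth_on_def)

lemma smooth_on_open: "smooth_on S f \<Longrightarrow> open S"
  by (simp add: smooth_on_def)

lemma smooth_on_subset: "smooth_on S f \<Longrightarrow> T \<subseteq> S \<Longrightarrow> open T \<Longrightarrow> smooth_on T f"
  using Ck_on_subset unfolding smooth_on_def by blast

lemma smooth_on_cong: "smooth_on S f \<Longrightarrow> (\<And>x. x \<in> S \<Longrightarrow> f x = g x) \<Longrightarrow> smooth_on S g"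
  using Ck_on_cong unfolding smooth_on_def by metis

lemma smooth_on_has_derivative:
  "smooth_on S f \<Longrightarrow> x \<in> S \<Longrightarrow> (f has_derivative frechet_derivative f (at x)) (at x)"
  using Ck_on_Suc_has_derivative[of S 0 f x] unfolding smooth_on_def by metis

lemma smooth_on_continuous_on: "smooth_on S f \<Longrightarrow> continuous_on S f"
  using Ck_on_imp_continuous_on smooth_onD by blast

lemma smooth_on_frechet: "smooth_on S f \<Longrightarrow> smooth_on S (\<lambda>x. frechet_derivative f (at x) v)"
  unfolding smooth_on_def by (metis Ck_on.simps(2))

lemma smooth_on_const: "open S \<Longrightarrow> smooth_on S (\<lambda>x. c)"
  by (simp add: smooth_on_def Ck_on_const)

lemma smooth_on_bounded_linear: "open S \<Longrightarrow> bounded_linear f \<Longrightarrow> smooth_on S f"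
  by (simp add: smooth_on_def Ck_on_bounded_linear)

lemma smooth_on_add: "smooth_on S f \<Longrightarrow> smooth_on S g \<Longrightarrow> smooth_on S (\<lambda>x. f x + g x)"
  by (simp add: smooth_on_def Ck_on_add)

lemma smooth_on_bilinear:
  "bounded_bilinear B \<Longrightarrow> smooth_on S f \<Longrightarrow> smooth_on S g \<Longrightarrow> smooth_on S (\<lambda>x. B (f x) (g x))"
  by (simp add: smooth_on_def Ck_on_bilinear)

lemma smooth_on_linear_compose:
  "bounded_linear L \<Longrightarrow> smooth_on S f \<Longrightarrow> smooth_on S (\<lambda>x. L (f x))"
  by (simp add: smooth_on_def Ck_on_linear_compose)

lemma smooth_on_compose:
  fixes f :: "'b::euclidean_space \<Rightarrow> 'c::real_normed_vector"
  shows "smooth_on T f \<Longrightarrow> smooth_on S g \<Longrightarrow> g ` S \<subseteq> T \<Longrightarrow> smooth_on S (\<lambda>x. f (g x))"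
  unfolding smooth_on_def using Ck_on_compose by metis

lemma smooth_on_Pair:
  "smooth_on S f \<Longrightarrow> smooth_on S g \<Longrightarrow> smooth_on S (\<lambda>x. (f x, g x))"
  by (simp add: smooth_on_def Ck_on_Pair)

lemma smooth_on_mult:
  fixes f g :: "'a::real_normed_vector \<Rightarrow> 'b::real_normed_algebra"
  shows "smooth_on S f \<Longrightarrow> smooth_on S g \<Longrightarrow> smooth_on S (\<lambda>x. f x * g x)"
  using smooth_on_bilinear[OF bounded_bilinear_mult] .

lemma smooth_on_diff:
  assumes "smooth_on S f" "smooth_on S g"
  shows "smooth_on S (\<lambda>x. f x - g x)"
  using smooth_on_add[OF assms(1) smooth_on_linear_compose[OF _ assms(2), of uminus]]
  by (simp add: bounded_linear_minus[OF bounded_linear_ident])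

lemma smooth_on_divide:
  fixes f g :: "'a::real_normed_vector \<Rightarrow> 'b::{euclidean_space, real_normed_field}"
  assumes "smooth_on S f" "smooth_on S g" "\<And>x. x \<in> S \<Longrightarrow> g x \<noteq> 0"
  shows "smooth_on S (\<lambda>x. f x / g x)"
proof -
  have "smooth_on (- {0}) (inverse :: 'b \<Rightarrow> 'b)"
    unfolding smooth_on_def using Ck_on_inverse by (metis ComplD insertI1 open_delete open_UNIV Compl_eq_Diff_UNIV)
  then have "smooth_on S (\<lambda>x. inverse (g x))"
    by (rule smooth_on_compose[OF _ assms(2)]) (use assms(3) in auto)
  then show ?thesis
    using smooth_on_mult[OF assms(1)] by (simp add: divide_inverse)
qed

subsection \<open>Orders of vanishing\<close>

text \<open>The filter is \<open>nhds 0\<close> and includes the point 0: for \<open>n > 0\<close>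
  the estimate forces the value 0 there. Composition then needs no proviso that the inner map avoids
  0.\<close>

definition near_O :: "nat \<Rightarrow> ('a::real_normed_vector \<Rightarrow> 'b::real_normed_vector) \<Rightarrow> bool" where
  "near_O n f \<longleftrightarrow> (\<exists>C. \<forall>\<^sub>F s in nhds 0. norm (f s) \<le> C * norm s ^ n)"

lemma near_OI: "\<forall>\<^sub>F s in nhds 0. norm (f s) \<le> C * norm s ^ n \<Longrightarrow> near_O n f"
  by (auto simp: near_O_def)

lemma near_OE:
  assumes "near_O n f"
  obtains C where "C > 0" "\<forall>\<^sub>F s in nhds 0. norm (f s) \<le> C * norm s ^ n"
proof -
  obtain C where C: "\<forall>\<^sub>F s in nhds 0. norm (f s) \<le> C * norm s ^ n"
    using assms by (auto simp: near_O_def)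
  have "\<forall>\<^sub>F s in nhds 0. norm (f s) \<le> max C 1 * norm s ^ n"
    using C by eventually_elim (smt (verit) max.cobounded1 mult_right_mono norm_ge_zero zero_le_power)
  then show ?thesis using that[of "max C 1"] by simp
qed

lemma near_O_cong:
  assumes "near_O n f" "\<forall>\<^sub>F s in nhds 0. f s = g s"
  shows "near_O n g"
proof -
  obtain C where "\<forall>\<^sub>F s in nhds 0. norm (f s) \<le> C * norm s ^ n"
    using assms by (auto simp: near_O_def)
  with assms(2) have "\<forall>\<^sub>F s in nhds 0. norm (g s) \<le> C * norm s ^ n"
    by eventually_elim simp
  then show ?thesis by (rule near_OI)
qed

lemma near_O_add:
  assumes "near_O n f" "near_O n g"
  shows "near_O n (\<lambda>s. f s + g s)"
proof -
  obtain C D where "\<forall>\<^sub>F s in nhds 0. norm (f s) \<le> C * norm s ^ n"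
    "\<forall>\<^sub>F s in nhds 0. norm (g s) \<le> D * norm s ^ n"
    using assms by (auto simp: near_O_def)
  then have "\<forall>\<^sub>F s in nhds 0. norm (f s + g s) \<le> (C + D) * norm s ^ n"
    by eventually_elim (smt (verit) distrib_right norm_triangle_ineq)
  then show ?thesis by (rule near_OI)
qed

lemma near_O_linear:
  assumes "bounded_linear L" "near_O n f"
  shows "near_O n (\<lambda>s. L (f s))"
proof -
  obtain K where K: "K > 0" "\<And>x. norm (L x) \<le> norm x * K"
    using bounded_linear.pos_bounded[OF assms(1)] by auto
  obtain C where C: "\<forall>\<^sub>F s in nhds 0. norm (f s) \<le> C * norm s ^ n"
    using assms by (auto simp: near_O_def)
  show ?thesis
  proof (rule near_OI[of _ "C * K"], use C in eventually_elim)
    case (elim s)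
    have "norm (L (f s)) \<le> norm (f s) * K" by (rule K(2))
    also have "\<dots> \<le> (C * norm s ^ n) * K" using elim K(1) by (intro mult_right_mono) auto
    finally show ?case by (simp add: mult_ac)
  qed
qed

lemma near_O_minus: "near_O n f \<Longrightarrow> near_O n (\<lambda>s. - f s)"
  by (auto simp: near_O_def)

lemma near_O_diff: "near_O n f \<Longrightarrow> near_O n g \<Longrightarrow> near_O n (\<lambda>s. f s - g s)"
  using near_O_add[of n f "\<lambda>s. - g s"] near_O_minus[of n g] by simp

lemma near_O_zero: "near_O n (\<lambda>s. 0)"
  by (rule near_OI[of _ 0]) auto

lemma near_O_mono:
  assumes "near_O n f" "m \<le> n"
  shows "near_O m f"
proof -
  obtain C where C: "C > 0" "\<forall>\<^sub>F s in nhds 0. norm (f s) \<le> C * norm s ^ n"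
    using near_OE[OF assms(1)] .
  have "\<forall>\<^sub>F s in nhds (0::'a). norm s \<le> 1"
    using eventually_nhds_ball[of 1 "0::'a"] by (auto elim: eventually_mono)
  note ev = this C(2)
  show ?thesis
  proof (rule near_OI[of _ C], use ev in eventually_elim)
    case (elim s)
    then show ?case
      by (smt (verit) C(1) assms(2) mult_left_mono norm_ge_zero power_decreasing)
  qed
qed

lemma near_O_Pair:
  assumes "near_O n f" "near_O n g"
  shows "near_O n (\<lambda>s. (f s, g s))"
proof -
  have "near_O n (\<lambda>s. (f s, 0) + (0, g s))"
    by (intro near_O_add near_O_linear[of "\<lambda>x. (x, 0)"] near_O_linear[of "\<lambda>x. (0, x)"] assms
        bounded_linear_Pair bounded_linear_ident bounded_linear_zero)
  then show ?thesis by simp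
qed

lemma near_O_mult:
  fixes f g :: "'a::real_normed_vector \<Rightarrow> 'b::real_normed_algebra"
  assumes "near_O m f" "near_O n g"
  shows "near_O (m + n) (\<lambda>s. f s * g s)"
proof -
  obtain C where C: "C > 0" "\<forall>\<^sub>F s in nhds 0. norm (f s) \<le> C * norm s ^ m"
    using near_OE[OF assms(1)] .
  obtain D where D: "D > 0" "\<forall>\<^sub>F s in nhds 0. norm (g s) \<le> D * norm s ^ n"
    using near_OE[OF assms(2)] .
  show ?thesis
  proof (rule near_OI[of _ "C * D"], use C(2) D(2) in eventually_elim)
    case (elim s)
    have "norm (f s * g s) \<le> norm (f s) * norm (g s)" by (rule norm_mult_ineq)
    also have "\<dots> \<le> (C * norm s ^ m) * (D * norm s ^ n)"
      using elim C(1) by (intro mult_mono) auto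
    finally show ?case by (simp add: power_add mult_ac)
  qed
qed

lemma near_O_power: "near_O n (\<lambda>z::'a::real_normed_field. c * z ^ n)"
  by (rule near_OI[of _ "norm c"]) (simp add: norm_mult norm_power)

lemma near_O_tendsto:
  assumes "near_O n f" "n > 0"
  shows "filterlim f (nhds 0) (nhds 0)" "f 0 = 0"
proof -
  obtain C where C: "C > 0" "\<forall>\<^sub>F s in nhds 0. norm (f s) \<le> C * norm s ^ n"
    using near_OE[OF assms(1)] .
  have t: "((\<lambda>s::'a. C * norm s ^ n) \<longlongrightarrow> 0) (nhds 0)"
    using assms(2) by (auto intro!: tendsto_eq_intros filterlim_ident simp: power_0_left)
  show "filterlim f (nhds 0) (nhds 0)"
    by (rule Lim_null_comparison[OF C(2) t])
  show "f 0 = 0"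
    using eventually_nhds_x_imp_x[OF C(2)] assms(2) by (auto simp: power_0_left)
qed

lemma near_O_compose:
  assumes "near_O n k" "near_O 1 y"
  shows "near_O n (\<lambda>s. k (y s))"
proof -
  obtain C where C: "C > 0" "\<forall>\<^sub>F s in nhds 0. norm (k s) \<le> C * norm s ^ n"
    using near_OE[OF assms(1)] .
  obtain D where D: "D > 0" "\<forall>\<^sub>F s in nhds 0. norm (y s) \<le> D * norm s ^ 1"
    using near_OE[OF assms(2)] .
  have "\<forall>\<^sub>F s in nhds 0. norm (k (y s)) \<le> C * norm (y s) ^ n"
    using eventually_compose_filterlim[OF C(2) near_O_tendsto(1)[OF assms(2)]] by simp
  note ev = this D(2)
  show ?thesis
  proof (rule near_OI[of _ "C * D ^ n"], use ev in eventually_elim)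
    case (elim s)
    have "C * norm (y s) ^ n \<le> C * (D * norm s) ^ n"
      using elim C(1) by (intro mult_left_mono power_mono) auto
    then show ?case using elim(1) by (simp add: power_mult_distrib mult_ac)
  qed
qed

lemma near_O_isCont:
  assumes "isCont f 0"
  shows "near_O 0 f"
proof (rule near_OI[of _ "norm (f 0) + 1"])
  have "(f \<longlongrightarrow> f 0) (nhds 0)" using assms
    by (simp add: isCont_def tendsto_at_iff_tendsto_nhds)
  then have "\<forall>\<^sub>F s in nhds 0. dist (f s) (f 0) < 1"
    by (rule tendstoD) simp
  then show "\<forall>\<^sub>F s in nhds 0. norm (f s) \<le> (norm (f 0) + 1) * norm s ^ 0"
    by eventually_elim (simp add: dist_norm, smt (verit) norm_triangle_sub)
qed

text \<open>Dividing by \<open>norm s ^ m\<close> leaves a bound of order one on \<open>q\<close>,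
  which tends to 0. This is the device by which orders and leading coefficients are compared
  throughout; \<open>q\<close> is a function so that non-constant cofactors are covered.\<close>

lemma near_O_leading_coeff_zero:
  fixes f :: "'a::{real_normed_vector, perfect_space} \<Rightarrow> 'b::real_normed_vector"
    and q :: "'a \<Rightarrow> 'c::real_normed_vector"
  assumes "near_O n f" "\<forall>\<^sub>F s in at 0. norm s ^ m * norm (q s) \<le> norm (f s)" "m < n" "isCont q 0"
  shows "q 0 = 0"
proof -
  obtain C where C: "C > 0" "\<forall>\<^sub>F s in nhds 0. norm (f s) \<le> C * norm s ^ Suc m"
    using near_OE[OF near_O_mono[OF assms(1), of "Suc m"]] assms(3) by auto
  have "\<forall>\<^sub>F s in at 0. norm (f s) \<le> C * norm s ^ Suc m"
    using C(2) by (simp add: eventually_nhds_conv_at)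
  moreover have "\<forall>\<^sub>F s in at (0::'a). s \<noteq> 0" by (simp add: eventually_at_filter)
  ultimately have "\<forall>\<^sub>F s in at 0. norm (q s) \<le> C * norm s"
    using assms(2)
  proof eventually_elim
    case (elim s)
    have "norm s ^ m * norm (q s) \<le> C * norm s ^ Suc m" using elim by linarith
    also have "\<dots> = norm s ^ m * (C * norm s)" by simp
    finally show ?case by (rule mult_left_le_imp_le) (use elim(2) in simp)
  qed
  moreover have "((\<lambda>s::'a. C * norm s) \<longlongrightarrow> 0) (at 0)"
    by (auto intro!: tendsto_eq_intros)
  ultimately have "(q \<longlongrightarrow> 0) (at 0)" by (rule Lim_null_comparison)
  moreover have "(q \<longlongrightarrow> q 0) (at 0)" using assms(4) by (simp add: isCont_def)
  ultimately show ?thesis using tendsto_unique trivial_limit_at by blast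
qed

lemma near_O_onorm:
  fixes L :: "'a::real_normed_vector \<Rightarrow> 'b::euclidean_space \<Rightarrow> 'c::real_normed_vector"
  assumes "\<forall>\<^sub>F z in nhds 0. bounded_linear (L z)" "\<And>b. b \<in> Basis \<Longrightarrow> near_O n (\<lambda>z. L z b)"
  obtains C where "C > 0" "\<forall>\<^sub>F z in nhds 0. onorm (L z) \<le> C * norm z ^ n"
proof -
  have "\<forall>b\<in>Basis. \<exists>C>0. \<forall>\<^sub>F s in nhds 0. norm (L s b) \<le> C * norm s ^ n"
    using near_OE[OF assms(2)] by metis
  then obtain C where C: "\<And>b. b \<in> Basis \<Longrightarrow> C b > 0"
    "\<And>b. b \<in> Basis \<Longrightarrow> \<forall>\<^sub>F s in nhds 0. norm (L s b) \<le> C b * norm s ^ n"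
    by metis
  have "\<forall>\<^sub>F s in nhds 0. \<forall>b\<in>Basis. norm (L s b) \<le> C b * norm s ^ n"
    using C(2) by (simp add: eventually_ball_finite)
  with assms(1) have "\<forall>\<^sub>F z in nhds 0. onorm (L z) \<le> (\<Sum>b\<in>Basis. C b) * norm z ^ n"
  proof eventually_elim
    case (elim z)
    have "onorm (L z) \<le> (\<Sum>b\<in>Basis. norm (L z b))"
      using onorm_componentwise[OF elim(1)] .
    also have "\<dots> \<le> (\<Sum>b\<in>Basis. C b * norm z ^ n)" using elim(2) by (intro sum_mono) auto
    finally show ?case by (simp add: sum_distrib_right)
  qed
  moreover have "(\<Sum>b\<in>Basis. C b) > 0" using C(1) by (intro sum_pos) auto
  ultimately show ?thesis using that by blast
qed

text \<open>The mean value inequality on the ball of radius \<open>norm z\<close>: integrating a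
  derivative of order \<open>n\<close> gains one order. It suffices to estimate the derivative on
  basis vectors.\<close>

lemma near_O_integrate:
  fixes f :: "'a::euclidean_space \<Rightarrow> 'b::real_normed_vector"
  assumes "open V" "0 \<in> V" "\<And>z. z \<in> V \<Longrightarrow> (f has_derivative f' z) (at z)" "f 0 = 0"
    "\<And>b. b \<in> Basis \<Longrightarrow> near_O n (\<lambda>z. f' z b)"
  shows "near_O (Suc n) f"
proof -
  have V: "\<forall>\<^sub>F z in nhds 0. z \<in> V" using assms(1,2) eventually_nhds_in_open by blast
  have bl: "\<forall>\<^sub>F z in nhds 0. bounded_linear (f' z)"
    using V by eventually_elim (use assms(3) has_derivative_bounded_linear in blast)
  obtain C where C: "C > 0" "\<forall>\<^sub>F z in nhds 0. onorm (f' z) \<le> C * norm z ^ n"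
    using near_O_onorm[OF bl assms(5)] by blast
  have "\<forall>\<^sub>F z in nhds 0. z \<in> V \<and> onorm (f' z) \<le> C * norm z ^ n"
    using V C(2) by eventually_elim simp
  then obtain e where e: "e > 0" "\<And>z. dist z 0 < e \<Longrightarrow> z \<in> V \<and> onorm (f' z) \<le> C * norm z ^ n"
    unfolding eventually_nhds_metric by blast
  have "norm (f z) \<le> C * norm z ^ Suc n" if "norm z < e" for z
  proof -
    have "norm (f z - f 0) \<le> (C * norm z ^ n) * norm (z - 0)"
    proof (rule differentiable_bound)
      show "convex (cball (0::'a) (norm z))" by simp
      fix x :: 'a assume "x \<in> cball 0 (norm z)"
      then have x: "norm x \<le> norm z" by simp
      then have x': "x \<in> V" "onorm (f' x) \<le> C * norm x ^ n" using e(2)[of x] that by auto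
      show "(f has_derivative f' x) (at x within cball 0 (norm z))"
        using assms(3)[OF x'(1)] has_derivative_at_withinI by blast
      show "onorm (f' x) \<le> C * norm z ^ n"
        using x'(2) x C(1) by (meson mult_left_mono norm_ge_zero order_less_imp_le order_trans power_mono)
    qed auto
    then show ?thesis using assms(4) by (simp add: mult_ac)
  qed
  then show ?thesis
    by (intro near_OI[of _ C]) (use e(1) in \<open>auto simp: eventually_nhds_metric\<close>)
qed

lemma near_O_differentiable:
  assumes "f differentiable (at 0)" "f 0 = 0"
  shows "near_O 1 f"
proof -
  obtain f' where f': "(f has_derivative f') (at 0)" using assms by (auto simp: differentiable_def)
  obtain K where K: "K > 0" "\<And>x. norm (f' x) \<le> norm x * K"
    using bounded_linear.pos_bounded[OF has_derivative_bounded_linear[OF f']] by auto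
  obtain d where d: "d > 0" "\<And>y. norm (y - 0) < d \<Longrightarrow> norm (f y - f 0 - f' (y - 0)) \<le> 1 * norm (y - 0)"
    using f' unfolding has_derivative_at_alt by (metis zero_less_one)
  show ?thesis
  proof (rule near_OI[of _ "K + 1"], unfold eventually_nhds_metric, intro exI[of _ d] conjI allI impI d(1))
    fix y :: 'a assume "dist y 0 < d"
    then have "norm (f y - f' y) \<le> norm y" using d(2)[of y] assms(2) by simp
    then have "norm (f y) \<le> norm y + norm (f' y)"
      by (smt (verit) norm_triangle_sub)
    then show "norm (f y) \<le> (K + 1) * norm y ^ 1" using K(2)[of y] by (simp add: algebra_simps)
  qed
qed

text \<open>The derivative of \<open>G\<close> differs from its value at 0 by the order of the
  distance to 0, which is one along the segment from \<open>y s\<close> to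
  \<open>y s + \<delta> s\<close>. So the derivative may be frozen at 0, at the price of one extra
  order, although the base point moves.\<close>

lemma near_O_linearization:
  fixes G :: "'a::euclidean_space \<Rightarrow> 'b::real_normed_vector"
    and y \<delta> :: "'c::real_normed_vector \<Rightarrow> 'a"
  assumes G: "smooth_on V G" "0 \<in> V" and y: "near_O 1 y" and \<delta>: "near_O n \<delta>" "n > 0"
  shows "near_O (Suc n) (\<lambda>s. G (y s + \<delta> s) - G (y s) - frechet_derivative G (at 0) (\<delta> s))"
proof -
  let ?D = "\<lambda>x. frechet_derivative G (at x)"
  note der = smooth_on_has_derivative[OF G(1)]
  have V: "\<forall>\<^sub>F z in nhds 0. z \<in> V" using smooth_on_open[OF G(1)] G(2) eventually_nhds_in_open by blast
  have bl0: "bounded_linear (?D 0)" using der[OF G(2)] has_derivative_bounded_linear by blast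
  have bl: "\<forall>\<^sub>F z in nhds 0. bounded_linear (\<lambda>v. ?D z v - ?D 0 v)"
    using V by eventually_elim
      (use der has_derivative_bounded_linear bl0 bounded_linear_sub in blast)
  have lip: "near_O 1 (\<lambda>z. ?D z b - ?D 0 b)" for b
  proof (rule near_O_differentiable)
    have "(\<lambda>x. ?D x b) differentiable (at 0)"
      using smooth_on_has_derivative[OF smooth_on_frechet[OF G(1)] G(2), of b]
      by (auto simp: differentiable_def)
    then show "(\<lambda>z. ?D z b - ?D 0 b) differentiable (at 0)" by simp
  qed simp
  obtain C where C: "C > 0" "\<forall>\<^sub>F z in nhds 0. onorm (\<lambda>v. ?D z v - ?D 0 v) \<le> C * norm z ^ 1"
    using near_O_onorm[OF bl, of 1] lip by blast
  have "\<forall>\<^sub>F z in nhds 0. z \<in> V \<and> onorm (\<lambda>v. ?D z v - ?D 0 v) \<le> C * norm z"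
    using V C(2) by eventually_elim simp
  then obtain e where e: "e > 0" "\<And>z. dist z 0 < e \<Longrightarrow> z \<in> V \<and> onorm (\<lambda>v. ?D z v - ?D 0 v) \<le> C * norm z"
    unfolding eventually_nhds_metric by blast
  obtain A where A: "A > 0" "\<forall>\<^sub>F s in nhds 0. norm (y s) \<le> A * norm s ^ 1"
    using near_OE[OF y] .
  obtain B where B: "B > 0" "\<forall>\<^sub>F s in nhds 0. norm (\<delta> s) \<le> B * norm s ^ n"
    using near_OE[OF \<delta>(1)] .
  obtain B' where B': "B' > 0" "\<forall>\<^sub>F s in nhds 0. norm (\<delta> s) \<le> B' * norm s ^ 1"
    using near_OE[OF near_O_mono[OF \<delta>(1), of 1]] \<delta>(2) by auto
  have "((\<lambda>s::'c. (A + B') * norm s) \<longlongrightarrow> 0) (nhds 0)"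
    by (auto intro!: tendsto_eq_intros filterlim_ident)
  then have "\<forall>\<^sub>F s in nhds (0::'c). (A + B') * norm s < e"
    using e(1) order_tendstoD(2) by blast
  note ev = A(2) B(2) B'(2) this
  show ?thesis
  proof (rule near_OI[of _ "B * (C * (A + B'))"], use ev in eventually_elim)
    case (elim s)
    have "norm (G (y s + \<delta> s) - G (y s) - ?D 0 (y s + \<delta> s - y s))
      \<le> norm (y s + \<delta> s - y s) * (C * ((A + B') * norm s))"
    proof (rule differentiable_bound_linearization[where S="cball 0 ((A + B') * norm s)" and f'="?D"])
      fix t :: real assume t: "t \<in> {0..1}"
      have "norm (y s + t *\<^sub>R \<delta> s) \<le> norm (y s) + t * norm (\<delta> s)"
        using norm_triangle_ineq[of "y s" "t *\<^sub>R \<delta> s"] t by simp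
      also have "\<dots> \<le> norm (y s) + 1 * norm (\<delta> s)"
        using t by (intro add_left_mono mult_right_mono) auto
      also have "\<dots> \<le> (A + B') * norm s" using elim by (simp add: algebra_simps)
      finally show "y s + t *\<^sub>R (y s + \<delta> s - y s) \<in> cball 0 ((A + B') * norm s)" by simp
    next
      fix x :: 'a assume "x \<in> cball 0 ((A + B') * norm s)"
      then have x: "norm x \<le> (A + B') * norm s" by simp
      then have x': "x \<in> V" "onorm (\<lambda>v. ?D x v - ?D 0 v) \<le> C * norm x" using e(2)[of x] elim by auto
      show "(G has_derivative ?D x) (at x within cball 0 ((A + B') * norm s))"
        using der[OF x'(1)] has_derivative_at_withinI by blast
      have "C * norm x \<le> C * ((A + B') * norm s)" using x C(1) by simp
      with x'(2) show "onorm (?D x - ?D 0) \<le> C * ((A + B') * norm s)"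
        by (simp add: fun_diff_def)
    qed (use A B' in auto)
    also have "\<dots> \<le> (B * norm s ^ n) * (C * ((A + B') * norm s))"
      using elim A B' C(1) by (intro mult_right_mono) auto
    finally show ?case by (simp add: mult_ac)
  qed
qed

subsection \<open>Contact of holomorphic half-disks\<close>

text \<open>All directional derivatives vanish on the same half-disk, so induction and integration
  apply once the value at 0 is known to be 0. Nothing is assumed below the real axis.\<close>

lemma near_O_vanishing_on_upper_half:
  fixes k :: "complex \<Rightarrow> 'b::real_normed_vector"
  assumes "smooth_on V k" "0 \<in> V" "\<rho> > 0" "\<And>z. norm z < \<rho> \<Longrightarrow> Im z > 0 \<Longrightarrow> z \<in> V \<Longrightarrow> k z = 0"
  shows "near_O n k"
  using assms(1,4)
proof (induction n arbitrary: k)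
  case 0
  then have "isCont k 0"
    using smooth_on_has_derivative[OF 0(1) assms(2)] has_derivative_continuous by blast
  then show ?case by (rule near_O_isCont)
next
  case (Suc n)
  have V: "open V" using Suc.prems(1) smooth_on_open by blast
  have k0: "k 0 = 0"
  proof -
    have "isCont k 0"
      using smooth_on_has_derivative[OF Suc.prems(1) assms(2)] has_derivative_continuous by blast
    then have "(k \<longlongrightarrow> k 0) (nhds 0)" by (simp add: isCont_def tendsto_at_iff_tendsto_nhds)
    \<comment> \<open>The value at 0 is reached by continuity from inside the half-plane, along the
      positive imaginary axis.\<close>
    moreover have lim: "((\<lambda>x::real. \<i> * of_real x) \<longlongrightarrow> 0) (at_right 0)"
      by (auto intro!: tendsto_eq_intros)
    ultimately have "((\<lambda>x::real. k (\<i> * of_real x)) \<longlongrightarrow> k 0) (at_right 0)"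
      by (rule filterlim_compose)
    moreover have "\<forall>\<^sub>F x in at_right (0::real). k (\<i> * of_real x) = 0"
    proof -
      have "\<forall>\<^sub>F x in at_right (0::real). \<i> * of_real x \<in> V"
        using topological_tendstoD[OF lim V assms(2)] .
      moreover have "\<forall>\<^sub>F x in at_right (0::real). x > 0 \<and> x < \<rho>"
        using assms(3) by (auto simp: eventually_at_right_field)
      ultimately show ?thesis
        by eventually_elim (rule Suc.prems(2), auto simp: norm_mult)
    qed
    ultimately show ?thesis
      using tendsto_eventually tendsto_unique trivial_limit_at_right_real by metis
  qed
  show ?case
  proof (rule near_O_integrate[OF V assms(2) smooth_on_has_derivative[OF Suc.prems(1)] k0])
    fix b :: complex
    show "near_O n (\<lambda>z. frechet_derivative k (at z) b)"
    proof (rule Suc.IH[OF smooth_on_frechet[OF Suc.prems(1)]])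
      fix z assume z: "norm z < \<rho>" "Im z > 0" "z \<in> V"
      let ?W = "V \<inter> ball 0 \<rho> \<inter> {z. Im z > 0}"
      have "open ?W" using V open_halfspace_Im_gt by (intro open_Int) auto
      moreover have "z \<in> ?W" using z by simp
      ultimately have "((\<lambda>_. 0) has_derivative frechet_derivative k (at z)) (at z)"
        using has_derivative_transform_within_open[OF smooth_on_has_derivative[OF Suc.prems(1) z(3)]]
          Suc.prems(2) by (metis (no_types, lifting) Int_iff dist_0_norm mem_Collect_eq mem_ball)
      then show "frechet_derivative k (at z) b = 0"
        using has_derivative_unique has_derivative_const by metis
    qed
  qed auto
qed

lemma pderiv_surj: "\<exists>P. pderiv P = (p :: complex poly)"
proof -
  have "pderiv (\<Sum>i\<le>degree p. monom (coeff p i / of_nat (Suc i)) (Suc i)) = (\<Sum>i\<le>degree p. monom (coeff p i) i)"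
    by (subst sum_comp_morphism[of pderiv, symmetric, unfolded o_def])
      (auto intro!: sum.cong simp: pderiv_add pderiv_monom simp del: of_nat_Suc)
  then show ?thesis by (metis poly_as_sum_of_monoms)
qed

text \<open>A real Taylor polynomial could involve \<open>cnj z\<close>. Holomorphy above the axis
  rules this out: induction applies to the derivative in direction 1, the Cauchy-Riemann equation
  gives direction \<open>\<i>\<close>, and integration yields a polynomial in
  \<open>z\<close>.\<close>

lemma taylor_holomorphic_upper_half:
  fixes g :: "complex \<Rightarrow> complex"
  assumes "smooth_on V g" "0 \<in> V" "\<rho> > 0" "g holomorphic_on {z\<in>V. norm z < \<rho> \<and> Im z > 0}"
  shows "\<exists>p. near_O n (\<lambda>z. g z - poly p z)"
  using assms(1,4)
proof (induction n arbitrary: g)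
  case 0
  have "isCont g 0"
    using smooth_on_has_derivative[OF 0(1) assms(2)] has_derivative_continuous by blast
  then have "near_O 0 (\<lambda>z. g z - poly 0 z)" by (auto intro: near_O_isCont)
  then show ?case by blast
next
  case (Suc n)
  let ?W = "{z\<in>V. norm z < \<rho> \<and> Im z > 0}"
  let ?D = "\<lambda>z. frechet_derivative g (at z)"
  have V: "open V" using Suc.prems(1) smooth_on_open by blast
  have "?W = V \<inter> ball 0 \<rho> \<inter> {z. Im z > 0}" by auto
  then have W: "open ?W" using V open_halfspace_Im_gt by (metis open_Int open_ball)
  have D: "?D z v = deriv g z * v" if "z \<in> ?W" for z v
  proof -
    have "(g has_derivative (*) (deriv g z)) (at z)"
      using holomorphic_derivI[OF Suc.prems(2) W that] by (simp add: has_field_derivative_def)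
    then show ?thesis by (metis frechet_derivative_at)
  qed
  have "deriv g holomorphic_on ?W" using holomorphic_deriv[OF Suc.prems(2) W] .
  then have "(\<lambda>z. ?D z 1) holomorphic_on ?W"
    by (rule holomorphic_transform) (simp add: D)
  then obtain p where p: "near_O n (\<lambda>z. ?D z 1 - poly p z)"
    using Suc.IH[OF smooth_on_frechet[OF Suc.prems(1)]] by blast
  \<comment> \<open>The Cauchy-Riemann defect is zero above the axis, hence vanishes to every order
    at 0 even though it need not vanish below.\<close>
  have "near_O n (\<lambda>z. ?D z \<i> - \<i> * ?D z 1)"
  proof (rule near_O_vanishing_on_upper_half[OF _ assms(2,3)])
    show "smooth_on V (\<lambda>z. ?D z \<i> - \<i> * ?D z 1)"
      by (intro smooth_on_diff smooth_on_linear_compose[OF bounded_linear_mult_right]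
          smooth_on_frechet Suc.prems(1))
  qed (simp add: D)
  from near_O_add[OF this near_O_linear[OF bounded_linear_mult_right p, of \<i>]]
  have pi: "near_O n (\<lambda>z. ?D z \<i> - poly p z * \<i>)" by (simp add: algebra_simps)
  obtain P where P: "pderiv P = p" using pderiv_surj by blast
  define Q where "Q = P + [:g 0 - poly P 0:]"
  have Q: "pderiv Q = p" "poly Q 0 = g 0" by (auto simp: Q_def pderiv_add P pderiv_pCons)
  have "near_O (Suc n) (\<lambda>z. g z - poly Q z)"
  proof (rule near_O_integrate[OF V assms(2)])
    fix z assume z: "z \<in> V"
    have "(poly Q has_derivative (\<lambda>v. poly p z * v)) (at z)"
      using poly_DERIV[of Q z] Q(1) by (simp add: has_field_derivative_def)
    then show "((\<lambda>z. g z - poly Q z) has_derivative (\<lambda>v. ?D z v - poly p z * v)) (at z)"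
      using smooth_on_has_derivative[OF Suc.prems(1) z] has_derivative_diff by blast
  next
    fix b :: complex assume "b \<in> Basis"
    then have "b = 1 \<or> b = \<i>" by (auto simp: Basis_complex_def)
    then show "near_O n (\<lambda>z. ?D z b - poly p z * b)" using p pi by auto
  qed (simp add: Q)
  then show ?case by blast
qed

lemma near_O_poly: "poly q 0 = 0 \<Longrightarrow> near_O 1 (poly q :: complex \<Rightarrow> complex)"
  by (rule near_O_differentiable)
    (use poly_DERIV[of q 0] in \<open>auto simp: differentiable_def has_field_derivative_def\<close>)

lemma near_O_poly_leading_term:
  fixes q :: "complex poly"
  assumes "near_O n (poly q)"
  shows "\<exists>c. near_O (Suc n) (\<lambda>z. poly q z - c * z ^ n)"
proof (cases "q = 0")
  case True
  then show ?thesis by (auto intro!: exI[of _ 0] near_O_zero)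
next
  case False
  obtain r where r: "q = [:-0, 1:] ^ order 0 q * r" "\<not> [:-0, 1:] dvd r"
    using order_decomp[OF False, of 0] by blast
  have qz: "poly q z = z ^ order 0 q * poly r z" for z
    by (subst r(1)) (simp add: poly_power)
  have "\<not> order 0 q < n"
  proof
    assume "order 0 q < n"
    then have "poly r 0 = 0"
      by (intro near_O_leading_coeff_zero[OF assms, where m="order 0 q"])
        (auto simp: qz norm_mult norm_power)
    then show False using r(2) by (simp add: poly_eq_0_iff_dvd)
  qed
  then obtain m where m: "order 0 q = n + m" using le_Suc_ex by (metis not_less)
  \<comment> \<open>\<open>t\<close> is \<open>q\<close> divided by the \<open>n\<close>-th power of
    the variable; its value at 0 is the wanted coefficient, and it is 0 when \<open>q\<close>
    vanishes to higher order.\<close>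
  define t where "t = monom 1 m * r"
  have "near_O 1 (poly (t - [:poly t 0:]))" by (rule near_O_poly) simp
  from near_O_mult[OF near_O_power[of n 1] this]
  have "near_O (Suc n) (\<lambda>z. poly q z - poly t 0 * z ^ n)"
    by (simp add: qz m t_def poly_monom power_add algebra_simps)
  then show ?thesis by blast
qed

section \<open>Complex lines in complex two-space\<close>

definition cscale :: "complex \<Rightarrow> complex \<times> complex \<Rightarrow> complex \<times> complex" where
  "cscale c p = (c * fst p, c * snd p)"

lemma bounded_linear_cscale: "bounded_linear (\<lambda>c. cscale c p)"
  unfolding cscale_def by (intro bounded_linear_Pair bounded_linear_mult_left)

lemma near_O_cscale_power: "near_O n (\<lambda>z. cscale (c * z ^ n) p)"
  by (rule near_O_linear[OF bounded_linear_cscale near_O_power])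

definition orth_vec :: "complex \<times> complex \<Rightarrow> complex \<times> complex" where
  "orth_vec v = (- cnj (snd v), cnj (fst v))"

lemma orth_decomposition:
  assumes "v \<noteq> 0"
  shows "\<exists>t a. p = cscale t v + cscale a (orth_vec v)"
proof -
  obtain v1 v2 where v: "v = (v1, v2)" by force
  obtain p1 p2 where p: "p = (p1, p2)" by force
  define n where "n = v1 * cnj v1 + v2 * cnj v2"
  have n: "n \<noteq> 0"
  proof
    assume "n = 0"
    then have "complex_of_real ((norm v1)\<^sup>2 + (norm v2)\<^sup>2) = 0"
      unfolding n_def of_real_add complex_norm_square .
    then have "(norm v1)\<^sup>2 + (norm v2)\<^sup>2 = 0" by (simp only: of_real_eq_0_iff)
    then show False using assms v by (simp add: add_nonneg_eq_0_iff zero_prod_def)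
  qed
  \<comment> \<open>The coefficients are the Hermitian products of \<open>p\<close> with
    \<open>v\<close> and with \<open>orth_vec v\<close>, divided by the common squared length
    \<open>n\<close> of these two vectors.\<close>
  let ?t = "(cnj v1 * p1 + cnj v2 * p2) / n" and ?a = "(v1 * p2 - v2 * p1) / n"
  have "n * p1 = (cnj v1 * p1 + cnj v2 * p2) * v1 + (v1 * p2 - v2 * p1) * (- cnj v2)"
    "n * p2 = (cnj v1 * p1 + cnj v2 * p2) * v2 + (v1 * p2 - v2 * p1) * cnj v1"
    by (simp_all add: n_def algebra_simps)
  then have "p = cscale ?t v + cscale ?a (orth_vec v)"
    using n by (simp add: v p cscale_def orth_vec_def field_simps)
  then show ?thesis by blast
qed

text \<open>The polynomial \<open>\<sigma>\<close> reparametrizes the first disk so that the second one agrees with it to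
  the highest possible order; what remains is transverse to both.\<close>

lemma contact_expansion:
  fixes g1 g2 :: "complex \<Rightarrow> complex \<times> complex"
  assumes g1: "smooth_on V1 g1" "0 \<in> V1" "g1 0 = 0"
    and g2: "smooth_on V2 g2" "0 \<in> V2" "g2 0 = 0"
    and hol: "\<rho> > 0"
      "(\<lambda>z. fst (g1 z)) holomorphic_on {z\<in>V1. norm z < \<rho> \<and> Im z > 0}"
      "(\<lambda>z. snd (g1 z)) holomorphic_on {z\<in>V1. norm z < \<rho> \<and> Im z > 0}"
      "(\<lambda>z. fst (g2 z)) holomorphic_on {z\<in>V2. norm z < \<rho> \<and> Im z > 0}"
      "(\<lambda>z. snd (g2 z)) holomorphic_on {z\<in>V2. norm z < \<rho> \<and> Im z > 0}"
    and D: "v \<noteq> 0" "\<And>z. frechet_derivative g1 (at 0) z = cscale z v"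
      "\<And>z. frechet_derivative g2 (at 0) z = cscale (s * z) v"
    and d: "d \<ge> 1"
  obtains \<sigma> a e where "near_O 1 (poly \<sigma>)" "1 \<le> e" "e \<le> d" "a \<noteq> 0 \<or> e = d" "d = 1 \<Longrightarrow> a = 0"
    "near_O (Suc e) (\<lambda>z. g2 z - g1 (poly \<sigma> z) - cscale (a * z ^ e) (orth_vec v))"
proof -
  note result = that
  have poly_approx: "\<exists>p q. near_O n (\<lambda>z. g z - (poly p z, poly q z))"
    if g: "smooth_on V g" "0 \<in> V" "(\<lambda>z. fst (g z)) holomorphic_on {z\<in>V. norm z < \<rho> \<and> Im z > 0}"
      "(\<lambda>z. snd (g z)) holomorphic_on {z\<in>V. norm z < \<rho> \<and> Im z > 0}" for g :: "complex \<Rightarrow> complex \<times> complex" and V n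
  proof -
    obtain p where p: "near_O n (\<lambda>z. fst (g z) - poly p z)"
      using taylor_holomorphic_upper_half[OF smooth_on_linear_compose[OF bounded_linear_fst g(1)] g(2) hol(1) g(3)] by blast
    obtain q where q: "near_O n (\<lambda>z. snd (g z) - poly q z)"
      using taylor_holomorphic_upper_half[OF smooth_on_linear_compose[OF bounded_linear_snd g(1)] g(2) hol(1) g(4)] by blast
    have "(fst (g z) - poly p z, snd (g z) - poly q z) = g z - (poly p z, poly q z)" for z
      by (simp add: prod_eq_iff)
    with near_O_Pair[OF p q] show ?thesis by auto
  qed
  let ?R = "\<lambda>\<sigma> z. g2 z - g1 (poly \<sigma> z)"
  \<comment> \<open>Alternative \<open>?A\<close> records that a transverse term has appeared at
    some order \<open>e\<close>; \<open>?B\<close> says that the disks agree beyond order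
    \<open>d\<close> after reparametrization. The induction decides between them order by
    order.\<close>
  let ?A = "\<lambda>d. \<exists>\<sigma> a e. near_O 1 (poly \<sigma>) \<and> 1 \<le> e \<and> e \<le> d \<and> a \<noteq> 0 \<and>
    near_O (Suc e) (\<lambda>z. ?R \<sigma> z - cscale (a * z ^ e) (orth_vec v))"
  let ?B = "\<lambda>d. \<exists>\<sigma>. near_O 1 (poly \<sigma>) \<and> near_O (Suc d) (?R \<sigma>)"
  \<comment> \<open>The linear parts are \<open>s * z\<close> and \<open>z\<close> times the same
    vector \<open>v\<close>, so the linear reparametrization by \<open>s\<close> already removes all
    first-order terms.\<close>
  have base: "?B 1"
  proof (intro exI[of _ "[:0, s:]"] conjI)
    show n1: "near_O 1 (poly [:0, s:])" by (rule near_O_poly) simp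
    have "near_O 2 (\<lambda>z. g z - frechet_derivative g (at 0) z)"
      if g: "smooth_on V g" "0 \<in> V" "g 0 = 0" for g :: "complex \<Rightarrow> complex \<times> complex" and V
      using near_O_linearization[OF g(1,2) near_O_zero, where \<delta>="\<lambda>z. z" and n=1] g(3)
        near_O_power[of 1 1] by (simp add: numeral_2_eq_2)
    from near_O_diff[OF this[OF g2] near_O_compose[OF this[OF g1] n1]]
    show "near_O (Suc 1) (?R [:0, s:])" by (simp add: D numeral_2_eq_2 mult_ac)
  qed
  have "?A d \<or> ?B d" using d
  proof (induction d rule: dec_induct)
    case base
    then show ?case using \<open>?B 1\<close> by blast
  next
    case (step d)
    show ?case
    proof (cases "?A d")
      case True
      then show ?thesis using le_SucI by blast
    next
      case False
      then obtain \<sigma> where \<sigma>: "near_O 1 (poly \<sigma>)" "near_O (Suc d) (?R \<sigma>)" using step by blast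
      \<comment> \<open>Polynomial approximations on both sides show that the remainder has a
        leading term which is a complex monomial with vector coefficient
        \<open>(c1, c2)\<close>.\<close>
      obtain p q where pq: "near_O (Suc (Suc d)) (\<lambda>z. g1 z - (poly p z, poly q z))"
        using poly_approx[OF g1(1,2) hol(2,3)] by blast
      obtain p' q' where pq': "near_O (Suc (Suc d)) (\<lambda>z. g2 z - (poly p' z, poly q' z))"
        using poly_approx[OF g2(1,2) hol(4,5)] by blast
      define P where "P = p' - pcompose p \<sigma>"
      define Q where "Q = q' - pcompose q \<sigma>"
      from near_O_diff[OF pq' near_O_compose[OF pq \<sigma>(1)]]
      have RPQ: "near_O (Suc (Suc d)) (\<lambda>z. ?R \<sigma> z - (poly P z, poly Q z))"
        by (rule near_O_cong)
          (simp add: P_def Q_def poly_pcompose prod_eq_iff algebra_simps)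
      from near_O_diff[OF \<sigma>(2) near_O_mono[OF this, of "Suc d"]]
      have PQ: "near_O (Suc d) (\<lambda>z. (poly P z, poly Q z))" by simp
      obtain c1 where c1: "near_O (Suc (Suc d)) (\<lambda>z. poly P z - c1 * z ^ Suc d)"
        using near_O_poly_leading_term[of "Suc d" P] near_O_linear[OF bounded_linear_fst PQ] by auto
      obtain c2 where c2: "near_O (Suc (Suc d)) (\<lambda>z. poly Q z - c2 * z ^ Suc d)"
        using near_O_poly_leading_term[of "Suc d" Q] near_O_linear[OF bounded_linear_snd PQ] by auto
      obtain t a where ta: "(c1, c2) = cscale t v + cscale a (orth_vec v)"
        using orth_decomposition[OF D(1)] by blast
      \<comment> \<open>Adding this monomial to \<open>\<sigma>\<close> moves the first disk by the
        same monomial times \<open>v\<close>, up to higher order. It absorbs the tangential part of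
        the leading term and leaves only the part along \<open>orth_vec v\<close>.\<close>
      define \<sigma>' where "\<sigma>' = \<sigma> + monom t (Suc d)"
      have \<sigma>': "poly \<sigma>' z = poly \<sigma> z + t * z ^ Suc d" for z by (simp add: \<sigma>'_def poly_monom)
      have "near_O 1 (\<lambda>z. t * z ^ Suc d)" using near_O_mono[OF near_O_power[of "Suc d" t], of 1] by simp
      with \<sigma>(1) have n1: "near_O 1 (poly \<sigma>')" unfolding \<sigma>' by (rule near_O_add)
      have "near_O (Suc (Suc d)) (\<lambda>z. g1 (poly \<sigma>' z) - g1 (poly \<sigma> z) - cscale (t * z ^ Suc d) v)"
        using near_O_linearization[OF g1(1,2) \<sigma>(1) near_O_power[of "Suc d" t]] 
        unfolding \<sigma>' D by simp
      from near_O_diff[OF near_O_add[OF RPQ near_O_Pair[OF c1 c2]] this]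
      have fin: "near_O (Suc (Suc d)) (\<lambda>z. ?R \<sigma>' z - cscale (a * z ^ Suc d) (orth_vec v))"
      proof (rule near_O_cong, intro always_eventually allI)
        fix z
        have "(c1 * z ^ Suc d, c2 * z ^ Suc d) = cscale (z ^ Suc d) (c1, c2)" 
          by (simp add: cscale_def mult_ac)
        also have "\<dots> = cscale (t * z ^ Suc d) v + cscale (a * z ^ Suc d) (orth_vec v)"
          unfolding ta by (simp add: cscale_def algebra_simps)
        finally have *: "(poly P z - c1 * z ^ Suc d, poly Q z - c2 * z ^ Suc d) =
           (poly P z, poly Q z) - (cscale (t * z ^ Suc d) v + cscale (a * z ^ Suc d) (orth_vec v))"
          by (metis diff_Pair)
        show "g2 z - g1 (poly \<sigma> z) - (poly P z, poly Q z) +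
          (poly P z - c1 * z ^ Suc d, poly Q z - c2 * z ^ Suc d) -
          (g1 (poly \<sigma>' z) - g1 (poly \<sigma> z) - cscale (t * z ^ Suc d) v) =
          ?R \<sigma>' z - cscale (a * z ^ Suc d) (orth_vec v)"
          unfolding * by simp
      qed
      show ?thesis
      proof (cases "a = 0")
        case True
        then have "near_O (Suc (Suc d)) (?R \<sigma>')" using fin by (simp add: cscale_def flip: zero_prod_def)
        then show ?thesis using n1 by blast
      next
        case False
        then show ?thesis using n1 fin by (intro disjI1 exI[of _ \<sigma>'] exI[of _ a] exI[of _ "Suc d"]) auto
      qed
    qed
  qed
  have B: ?thesis if B: "?B d"
  proof -
    obtain \<sigma> where "near_O 1 (poly \<sigma>)" "near_O (Suc d) (?R \<sigma>)" using B by blast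
    \<comment> \<open>If no transverse term has been found up to order \<open>d\<close>, the
      conclusion holds with \<open>e = d\<close> and coefficient 0.\<close>
    then show ?thesis using d by (intro result[of \<sigma> d 0]) (auto simp: cscale_def simp flip: zero_prod_def)
  qed
  show ?thesis
  \<comment> \<open>At order one the alternative \<open>?B\<close> is available outright, which
    gives the claim that \<open>a = 0\<close> when \<open>d = 1\<close>.\<close>
  proof (cases "d = 1")
    case True
    then show ?thesis using B base by simp
  next
    case False
    then show ?thesis using B \<open>?A d \<or> ?B d\<close> that by blast
  qed
qed

subsection \<open>Continuous logarithms and degree\<close>

text \<open>The factor never vanishes, so \<open>f\<close> and \<open>g\<close> have the same zeros
  in \<open>S\<close>; on a circle that avoids the zeros, they have the same winding number. This
  replaces homotopy classes by a relation that can be multiplied.\<close>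

definition log_equiv :: "complex set \<Rightarrow> (complex \<Rightarrow> complex) \<Rightarrow> (complex \<Rightarrow> complex) \<Rightarrow> bool" where
  "log_equiv S f g \<longleftrightarrow> (\<exists>L. continuous_on S L \<and> (\<forall>z\<in>S. f z = g z * exp (L z)))"

lemma log_equivI:
  "continuous_on S L \<Longrightarrow> (\<And>z. z \<in> S \<Longrightarrow> f z = g z * exp (L z)) \<Longrightarrow> log_equiv S f g"
  by (auto simp: log_equiv_def)

lemma log_equivE:
  assumes "log_equiv S f g"
  obtains L where "continuous_on S L" "\<forall>z\<in>S. f z = g z * exp (L z)"
  using assms by (auto simp: log_equiv_def)

lemma log_equiv_eq: "(\<And>z. z \<in> S \<Longrightarrow> f z = g z) \<Longrightarrow> log_equiv S f g"
  by (rule log_equivI[of _ "\<lambda>_. 0"]) auto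

lemma log_equiv_sym:
  assumes "log_equiv S f g"
  shows "log_equiv S g f"
proof -
  obtain L where L0: "continuous_on S L" "\<forall>z\<in>S. f z = g z * exp (L z)"
    using log_equivE[OF assms] .
  note L = L0(1) bspec[OF L0(2)]
  show ?thesis
    by (rule log_equivI[of _ "\<lambda>z. - L z"])
      (auto simp: L(2) exp_minus intro!: continuous_intros L(1))
qed

lemma log_equiv_trans:
  assumes "log_equiv S f g" "log_equiv S g h"
  shows "log_equiv S f h"
proof -
  obtain L where L0: "continuous_on S L" "\<forall>z\<in>S. f z = g z * exp (L z)"
    using log_equivE[OF assms(1)] .
  note L = L0(1) bspec[OF L0(2)]
  obtain M where M0: "continuous_on S M" "\<forall>z\<in>S. g z = h z * exp (M z)"
    using log_equivE[OF assms(2)] .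
  note M = M0(1) bspec[OF M0(2)]
  show ?thesis
    by (rule log_equivI[of _ "\<lambda>z. M z + L z"])
      (auto simp: L(2) M(2) exp_add intro!: continuous_intros L(1) M(1))
qed

lemma log_equiv_mult:
  assumes "log_equiv S f g" "log_equiv S f' g'"
  shows "log_equiv S (\<lambda>z. f z * f' z) (\<lambda>z. g z * g' z)"
proof -
  obtain L where L0: "continuous_on S L" "\<forall>z\<in>S. f z = g z * exp (L z)"
    using log_equivE[OF assms(1)] .
  note L = L0(1) bspec[OF L0(2)]
  obtain M where M0: "continuous_on S M" "\<forall>z\<in>S. f' z = g' z * exp (M z)"
    using log_equivE[OF assms(2)] .
  note M = M0(1) bspec[OF M0(2)]
  show ?thesis
    by (rule log_equivI[of _ "\<lambda>z. L z + M z"])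
      (auto simp: L(2) M(2) exp_add mult_ac intro!: continuous_intros L(1) M(1))
qed

lemma log_equiv_prod:
  assumes "finite I" "\<And>i. i \<in> I \<Longrightarrow> log_equiv S (f i) (g i)"
  shows "log_equiv S (\<lambda>z. \<Prod>i\<in>I. f i z) (\<lambda>z. \<Prod>i\<in>I. g i z)"
  using assms
proof (induction I rule: finite_induct)
  case empty
  show ?case by (rule log_equiv_eq) simp
next
  case (insert i I)
  then show ?case using log_equiv_mult[of S "f i" "g i"] by simp
qed

lemma log_equiv_subset: "log_equiv S f g \<Longrightarrow> T \<subseteq> S \<Longrightarrow> log_equiv T f g"
  unfolding log_equiv_def using continuous_on_subset by blast

lemma log_equiv_const: "c \<noteq> 0 \<Longrightarrow> log_equiv S (\<lambda>z. c * f z) f"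
  by (rule log_equivI[of _ "\<lambda>_. Ln c"]) auto

text \<open>The hypothesis of Rouche: the quotient stays within distance 1 of 1, hence in the right
  half-plane, where the principal logarithm is continuous.\<close>

lemma log_equiv_close:
  assumes "continuous_on S f" "continuous_on S g" "\<And>z. z \<in> S \<Longrightarrow> norm (f z - g z) < norm (g z)"
  shows "log_equiv S f g"
proof (rule log_equivI[of _ "\<lambda>z. Ln (f z / g z)"])
  have nz: "g z \<noteq> 0" "f z \<noteq> 0" if "z \<in> S" for z using assms(3)[OF that] by auto
  have "f z / g z \<notin> \<real>\<^sub>\<le>\<^sub>0" if "z \<in> S" for z
  proof -
    have "norm (f z / g z - 1) = norm (f z - g z) / norm (g z)"
      using nz[OF that] by (simp add: diff_divide_distrib flip: norm_divide)
    also have "\<dots> < 1" using assms(3)[OF that] nz[OF that] by (simp add: divide_less_eq)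
    finally have "Re (f z / g z) > 0"
      using abs_Re_le_cmod[of "f z / g z - 1"] by (simp add: abs_less_iff)
    then show ?thesis by (auto simp: complex_nonpos_Reals_iff)
  qed
  then show "continuous_on S (\<lambda>z. Ln (f z / g z))"
    using nz by (intro continuous_intros assms) auto
  show "f z = g z * exp (Ln (f z / g z))" if "z \<in> S" for z using nz[OF that] by simp
qed

text \<open>A nonzero power of \<open>z\<close> has no continuous logarithm on a circle: following
  it once around changes the logarithm by a nonzero multiple of the period.\<close>

lemma winding_power_unique:
  assumes "r > 0" "log_equiv (sphere 0 r) (\<lambda>z. z powi p) (\<lambda>z. z powi q)"
  shows "p = q"
proof -
  obtain L :: "complex \<Rightarrow> complex" where L0: "continuous_on (sphere 0 r) L" "\<forall>z\<in>sphere 0 r. z powi p = z powi q * exp (L z)"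
    using log_equivE[OF assms(2)] by blast
  note L = L0(1) bspec[OF L0(2)]
  define c where "c t = of_real r * exp (\<i> * of_real t)" for t :: real
  define n where "n = p - q"
  \<comment> \<open>The difference of two logarithms of the same \<open>n\<close>-th power along the
    circle: one is pulled back from \<open>L\<close>, the other is explicit and fails to close up
    unless \<open>n = 0\<close>.\<close>
  define M where "M t = L (c t) - of_int n * (\<i> * of_real t + of_real (ln r))" for t
  have c: "c t \<in> sphere 0 r" "c t = exp (\<i> * of_real t + of_real (ln r))" for t
    using assms(1) by (auto simp: c_def norm_mult exp_add exp_of_real)
  have M: "exp (M t) = 1" for t
  proof -
    have "c t \<noteq> 0" using c(2) by simp
    then have "exp (L (c t)) = c t powi n"
      using L(2)[OF c(1), of t] by (simp add: n_def power_int_diff)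
    also have "\<dots> = exp (of_int n * (\<i> * of_real t + of_real (ln r)))"
      unfolding c(2) exp_power_int by simp
    finally show ?thesis by (simp add: M_def exp_diff)
  qed
  \<comment> \<open>The values of \<open>M\<close> are integer multiples of the period of
    \<open>exp\<close>; distinct ones are at least \<open>2 * pi\<close> apart, so continuity makes
    \<open>M\<close> constant.\<close>
  have "M constant_on {0..2*pi}"
  proof (rule continuous_discrete_range_constant)
    have "continuous_on {0..2*pi} (\<lambda>t. L (c t))"
      by (rule continuous_on_compose2[OF L(1)]) (use c(1) in \<open>auto simp: c_def intro!: continuous_intros\<close>)
    then show "continuous_on {0..2*pi} M"
      unfolding M_def by (intro continuous_intros)
    fix x assume "x \<in> {0..2*pi}"
    show "\<exists>e>0. \<forall>y. y \<in> {0..2*pi} \<and> M y \<noteq> M x \<longrightarrow> e \<le> norm (M y - M x)"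
    proof (intro exI[of _ 1] conjI allI impI)
      fix y assume y: "y \<in> {0..2*pi} \<and> M y \<noteq> M x"
      have "\<exists>k::int. M t = of_real (2 * of_int k * pi) * \<i>" for t
      proof -
        obtain k :: int where "Re (M t) = 0" "Im (M t) = of_int (2 * k) * pi"
          using M[of t] unfolding exp_eq_1 by blast
        then show ?thesis by (intro exI[of _ k]) (simp add: complex_eq_iff)
      qed
      then obtain k l :: int where k: "M y = of_real (2 * of_int k * pi) * \<i>" "M x = of_real (2 * of_int l * pi) * \<i>"
        by meson
      have "M y - M x = of_real (2 * of_int (k - l) * pi) * \<i>" unfolding k by (simp add: left_diff_distrib right_diff_distrib)
      then have n: "norm (M y - M x) = \<bar>of_int (k - l)\<bar> * (2 * pi)"
        by (simp only: norm_mult norm_of_real norm_ii abs_mult) simp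
      have "k \<noteq> l" using y k by auto
      then have "\<bar>k - l\<bar> \<ge> 1" by simp
      then have "1 * (2 * pi) \<le> \<bar>of_int (k - l)\<bar> * (2 * pi)"
        by (intro mult_right_mono) (linarith, simp)
      then show "1 \<le> norm (M y - M x)" using pi_gt3 n by linarith
    qed simp
  qed auto
  then have "M 0 = M (2 * pi)" by (auto simp: constant_on_def)
  moreover have "c (2 * pi) = c 0" using exp_two_pi_i by (simp add: c_def mult_ac)
  ultimately have "of_int n * (\<i> * (2 * of_real pi)) = (0::complex)" by (simp add: M_def distrib_left)
  then show ?thesis by (simp add: n_def)
qed

text \<open>The local model of a nondegenerate zero, up to a nonvanishing factor: the identity when
  the derivative preserves orientation, conjugation when it reverses it.\<close>

definition cnj_if_neg :: "bool \<Rightarrow> complex \<Rightarrow> complex" where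
  "cnj_if_neg s w = (if s then w else cnj w)"

lemma cnj_if_neg_eq_0 [simp]: "cnj_if_neg s w = 0 \<longleftrightarrow> w = 0"
  by (simp add: cnj_if_neg_def)

lemma norm_cnj_if_neg [simp]: "norm (cnj_if_neg s w) = norm w"
  by (simp add: cnj_if_neg_def)

lemma continuous_on_cnj_if_neg [continuous_intros]:
  "continuous_on S f \<Longrightarrow> continuous_on S (\<lambda>z. cnj_if_neg s (f z))"
  by (cases s) (auto simp: cnj_if_neg_def intro!: continuous_intros)

lemma log_equiv_nonvanishing:
  assumes "convex S" "continuous_on S f" "\<And>z. z \<in> S \<Longrightarrow> f z \<noteq> 0"
  shows "log_equiv S f (\<lambda>_. 1)"
proof -
  from continuous_logarithm_on_contractible[OF assms(2) convex_imp_contractible[OF assms(1)] assms(3)]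
  show ?thesis unfolding log_equiv_def by (metis mult_1)
qed

text \<open>Zeros are divided out one at a time. The local logarithm at a zero is cut off to a
  global one, so the quotient extends continuously and without a zero there, and keeps its local
  models at the remaining zeros. With no zeros left, convexity of \<open>B\<close> provides a global
  logarithm.\<close>

lemma log_equiv_prod_zeros:
  assumes "open B" "convex B" "finite Z" "continuous_on B h" "{z\<in>B. h z = 0} = Z"
    "\<And>b. b \<in> Z \<Longrightarrow> \<exists>r>0. log_equiv (ball b r - {b}) h (\<lambda>z. cnj_if_neg (s b) (z - b))"
  shows "log_equiv (B - Z) h (\<lambda>z. \<Prod>b\<in>Z. cnj_if_neg (s b) (z - b))"
  using assms(3-)
proof (induction Z arbitrary: h rule: finite_induct)
  case empty
  then show ?case using log_equiv_nonvanishing[OF assms(2)] by auto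
next
  case (insert b Z)
  let ?e = "\<lambda>z. cnj_if_neg (s b) (z - b)"
  obtain r0 where r0: "r0 > 0" "log_equiv (ball b r0 - {b}) h ?e"
    using insert.prems(3) by blast
  have bB: "b \<in> B" "h b = 0" using insert.prems(2) by auto
  have "open (B - Z)" using assms(1) insert.hyps(1) by (simp add: finite_imp_closed open_Diff)
  then obtain r1 where r1: "r1 > 0" "ball b r1 \<subseteq> B - Z"
    using bB insert.hyps(2) by (metis Diff_iff open_contains_ball)
  define r where "r = min r0 r1"
  have r: "r > 0" "ball b r \<subseteq> B - Z" "ball b r \<subseteq> ball b r0" using r0 r1 by (auto simp: r_def)
  have "ball b r - {b} \<subseteq> ball b r0 - {b}" using r(3) by blast
  then obtain L where L0: "continuous_on (ball b r - {b}) L" "\<forall>z\<in>ball b r - {b}. h z = ?e z * exp (L z)"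
    using log_equivE[OF log_equiv_subset[OF r0(2)]] by blast
  note L = L0(1) bspec[OF L0(2)]
  \<comment> \<open>A cutoff equal to 1 up to distance \<open>r / 3\<close> and to 0 from
    \<open>2 * r / 3\<close> on, which extends the local logarithm by 0 outside the ball.\<close>
  define \<kappa> where "\<kappa> z = max 0 (min 1 (2 - 3 * dist b z / r))" for z
  have \<kappa>1: "\<kappa> z = 1" if "dist b z \<le> r / 3" for z
    using that r(1) by (auto simp: \<kappa>_def field_simps)
  have \<kappa>0: "\<kappa> z = 0" if "dist b z \<ge> 2 * r / 3" for z
    using that r(1) by (auto simp: \<kappa>_def field_simps)
  have \<kappa>c: "continuous_on S \<kappa>" for S
    unfolding \<kappa>_def using r(1) by (intro continuous_intros) auto
  define M where "M z = (if z \<in> ball b r then of_real (\<kappa> z) * L z else 0)" for z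
  have Mc: "continuous_on (- {b}) M"
  proof -
    have "continuous_on ((ball b r - {b}) \<union> (- cball b (2 * r / 3))) M"
    proof (rule continuous_on_open_Un)
      show "continuous_on (ball b r - {b}) M"
        by (rule continuous_on_eq[of _ "\<lambda>z. of_real (\<kappa> z) * L z"])
          (auto simp: M_def intro!: continuous_intros \<kappa>c L(1))
      show "continuous_on (- cball b (2 * r / 3)) M"
        by (rule continuous_on_eq[of _ "\<lambda>z. 0"]) (auto simp: M_def \<kappa>0)
    qed auto
    moreover have "- {b} \<subseteq> (ball b r - {b}) \<union> (- cball b (2 * r / 3))" using r(1) by auto
    ultimately show ?thesis using continuous_on_subset by blast
  qed
  \<comment> \<open>Near \<open>b\<close> the cutoff is inactive and the quotient is identically 1,
    so 1 is the continuous value at \<open>b\<close> itself.\<close>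
  define h' where "h' z = (if z = b then 1 else h z / ?e z * exp (- M z))" for z
  have hh': "h z = ?e z * h' z * exp (M z)" if "z \<noteq> b" for z
    using that by (simp add: h'_def exp_minus)
  have h'1: "h' z = 1" if "dist b z < r / 3" for z
  proof (cases "z = b")
    case False
    then have "h z = ?e z * exp (L z)" using L(2)[of z] that r(1) by auto
    moreover have "M z = L z" using that r(1) by (simp add: M_def \<kappa>1)
    ultimately show ?thesis using False by (simp add: h'_def exp_minus)
  qed (simp add: h'_def)
  have IH: "log_equiv (B - Z) h' (\<lambda>z. \<Prod>b\<in>Z. cnj_if_neg (s b) (z - b))"
  proof (rule insert.IH)
    have "continuous_on (ball b (r / 3) \<union> (B - {b})) h'"
    proof (rule continuous_on_open_Un)
      show "continuous_on (ball b (r / 3)) h'"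
        by (rule continuous_on_eq[of _ "\<lambda>z. 1"]) (auto simp: h'1)
      have "continuous_on (B - {b}) (\<lambda>z. h z / ?e z * exp (- M z))"
        using continuous_on_subset[OF insert.prems(1)] continuous_on_subset[OF Mc]
        by (intro continuous_intros) auto
      then show "continuous_on (B - {b}) h'"
        by (rule continuous_on_eq) (auto simp: h'_def)
    qed (use assms(1) in auto)
    then show "continuous_on B h'" by (rule continuous_on_subset) (use r(1) in auto)
    have "h' z = 0 \<longleftrightarrow> h z = 0 \<and> z \<noteq> b" for z by (simp add: h'_def)
    then show "{z \<in> B. h' z = 0} = Z" using insert.prems(2) insert.hyps(2) by auto
    fix c assume c: "c \<in> Z"
    then have cb: "c \<noteq> b" using insert.hyps(2) by auto
    obtain t0 where t0: "t0 > 0" "log_equiv (ball c t0 - {c}) h (\<lambda>z. cnj_if_neg (s c) (z - c))"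
      using insert.prems(3) c by blast
    \<comment> \<open>The disk around \<open>c\<close> must avoid \<open>b\<close>, so that the
      factor that was divided out is continuous and nonvanishing on it and has a logarithm.\<close>
    define t where "t = min t0 (dist c b)"
    have t: "t > 0" "ball c t \<subseteq> - {b}" using t0 cb by (auto simp: t_def dist_commute)
    have "log_equiv (ball c t) (\<lambda>z. inverse (?e z) * exp (- M z)) (\<lambda>_. 1)"
      by (rule log_equiv_nonvanishing)
        (use t(2) continuous_on_subset[OF Mc t(2)] in \<open>auto intro!: continuous_intros\<close>)
    then have "log_equiv (ball c t - {c}) (\<lambda>z. inverse (?e z) * exp (- M z)) (\<lambda>_. 1)"
      by (rule log_equiv_subset) auto
    moreover have "log_equiv (ball c t - {c}) h (\<lambda>z. cnj_if_neg (s c) (z - c))"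
      by (rule log_equiv_subset[OF t0(2)]) (auto simp: t_def)
    ultimately have 1: "log_equiv (ball c t - {c}) (\<lambda>z. h z * (inverse (?e z) * exp (- M z))) 
        (\<lambda>z. cnj_if_neg (s c) (z - c) * 1)"
      by (intro log_equiv_mult)
    have 2: "log_equiv (ball c t - {c}) h' (\<lambda>z. h z * (inverse (?e z) * exp (- M z)))"
      by (rule log_equiv_eq) (use t(2) in \<open>auto simp: h'_def divide_inverse\<close>)
    show "\<exists>r>0. log_equiv (ball c r - {c}) h' (\<lambda>z. cnj_if_neg (s c) (z - c))"
      using t(1) log_equiv_trans[OF 2 1] by auto
  qed
  have "log_equiv (B - insert b Z) h (\<lambda>z. ?e z * h' z)"
  proof (rule log_equivI[of _ M])
    show "continuous_on (B - insert b Z) M" by (rule continuous_on_subset[OF Mc]) auto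
    fix z assume "z \<in> B - insert b Z"
    then show "h z = ?e z * h' z * exp (M z)" by (intro hh') auto
  qed
  moreover have "log_equiv (B - insert b Z) (\<lambda>z. ?e z * h' z)
      (\<lambda>z. ?e z * (\<Prod>b\<in>Z. cnj_if_neg (s b) (z - b)))"
    by (intro log_equiv_mult log_equiv_eq log_equiv_subset[OF IH]) auto
  ultimately have "log_equiv (B - insert b Z) h (\<lambda>z. ?e z * (\<Prod>b\<in>Z. cnj_if_neg (s b) (z - b)))"
    by (rule log_equiv_trans)
  then show ?case using insert.hyps by simp
qed

definition cdet :: "complex \<Rightarrow> complex \<Rightarrow> real" where
  "cdet p q = Re p * Im q - Im p * Re q"

text \<open>Write \<open>D w\<close> as \<open>\<alpha> * w + \<beta> * cnj w\<close>. The
  determinant is the difference of the squared moduli of \<open>\<alpha>\<close> and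
  \<open>\<beta>\<close>, so its sign tells which of the two terms dominates; the other one,
  together with the differentiation error, is too small to matter.\<close>

lemma log_equiv_nondegenerate_zero:
  assumes "(h has_derivative D) (at b)" "h b = 0" "continuous_on S h" "open S" "b \<in> S" "cdet (D 1) (D \<i>) \<noteq> 0"
  shows "\<exists>r>0. log_equiv (ball b r - {b}) h (\<lambda>z. cnj_if_neg (cdet (D 1) (D \<i>) > 0) (z - b))"
proof -
  define \<alpha> where "\<alpha> = (D 1 - \<i> * D \<i>) / 2"
  define \<beta> where "\<beta> = (D 1 + \<i> * D \<i>) / 2"
  have lin: "linear D" using assms(1) has_derivative_linear by blast
  have D: "D w = \<alpha> * w + \<beta> * cnj w" for w
  proof -
    have "w = Re w *\<^sub>R 1 + Im w *\<^sub>R \<i>" by (simp add: complex_eq_iff)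
    then have "D w = D (Re w *\<^sub>R 1 + Im w *\<^sub>R \<i>)" by (rule arg_cong)
    also have "\<dots> = Re w *\<^sub>R D 1 + Im w *\<^sub>R D \<i>"
      by (simp only: linear_add[OF lin] linear_scale[OF lin])
    also have "\<dots> = of_real (Re w) * D 1 + of_real (Im w) * D \<i>"
      by (simp only: scaleR_conv_of_real)
    also have "\<dots> = \<alpha> * w + \<beta> * cnj w"
      by (simp add: \<alpha>_def \<beta>_def complex_eq_iff field_simps)
    finally show ?thesis .
  qed
  have det: "cdet (D 1) (D \<i>) = (norm \<alpha>)\<^sup>2 - (norm \<beta>)\<^sup>2"
    unfolding cdet_def cmod_power2 \<alpha>_def \<beta>_def by (simp add: power2_eq_square field_simps)
  define s where "s = (cdet (D 1) (D \<i>) > 0)"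
  define c where "c = (if s then \<alpha> else \<beta>)"
  define c' where "c' = (if s then \<beta> else \<alpha>)"
  have cc: "norm c' < norm c"
    using assms(6) by (auto simp: c_def c'_def s_def det not_less order_le_less intro: power2_less_imp_less)
  have Dc: "D w = c * cnj_if_neg s w + c' * cnj_if_neg (\<not> s) w" for w
    by (auto simp: c_def c'_def D cnj_if_neg_def)
  \<comment> \<open>Half of the gap between the two moduli is allowed for the differentiation error,
    so error and minor term together stay strictly below the dominant term.\<close>
  obtain d where d: "d > 0" "\<And>y. norm (y - b) < d \<Longrightarrow>
      norm (h y - h b - D (y - b)) \<le> (norm c - norm c') / 2 * norm (y - b)"
    using assms(1) cc unfolding has_derivative_at_alt by (metis diff_gt_0_iff_gt half_gt_zero)
  obtain e where e: "e > 0" "ball b e \<subseteq> S" using assms(4,5) open_contains_ball by blast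
  define r where "r = min d e"
  have "log_equiv (ball b r - {b}) h (\<lambda>z. c * cnj_if_neg s (z - b))"
  proof (rule log_equiv_close)
    show "continuous_on (ball b r - {b}) h"
      by (rule continuous_on_subset[OF assms(3)]) (use e in \<open>auto simp: r_def\<close>)
    show "continuous_on (ball b r - {b}) (\<lambda>z. c * cnj_if_neg s (z - b))"
      by (intro continuous_intros)
    fix z assume z: "z \<in> ball b r - {b}"
    then have *: "norm (h z - D (z - b)) \<le> (norm c - norm c') / 2 * norm (z - b)"
      using d(2)[of z] assms(2) by (simp add: r_def dist_norm norm_minus_commute)
    have "h z - c * cnj_if_neg s (z - b) = (h z - D (z - b)) + c' * cnj_if_neg (\<not> s) (z - b)"
      by (simp add: Dc)
    then have "norm (h z - c * cnj_if_neg s (z - b)) \<le> norm (h z - D (z - b)) + norm c' * norm (z - b)"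
      by (metis norm_cnj_if_neg norm_mult norm_triangle_ineq)
    also have "\<dots> \<le> ((norm c - norm c') / 2 + norm c') * norm (z - b)"
      using * by (simp add: distrib_right)
    also have "\<dots> < norm c * norm (z - b)"
      using cc z by (intro mult_strict_right_mono) (auto simp: field_simps)
    finally show "norm (h z - c * cnj_if_neg s (z - b)) < norm (c * cnj_if_neg s (z - b))"
      by (simp add: norm_mult)
  qed
  moreover have "log_equiv (ball b r - {b}) (\<lambda>z. c * cnj_if_neg s (z - b)) (\<lambda>z. cnj_if_neg s (z - b))"
    by (rule log_equiv_const) (use cc in auto)
  moreover have "r > 0" using d e by (simp add: r_def)
  ultimately show ?thesis unfolding s_def using log_equiv_trans by blast
qed

text \<open>On the circle of radius \<open>\<rho>\<close> every local model at a zero inside becomes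
  a power of \<open>z\<close>: exponent 1 for a positive zero, -1 for a negative one. The exponents
  add up, and uniqueness of the winding exponent equates the sum with \<open>d\<close>.\<close>

lemma sum_signs_eq_degree:
  assumes "0 < \<rho>" "\<rho> < R" "continuous_on (ball 0 R) h" "Z = {z\<in>ball 0 R. h z = 0}" "Z \<subseteq> ball 0 \<rho>"
    and der: "\<And>b. b \<in> Z \<Longrightarrow> (h has_derivative D b) (at b)"
    and nondeg: "\<And>b. b \<in> Z \<Longrightarrow> cdet (D b 1) (D b \<i>) \<noteq> 0"
    and deg: "log_equiv (sphere 0 \<rho>) h (\<lambda>z. z ^ d)"
  shows "finite Z" "(\<Sum>b\<in>Z. sgn (cdet (D b 1) (D b \<i>))) = of_nat d"
proof -
  define s where "s b \<longleftrightarrow> cdet (D b 1) (D b \<i>) > 0" for b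
  have loc: "\<exists>r>0. log_equiv (ball b r - {b}) h (\<lambda>z. cnj_if_neg (s b) (z - b))" if "b \<in> Z" for b
    unfolding s_def using log_equiv_nondegenerate_zero[OF der _ assms(3) _ _ nondeg] that assms(4) by auto
  \<comment> \<open>Zeros are isolated by their local models, and points that are not zeros are no
    limit points by continuity; compactness leaves finitely many.\<close>
  have "finite (cball 0 \<rho> \<inter> Z)"
  proof (rule finite_not_islimpt_in_compact[OF compact_cball])
    fix b :: complex assume b: "b \<in> cball 0 \<rho>"
    then have bR: "b \<in> ball 0 R" using assms(2) by auto
    show "\<not> b islimpt Z"
    proof (cases "b \<in> Z")
      case True
      then obtain r where "r > 0" "log_equiv (ball b r - {b}) h (\<lambda>z. cnj_if_neg (s b) (z - b))"
        using loc by blast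
      then have "z \<notin> Z" if "z \<in> ball b r - {b}" for z
        using that assms(4) by (elim log_equivE) auto
      then show ?thesis using \<open>r > 0\<close> unfolding islimpt_def
        by (metis DiffI centre_in_ball open_ball singletonD)
    next
      case False
      then have "h b \<noteq> 0" using bR assms(4) by auto
      have "open (ball 0 R \<inter> h -` (- {0}))"
        by (rule continuous_open_preimage[OF assms(3)]) auto
      then show ?thesis using \<open>h b \<noteq> 0\<close> bR assms(4) unfolding islimpt_def
        by (metis (mono_tags, lifting) ComplD ComplI IntD2 IntI mem_Collect_eq singletonD singletonI vimage_eq)
    qed
  qed
  then show fin: "finite Z" using assms(5) by (simp add: Int_absorb1 ball_subset_cball subset_trans)
  have "log_equiv (ball 0 R - Z) h (\<lambda>z. \<Prod>b\<in>Z. cnj_if_neg (s b) (z - b))"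
    by (rule log_equiv_prod_zeros[OF _ _ fin assms(3)]) (use assms(4) loc in auto)
  then have "log_equiv (sphere 0 \<rho>) h (\<lambda>z. \<Prod>b\<in>Z. cnj_if_neg (s b) (z - b))"
    by (rule log_equiv_subset) (use assms(2,5) in auto)
  moreover have "log_equiv (sphere 0 \<rho>) (\<lambda>z. \<Prod>b\<in>Z. cnj_if_neg (s b) (z - b)) 
     (\<lambda>z. \<Prod>b\<in>Z. z powi (if s b then 1 else -1))"
  proof (rule log_equiv_prod[OF fin])
    fix b assume "b \<in> Z"
    then have b: "norm b < \<rho>" using assms(5) by auto
    \<comment> \<open>The centre \<open>b\<close> lies strictly inside the circle, so moving it to 0
      is a perturbation smaller than the modulus of \<open>z\<close>.\<close>
    have 1: "log_equiv (sphere 0 \<rho>) (\<lambda>z. cnj_if_neg (s b) (z - b)) (cnj_if_neg (s b))"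
    proof (rule log_equiv_close)
      show "continuous_on (sphere 0 \<rho>) (\<lambda>z. cnj_if_neg (s b) (z - b))" by (intro continuous_intros)
      show "continuous_on (sphere 0 \<rho>) (cnj_if_neg (s b))"
        using continuous_on_cnj_if_neg[OF continuous_on_id] by simp
      fix z :: complex assume "z \<in> sphere 0 \<rho>"
      moreover have "cnj_if_neg (s b) (z - b) - cnj_if_neg (s b) z = - cnj_if_neg (s b) b"
        by (simp add: cnj_if_neg_def)
      ultimately show "norm (cnj_if_neg (s b) (z - b) - cnj_if_neg (s b) z) < norm (cnj_if_neg (s b) z)"
        using b by simp
    qed
    have 2: "log_equiv (sphere 0 \<rho>) (cnj_if_neg (s b)) (\<lambda>z. z powi (if s b then 1 else -1))"
    proof (cases "s b")
      case True
      then show ?thesis by (intro log_equiv_eq) (simp add: cnj_if_neg_def)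
    next
      case False
      \<comment> \<open>On the circle, conjugation is inversion up to the positive constant
        \<open>\<rho>\<^sup>2\<close>; this is the source of the exponent -1.\<close>
      have "log_equiv (sphere 0 \<rho>) (cnj_if_neg (s b)) (\<lambda>z. of_real (\<rho>\<^sup>2) * inverse z)"
      proof (rule log_equiv_eq)
        fix z :: complex assume z: "z \<in> sphere 0 \<rho>"
        then have "z * cnj z = of_real (\<rho>\<^sup>2)" using complex_norm_square[of z] by simp
        moreover have "z \<noteq> 0" using z assms(1) by auto
        ultimately show "cnj_if_neg (s b) z = of_real (\<rho>\<^sup>2) * inverse z"
          using False by (simp add: cnj_if_neg_def field_simps)
      qed
      moreover have "log_equiv (sphere 0 \<rho>) (\<lambda>z. of_real (\<rho>\<^sup>2) * inverse z) inverse"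
        using assms(1) by (intro log_equiv_const) auto
      ultimately show ?thesis using False log_equiv_trans by (auto simp: power_int_minus)
    qed
    show "log_equiv (sphere 0 \<rho>) (\<lambda>z. cnj_if_neg (s b) (z - b)) (\<lambda>z. z powi (if s b then 1 else -1))"
      using log_equiv_trans[OF 1 2] .
  qed
  moreover have "log_equiv (sphere 0 \<rho>) (\<lambda>z. \<Prod>b\<in>Z. z powi (if s b then 1 else -1)) 
      (\<lambda>z. z powi (\<Sum>b\<in>Z. if s b then 1 else -1))"
  proof (rule log_equiv_eq)
    fix z :: complex assume "z \<in> sphere 0 \<rho>"
    then have z: "z \<noteq> 0" using assms(1) by auto
    have "(\<Prod>b\<in>A. z powi (if s b then 1 else -1)) = z powi (\<Sum>b\<in>A. if s b then 1 else -1)"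
      if "finite A" for A
      using that by (induction A rule: finite_induct) (auto simp: power_int_add z)
    then show "(\<Prod>b\<in>Z. z powi (if s b then 1 else -1)) = z powi (\<Sum>b\<in>Z. if s b then 1 else -1)"
      using fin by blast
  qed
  moreover have "log_equiv (sphere 0 \<rho>) (\<lambda>z. z powi (int d)) h"
    using log_equiv_sym[OF deg] by (simp add: power_int_of_nat)
  ultimately have "log_equiv (sphere 0 \<rho>) (\<lambda>z. z powi (int d)) (\<lambda>z. z powi (\<Sum>b\<in>Z. if s b then 1 else -1))"
    using log_equiv_trans by blast
  then have "int d = (\<Sum>b\<in>Z. if s b then 1 else -1)" by (rule winding_power_unique[OF assms(1)])
  then have "of_int (int d) = (\<Sum>b\<in>Z. of_int (if s b then 1 else -1) :: real)" by simp
  also have "\<dots> = (\<Sum>b\<in>Z. sgn (cdet (D b 1) (D b \<i>)))"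
    using nondeg by (intro sum.cong) (auto simp: s_def sgn_if)
  finally show "(\<Sum>b\<in>Z. sgn (cdet (D b 1) (D b \<i>))) = of_nat d" by simp
qed

subsection \<open>Transverse perturbations\<close>

lemma smooth_on_real_polynomial:
  fixes p :: "complex \<Rightarrow> real"
  shows "real_polynomial_function p \<Longrightarrow> smooth_on UNIV p"
  by (induction p rule: real_polynomial_function.induct)
    (auto intro!: smooth_on_bounded_linear smooth_on_const smooth_on_add smooth_on_mult)

lemma smooth_on_polynomial:
  fixes p :: "complex \<Rightarrow> complex"
  assumes "polynomial_function p"
  shows "smooth_on UNIV p"
proof -
  have "smooth_on UNIV (\<lambda>z. of_real (Re (p z)) + \<i> * of_real (Im (p z)))"
    using assms unfolding polynomial_function_def
    by (intro smooth_on_add smooth_on_linear_compose[OF bounded_linear_mult_right]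
        smooth_on_linear_compose[OF bounded_linear_of_real] smooth_on_real_polynomial)
      (auto simp: o_def bounded_linear_Re bounded_linear_Im)
  then show ?thesis by (simp add: complex_eq[symmetric])
qed

lemma smooth_on_exp: "smooth_on UNIV (exp :: complex \<Rightarrow> complex)"
  by (simp add: smooth_on_def Ck_on_exp)

lemma smooth_on_power:
  fixes f :: "'a::real_normed_vector \<Rightarrow> 'b::real_normed_algebra_1"
  assumes "smooth_on S f"
  shows "smooth_on S (\<lambda>x. f x ^ n)"
  using assms by (induction n) (auto intro: smooth_on_const smooth_on_mult simp: smooth_on_open)

text \<open>Writing \<open>\<Phi> = z\<^sup>d e\<^sup>L\<close>, the perturbation is \<open>(z\<^sup>d - \<tau>) e\<^sup>M\<close> for a polynomial \<open>M\<close> close to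
  \<open>L\<close>: its zeros are visibly nondegenerate, so Sard's theorem is not needed.\<close>

lemma transverse_perturbation:
  assumes "0 < R" "continuous_on (cball 0 R) \<Phi>" "\<Phi> 0 = 0"
    and "log_equiv (cball 0 R - {0}) \<Phi> (\<lambda>z. z ^ d)" "d > 0" "\<delta> > 0"
  obtains h D where "smooth_on UNIV h" "\<And>z. z \<in> cball 0 R \<Longrightarrow> dist (h z) (\<Phi> z) < \<delta>"
    "\<And>b. h b = 0 \<Longrightarrow> (h has_derivative D b) (at b)" "\<And>b. h b = 0 \<Longrightarrow> cdet (D b 1) (D b \<i>) \<noteq> 0"
proof -
  obtain L where L: "continuous_on (cball 0 R - {0}) L" "\<forall>z\<in>cball 0 R - {0}. \<Phi> z = z ^ d * exp (L z)"
    using log_equivE[OF assms(4)] by blast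
  \<comment> \<open>Near 0 the first error is bounded by one copy of \<open>norm (z ^ d)\<close> and
    two of \<open>norm (\<Phi> z)\<close>, so ninths add up to \<open>\<delta> / 3\<close>. Two
    further thirds are kept for the polynomial approximation and for \<open>\<tau>\<close>.\<close>
  have "\<delta> / 9 > 0" using assms(6) by simp
  moreover have "isCont (\<lambda>z::complex. z ^ d) 0" by (intro continuous_intros)
  ultimately have "\<exists>\<eta>>0. \<forall>z. dist z 0 < \<eta> \<longrightarrow> dist (z ^ d) (0 ^ d :: complex) < \<delta> / 9"
    unfolding continuous_at_eps_delta by blast
  then obtain \<eta>1 where \<eta>1: "\<eta>1 > 0" "\<And>z::complex. norm z < \<eta>1 \<Longrightarrow> norm (z ^ d) < \<delta> / 9"
    using assms(5) by (auto simp: power_0_left)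
  obtain \<eta>2 where \<eta>2: "\<eta>2 > 0" "\<And>z. z \<in> cball 0 R \<Longrightarrow> norm z < \<eta>2 \<Longrightarrow> norm (\<Phi> z) < \<delta> / 9"
    using assms(1,2,3,6) unfolding continuous_on_iff
    by (metis centre_in_cball dist_0_norm dist_commute less_imp_le zero_less_divide_iff zero_less_numeral)
  define \<eta> where "\<eta> = min \<eta>1 \<eta>2"
  have \<eta>: "\<eta> > 0" using \<eta>1 \<eta>2 by (simp add: \<eta>_def)
  \<comment> \<open>\<open>L\<close> may be discontinuous or unbounded at 0. Multiplying it by a
    cutoff that vanishes on the disk of radius \<open>\<eta> / 2\<close> makes it continuous on the
    whole disk, as polynomial approximation requires.\<close>
  define \<kappa> where "\<kappa> z = max 0 (min 1 (2 * norm z / \<eta> - 1))" for z :: complex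
  have \<kappa>1: "\<kappa> z = 1" if "norm z \<ge> \<eta>" for z
    using that \<eta> by (auto simp: \<kappa>_def field_simps)
  have \<kappa>0: "\<kappa> z = 0" if "norm z \<le> \<eta> / 2" for z
    using that \<eta> by (auto simp: \<kappa>_def field_simps)
  have \<kappa>01: "0 \<le> \<kappa> z" "\<kappa> z \<le> 1" for z by (auto simp: \<kappa>_def)
  have \<kappa>c: "continuous_on S \<kappa>" for S
    unfolding \<kappa>_def using \<eta> by (intro continuous_intros) auto
  define K where "K z = (if z = 0 then 0 else of_real (\<kappa> z) * L z)" for z
  have K: "continuous_on (cball 0 R) K"
  proof -
    have "continuous_on ((cball 0 R - {0}) \<union> (cball 0 R \<inter> ball 0 (\<eta> / 2))) K"
    proof (rule continuous_on_Un_local_open)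
      show "continuous_on (cball 0 R - {0}) K"
        by (rule continuous_on_eq[of _ "\<lambda>z. of_real (\<kappa> z) * L z"])
          (auto simp: K_def intro!: continuous_intros \<kappa>c L(1))
      show "continuous_on (cball 0 R \<inter> ball 0 (\<eta> / 2)) K"
        by (rule continuous_on_eq[of _ "\<lambda>z. 0"]) (auto simp: K_def \<kappa>0)
      show "openin (top_of_set (cball 0 R - {0} \<union> cball 0 R \<inter> ball 0 (\<eta> / 2))) (cball 0 R - {0})"
        unfolding openin_open by (intro exI[of _ "- {0}"]) auto
      show "openin (top_of_set (cball 0 R - {0} \<union> cball 0 R \<inter> ball 0 (\<eta> / 2))) (cball 0 R \<inter> ball 0 (\<eta> / 2))"
        unfolding openin_open by (intro exI[of _ "ball 0 (\<eta> / 2)"]) auto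
    qed
    then show ?thesis by (rule continuous_on_subset) (use \<eta> in auto)
  qed
  have step1: "norm (z ^ d * exp (K z) - \<Phi> z) \<le> \<delta> / 3" if z: "z \<in> cball 0 R" for z
  proof (cases "norm z \<ge> \<eta>")
    case True
    then have "z \<noteq> 0" using \<eta> by auto
    then have "\<Phi> z = z ^ d * exp (K z)" using L(2) z True by (simp add: K_def \<kappa>1)
    then show ?thesis using assms(6) by simp
  next
    case False
    then have zs: "norm (z ^ d) < \<delta> / 9" "norm (\<Phi> z) < \<delta> / 9" using \<eta>1 \<eta>2 z by (auto simp: \<eta>_def)
    \<comment> \<open>Since the cutoff lies between 0 and 1, \<open>exp (Re (K z))\<close> is at
      most \<open>1 + exp (Re (L z))\<close>; no bound on \<open>L\<close> itself enters.\<close>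
    have "norm (z ^ d * exp (K z)) \<le> norm (z ^ d) + norm (\<Phi> z)"
    proof (cases "z = 0")
      case True
      then show ?thesis by (simp add: K_def)
    next
      case False
      then have \<Phi>z: "norm (\<Phi> z) = norm (z ^ d) * exp (Re (L z))" using L(2) z by (simp add: norm_mult)
      have "Re (K z) = \<kappa> z * Re (L z)" using False by (simp add: K_def)
      also have "\<dots> \<le> max 0 (Re (L z))"
        using \<kappa>01[of z] by (cases "Re (L z) \<ge> 0") (auto simp: mult_left_le_one_le mult_nonneg_nonpos)
      finally have "exp (Re (K z)) \<le> 1 + exp (Re (L z))"
        by (smt (verit) exp_ge_zero exp_le_cancel_iff exp_zero)
      then have "norm (z ^ d) * exp (Re (K z)) \<le> norm (z ^ d) * (1 + exp (Re (L z)))"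
        by (intro mult_left_mono) auto
      then show ?thesis by (simp add: \<Phi>z norm_mult distrib_left)
    qed
    then have "norm (z ^ d * exp (K z)) + norm (\<Phi> z) \<le> \<delta> / 3" using zs by linarith
    then show ?thesis by (meson norm_triangle_ineq4 order_trans)
  qed
  have "continuous_on (cball 0 R) (\<lambda>z. z ^ d * exp (K z))" by (intro continuous_intros K)
  then have "bounded ((\<lambda>z. z ^ d * exp (K z)) ` cball 0 R)"
    using compact_continuous_image compact_imp_bounded compact_cball by blast
  then obtain C where C: "C > 0" "\<And>z. z \<in> cball 0 R \<Longrightarrow> norm (z ^ d * exp (K z)) \<le> C"
    unfolding bounded_pos by blast
  have "\<delta> / (3 * C) > 0" using assms(6) C(1) by simp
  moreover have "isCont (exp :: complex \<Rightarrow> complex) 0" by (intro continuous_intros)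
  ultimately obtain t where t: "t > 0" "\<forall>w::complex. dist w 0 < t \<longrightarrow> dist (exp w) (exp 0) < \<delta> / (3 * C)"
    unfolding continuous_at_eps_delta by blast
  obtain M where M: "polynomial_function M" "\<And>z. z \<in> cball 0 R \<Longrightarrow> norm (K z - M z) < t"
    using Stone_Weierstrass_polynomial_function[OF compact_cball K t(1)] by blast
  have step2: "norm (z ^ d * exp (M z) - z ^ d * exp (K z)) \<le> \<delta> / 3" if z: "z \<in> cball 0 R" for z
  proof -
    have "exp (M z) = exp (K z) * exp (M z - K z)" by (simp flip: exp_add)
    then have "z ^ d * exp (M z) - z ^ d * exp (K z) = z ^ d * exp (K z) * (exp (M z - K z) - 1)"
      by (simp add: right_diff_distrib mult.assoc)
    then have "norm (z ^ d * exp (M z) - z ^ d * exp (K z)) = norm (z ^ d * exp (K z)) * norm (exp (M z - K z) - 1)"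
      by (metis norm_mult)
    also have "\<dots> \<le> C * (\<delta> / (3 * C))"
      using C z t(2)[rule_format, of "M z - K z"] M(2)[OF z] by (intro mult_mono) (auto simp: norm_minus_commute less_imp_le dist_norm)
    finally show ?thesis using C(1) by simp
  qed
  have sM: "smooth_on UNIV M" using smooth_on_polynomial[OF M(1)] .
  have sE: "smooth_on UNIV (\<lambda>z. exp (M z))" by (rule smooth_on_compose[OF smooth_on_exp sM]) auto
  have "continuous_on (cball 0 R) (\<lambda>z. exp (M z))"
    using smooth_on_continuous_on[OF sE] continuous_on_subset by blast
  then have "bounded ((\<lambda>z. exp (M z)) ` cball 0 R)"
    using compact_continuous_image compact_imp_bounded compact_cball by blast
  then obtain C' where C': "C' > 0" "\<And>z. z \<in> cball 0 R \<Longrightarrow> norm (exp (M z)) \<le> C'"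
    unfolding bounded_pos by blast
  \<comment> \<open>Nonzero, so that the zeros become simple and move off the origin; its modulus
    makes the last error at most \<open>\<delta> / 6\<close>, strictly below the remaining
    third.\<close>
  define \<tau> where "\<tau> = complex_of_real (\<delta> / (6 * C'))"
  have \<tau>: "\<tau> \<noteq> 0" "norm \<tau> = \<delta> / (6 * C')" using assms(6) C'(1) by (auto simp: \<tau>_def simp del: of_real_divide of_real_mult)
  define h where "h z = (z ^ d - \<tau>) * exp (M z)" for z
  have h0: "b \<noteq> 0 \<and> b ^ d = \<tau>" if "h b = 0" for b
    using that \<tau>(1) assms(5) by (auto simp: h_def power_0_left)
  show ?thesis
  \<comment> \<open>At a zero of \<open>h\<close> the factor \<open>b ^ d - \<tau>\<close> vanishes,
    so the derivative of the exponential drops out. What remains is multiplication by a nonzero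
    complex number, whose determinant is its squared modulus, whether or not \<open>M\<close> is
    holomorphic.\<close>
  proof (rule that[of h "\<lambda>b v. of_nat d * b ^ (d - 1) * exp (M b) * v"])
    show "smooth_on UNIV h"
      unfolding h_def
      by (intro smooth_on_mult smooth_on_diff smooth_on_power sE smooth_on_const
          smooth_on_bounded_linear bounded_linear_ident) auto
  next
    fix z :: complex assume z: "z \<in> cball 0 R"
    have "h z - z ^ d * exp (M z) = - (\<tau> * exp (M z))" by (simp add: h_def algebra_simps)
    then have "norm (h z - z ^ d * exp (M z)) = norm \<tau> * norm (exp (M z))"
      by (metis norm_minus_cancel norm_mult)
    also have "\<dots> \<le> \<delta> / (6 * C') * C'" using C'(1) C'(2)[OF z] \<tau> assms(6) by (intro mult_mono) auto
    also have "\<dots> < \<delta> / 3" using C'(1) assms(6) by simp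
    finally have "norm (h z - z ^ d * exp (M z)) < \<delta> / 3" .
    then show "dist (h z) (\<Phi> z) < \<delta>"
      using step1[OF z] step2[OF z] unfolding dist_norm
      using norm_triangle_ineq[of "h z - z ^ d * exp (M z)" "z ^ d * exp (M z) - z ^ d * exp (K z)"]
        norm_triangle_ineq[of "h z - z ^ d * exp (K z)" "z ^ d * exp (K z) - \<Phi> z"]
      by simp
  next
    fix b assume "h b = 0"
    then have b: "b \<noteq> 0" "b ^ d = \<tau>" using h0 by auto
    have "((\<lambda>z. z ^ d - \<tau>) has_derivative (\<lambda>v. of_nat d * b ^ (d - 1) * v)) (at b)"
      by (auto intro!: derivative_eq_intros)
    from has_derivative_mult[OF this smooth_on_has_derivative[OF sE UNIV_I]]
    show "(h has_derivative (\<lambda>v. of_nat d * b ^ (d - 1) * exp (M b) * v)) (at b)"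
      unfolding h_def by (rule has_derivative_eq_rhs) (simp add: b mult_ac fun_eq_iff)
    have "cdet (c * 1) (c * \<i>) = (norm c)\<^sup>2" for c
      unfolding cdet_def cmod_power2 by (simp add: power2_eq_square)
    then show "cdet (of_nat d * b ^ (d - 1) * exp (M b) * 1) (of_nat d * b ^ (d - 1) * exp (M b) * \<i>) \<noteq> 0"
      using b assms(5) by simp
  qed
qed

section \<open>Determinants of order four\<close>

lemma det_4: "det (A::real^4^4) =
  (let m = (\<lambda>i j k l. A$1$i * A$2$j * A$3$k * A$4$l) in
   m 1 2 3 4 - m 1 2 4 3 - m 1 3 2 4 + m 1 3 4 2 + m 1 4 2 3 - m 1 4 3 2
   - m 2 1 3 4 + m 2 1 4 3 + m 2 3 1 4 - m 2 3 4 1 - m 2 4 1 3 + m 2 4 3 1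
   + m 3 1 2 4 - m 3 1 4 2 - m 3 2 1 4 + m 3 2 4 1 + m 3 4 1 2 - m 3 4 2 1
   - m 4 1 2 3 + m 4 1 3 2 + m 4 2 1 3 - m 4 2 3 1 - m 4 3 1 2 + m 4 3 2 1)"
proof -
  have f1: "finite {2::4, 3, 4}" "1 \<notin> {2::4, 3, 4}" by auto
  have f2: "finite {3::4, 4}" "2 \<notin> {3::4, 4}" by auto
  have f3: "finite {4::4}" "3 \<notin> {4::4}" by auto
  show ?thesis
    unfolding det_def UNIV_4
    unfolding sum_over_permutations_insert[OF f1]
    unfolding sum_over_permutations_insert[OF f2]
    unfolding sum_over_permutations_insert[OF f3]
    unfolding permutes_sing
    by (simp add: sign_swap_id permutation_swap_id sign_compose permutation_compose sign_id swap_id_eq Let_def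
        transpose_def)
qed

lemma vector_4:
  "(vector [w, x, y, z] :: 'a::zero^4) $ 1 = w" "(vector [w, x, y, z] :: 'a::zero^4) $ 2 = x"
  "(vector [w, x, y, z] :: 'a::zero^4) $ 3 = y" "(vector [w, x, y, z] :: 'a::zero^4) $ 4 = z"
  unfolding vector_def by simp_all

text \<open>Laplace expansion by two-by-two minors: the real and imaginary parts of the first
  complex coordinates form one pair of columns, those of the second the other.\<close>

lemma det4_expand:
  "det4 (a1, a2) (b1, b2) (c1, c2) (d1, d2) =
     cdet a1 b1 * cdet c2 d2 - cdet a1 c1 * cdet b2 d2 + cdet a1 d1 * cdet b2 c2
     + cdet b1 c1 * cdet a2 d2 - cdet b1 d1 * cdet a2 c2 + cdet c1 d1 * cdet a2 b2"
  unfolding det4_def det_4 Let_def real_coords_def vector_4 cdet_def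
  by (simp add: vector_4) algebra

subsection \<open>The local index of a graph\<close>

text \<open>The flat surface contributes the first two standard basis vectors, so only the normal
  components of the derivative of \<open>h\<close> survive in the determinant.\<close>

lemma intersection_sign_flat:
  assumes "(h has_derivative D) (at b)"
  shows "intersection_sign (\<lambda>z. (z, 0)) h a b = sgn (cdet (snd (D 1)) (snd (D \<i>)))"
proof -
  have "((\<lambda>z::complex. (z, 0::complex)) has_derivative (\<lambda>v. (v, 0))) (at a)"
    by (auto intro!: derivative_eq_intros)
  then have "frechet_derivative (\<lambda>z::complex. (z, 0::complex)) (at a) = (\<lambda>v. (v, 0))"
    using frechet_derivative_at by metis
  moreover have "frechet_derivative h (at b) = D"
    using frechet_derivative_at[OF assms] by simp
  moreover have "det4 (1, 0) (\<i>, 0) p q = cdet (snd p) (snd q)" for p q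
    using det4_expand[of 1 0 \<i> 0 "fst p" "snd p" "fst q" "snd q"] by (simp add: cdet_def)
  ultimately show ?thesis by (simp add: intersection_sign_def)
qed

text \<open>The condition on \<open>\<epsilon>\<close> and \<open>\<delta>\<close> in the definition of the local index, for a flat first surface.\<close>

definition graph_index_at :: "(complex \<Rightarrow> complex) \<Rightarrow> real \<Rightarrow> real \<Rightarrow> int \<Rightarrow> bool" where
  "graph_index_at \<Phi> \<epsilon> \<delta> k \<longleftrightarrow>
     (\<forall>h. let X = {(a, b). a \<in> ball 0 \<epsilon> \<and> b \<in> ball 0 \<epsilon> \<and> (a, 0) = h b} in
       smooth_on (ball 0 \<epsilon>) h \<and> (\<forall>b\<in>ball 0 \<epsilon>. dist (h b) (b, \<Phi> b) < \<delta>) \<and>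
       (\<forall>(a, b)\<in>X. intersection_sign (\<lambda>z. (z, 0)) h a b \<noteq> 0) \<longrightarrow>
       finite X \<and> (\<Sum>(a, b)\<in>X. intersection_sign (\<lambda>z. (z, 0)) h a b) = of_int k)"

lemma has_local_index_graph:
  "has_local_index (\<lambda>z. (z, 0)) (\<lambda>z. (z, \<Phi> z)) k \<longleftrightarrow>
     (\<exists>\<epsilon>0>0. \<forall>\<epsilon>. 0 < \<epsilon> \<and> \<epsilon> < \<epsilon>0 \<longrightarrow> (\<exists>\<delta>>0. graph_index_at \<Phi> \<epsilon> \<delta> k))"
  unfolding has_local_index_def graph_index_at_def ..

lemma graph_index_atI:
  assumes "\<And>h X. X = {(a, b). a \<in> ball 0 \<epsilon> \<and> b \<in> ball 0 \<epsilon> \<and> (a, 0) = h b} \<Longrightarrow>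
     smooth_on (ball 0 \<epsilon>) h \<Longrightarrow> (\<forall>b\<in>ball 0 \<epsilon>. dist (h b) (b, \<Phi> b) < \<delta>) \<Longrightarrow>
     (\<forall>(a, b)\<in>X. intersection_sign (\<lambda>z. (z, 0)) h a b \<noteq> 0) \<Longrightarrow>
     finite X \<and> (\<Sum>(a, b)\<in>X. intersection_sign (\<lambda>z. (z, 0)) h a b) = of_int k"
  shows "graph_index_at \<Phi> \<epsilon> \<delta> k"
  unfolding graph_index_at_def Let_def using assms by blast

lemma graph_index_atD:
  assumes "graph_index_at \<Phi> \<epsilon> \<delta> k" "smooth_on (ball 0 \<epsilon>) h"
    "\<forall>b\<in>ball 0 \<epsilon>. dist (h b) (b, \<Phi> b) < \<delta>"
    "X = {(a, b). a \<in> ball 0 \<epsilon> \<and> b \<in> ball 0 \<epsilon> \<and> (a, 0) = h b}"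
    "\<forall>(a, b)\<in>X. intersection_sign (\<lambda>z. (z, 0)) h a b \<noteq> 0"
  shows "(\<Sum>(a, b)\<in>X. intersection_sign (\<lambda>z. (z, 0)) h a b) = of_int k"
  using assms unfolding graph_index_at_def Let_def by blast

text \<open>Intersections with the flat surface are the zeros of the second component of
  \<open>h\<close>. A small perturbation does not change its winding on the circle of radius
  \<open>\<epsilon> / 2\<close>, so the signed count of zeros is the degree of
  \<open>\<Phi>\<close>.\<close>

lemma transverse_count:
  assumes R: "0 < R" "continuous_on (ball 0 R) \<Phi>" "\<Phi> 0 = 0"
    "log_equiv (ball 0 R - {0}) \<Phi> (\<lambda>z. z ^ d)"
    and \<epsilon>: "0 < \<epsilon>" "\<epsilon> < R"
  shows "\<exists>\<delta>>0. graph_index_at \<Phi> \<epsilon> \<delta> (int d)"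
proof -
  define A where "A = cball 0 \<epsilon> - ball (0::complex) (\<epsilon> / 2)"
  have "compact A" unfolding A_def by (intro compact_diff) auto
  moreover have "complex_of_real \<epsilon> \<in> A" using \<epsilon> by (auto simp: A_def)
  moreover have AR: "A \<subseteq> ball 0 R" using \<epsilon> by (auto simp: A_def)
  moreover have "continuous_on A (\<lambda>z. norm (\<Phi> z))"
    by (intro continuous_intros continuous_on_subset[OF R(2) AR])
  ultimately obtain z0 where z0: "z0 \<in> A" "\<And>z. z \<in> A \<Longrightarrow> norm (\<Phi> z0) \<le> norm (\<Phi> z)"
    using continuous_attains_inf[of A] by (metis empty_iff)
  have z0': "\<Phi> z0 \<noteq> 0"
  proof -
    have "z0 \<in> ball 0 R - {0}" using z0(1) AR \<epsilon> by (auto simp: A_def)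
    then show ?thesis using R(4) by (elim log_equivE) auto
  qed
  \<comment> \<open>The minimum of \<open>norm (\<Phi> z)\<close> over the closed annulus keeps all
    zeros inside radius \<open>\<epsilon> / 2\<close> and allows the Rouche comparison on that
    circle. The bound \<open>\<epsilon> / 2\<close> ensures that the matching parameter
    \<open>a = fst (h b)\<close> is still in the ball of radius \<open>\<epsilon>\<close>.\<close>
  define \<delta> where "\<delta> = min (norm (\<Phi> z0)) (\<epsilon> / 2)"
  have \<delta>: "\<delta> > 0" "\<And>z. z \<in> A \<Longrightarrow> \<delta> \<le> norm (\<Phi> z)" "\<delta> \<le> \<epsilon> / 2"
    using z0' z0(2) \<epsilon> by (auto simp: \<delta>_def min_le_iff_disj)
  have "graph_index_at \<Phi> \<epsilon> \<delta> (int d)"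
  proof (rule graph_index_atI)
    fix h :: "complex \<Rightarrow> complex \<times> complex" and X
    assume X: "X = {(a, b). a \<in> ball 0 \<epsilon> \<and> b \<in> ball 0 \<epsilon> \<and> (a, 0) = h b}"
      and h: "smooth_on (ball 0 \<epsilon>) h" "\<forall>b\<in>ball 0 \<epsilon>. dist (h b) (b, \<Phi> b) < \<delta>"
      and nz: "\<forall>(a, b)\<in>X. intersection_sign (\<lambda>z. (z, 0)) h a b \<noteq> 0"
    have d1: "dist (fst (h b)) b < \<delta>" and d2: "dist (snd (h b)) (\<Phi> b) < \<delta>" if "b \<in> ball 0 \<epsilon>" for b
      using h(2) that dist_fst_le[of "h b" "(b, \<Phi> b)"] dist_snd_le[of "h b" "(b, \<Phi> b)"]
      by (auto intro: le_less_trans)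
    define Z where "Z = {b\<in>ball 0 \<epsilon>. snd (h b) = 0}"
    let ?D = "\<lambda>b. frechet_derivative h (at b)"
    have Zsmall: "Z \<subseteq> ball 0 (\<epsilon> / 2)"
    proof
      fix b assume b: "b \<in> Z"
      then have "norm (\<Phi> b) < \<delta>" using d2[of b] by (auto simp: Z_def dist_norm)
      then have "b \<notin> A" using \<delta>(2)[of b] by fastforce
      then show "b \<in> ball 0 (\<epsilon> / 2)" using b by (auto simp: A_def Z_def)
    qed
    have XZ: "X = (\<lambda>b. (fst (h b), b)) ` Z"
    proof (intro set_eqI iffI)
      fix x assume "x \<in> X"
      then show "x \<in> (\<lambda>b. (fst (h b), b)) ` Z"
        unfolding X Z_def by (auto simp: image_iff prod_eq_iff)
    next
      fix x assume "x \<in> (\<lambda>b. (fst (h b), b)) ` Z"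
      then obtain b where b: "b \<in> Z" "x = (fst (h b), b)" by auto
      have bb: "b \<in> ball 0 \<epsilon>" "snd (h b) = 0" "norm b < \<epsilon> / 2" using b Zsmall by (auto simp: Z_def)
      have "norm (fst (h b)) \<le> norm b + dist (fst (h b)) b"
        unfolding dist_norm by (metis norm_triangle_sub)
      then have "fst (h b) \<in> ball 0 \<epsilon>" using d1[OF bb(1)] bb(3) \<delta>(3) by simp
      then show "x \<in> X" using bb unfolding b(2) X by (simp add: prod_eq_iff)
    qed
    have der: "(h has_derivative ?D b) (at b)" if "b \<in> ball 0 \<epsilon>" for b
      using smooth_on_has_derivative[OF h(1) that] .
    have sgn: "intersection_sign (\<lambda>z. (z, 0)) h a b = sgn (cdet (snd (?D b 1)) (snd (?D b \<i>)))" if "b \<in> Z" for a b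
      using intersection_sign_flat[OF der] that by (auto simp: Z_def)
    have ch: "continuous_on (ball 0 \<epsilon>) (\<lambda>b. snd (h b))"
      using smooth_on_continuous_on[OF h(1)] by (intro continuous_intros)
    have lS: "log_equiv (sphere 0 (\<epsilon> / 2)) (\<lambda>b. snd (h b)) \<Phi>"
    proof (rule log_equiv_close)
      show "continuous_on (sphere 0 (\<epsilon> / 2)) (\<lambda>b. snd (h b))"
        by (rule continuous_on_subset[OF ch]) (use \<epsilon> in auto)
      show "continuous_on (sphere 0 (\<epsilon> / 2)) \<Phi>"
        by (rule continuous_on_subset[OF R(2)]) (use \<epsilon> in auto)
      fix z :: complex assume "z \<in> sphere 0 (\<epsilon> / 2)"
      then have "z \<in> ball 0 \<epsilon>" "z \<in> A" using \<epsilon> by (auto simp: A_def)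
      then show "norm (snd (h z) - \<Phi> z) < norm (\<Phi> z)"
        using d2[of z] \<delta>(2)[of z] by (simp add: dist_norm)
    qed
    have "log_equiv (sphere 0 (\<epsilon> / 2)) \<Phi> (\<lambda>z. z ^ d)"
      by (rule log_equiv_subset[OF R(4)]) (use \<epsilon> in auto)
    note deg = log_equiv_trans[OF lS this]
    have half: "0 < \<epsilon> / 2" "\<epsilon> / 2 < \<epsilon>" using \<epsilon> by auto
    have dsnd: "((\<lambda>b. snd (h b)) has_derivative (\<lambda>v. snd (?D b v))) (at b)" if "b \<in> Z" for b
      using bounded_linear.has_derivative[OF bounded_linear_snd der] that by (simp add: Z_def)
    have nd: "cdet (snd (?D b 1)) (snd (?D b \<i>)) \<noteq> 0" if "b \<in> Z" for b
      using nz sgn[OF that] that unfolding XZ by (auto simp: sgn_zero_iff)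
    note count = sum_signs_eq_degree[OF half ch Z_def Zsmall dsnd nd deg]
    have inj: "inj_on (\<lambda>b. (fst (h b), b)) Z" by (auto simp: inj_on_def)
    have "(\<Sum>(a, b)\<in>X. intersection_sign (\<lambda>z. (z, 0)) h a b) = (\<Sum>b\<in>Z. sgn (cdet (snd (?D b 1)) (snd (?D b \<i>))))"
      unfolding XZ sum.reindex[OF inj] o_def by (intro sum.cong) (auto simp: sgn)
    then show "finite X \<and> (\<Sum>(a, b)\<in>X. intersection_sign (\<lambda>z. (z, 0)) h a b) = of_int (int d)"
      using count by (simp add: XZ)
  qed
  then show ?thesis using \<delta>(1) by blast
qed

text \<open>Uniqueness is the less obvious half: two candidate values may come with different
  tolerances. A single transverse perturbation within both tolerances has only one signed
  count.\<close>

lemma has_local_index_graph_iff: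
  assumes R: "0 < R" "continuous_on (ball 0 R) \<Phi>" "\<Phi> 0 = 0"
    "log_equiv (ball 0 R - {0}) \<Phi> (\<lambda>z. z ^ d)" and "d > 0"
  shows "has_local_index (\<lambda>z. (z, 0)) (\<lambda>z. (z, \<Phi> z)) k \<longleftrightarrow> k = int d"
proof
  assume "k = int d"
  then show "has_local_index (\<lambda>z. (z, 0)) (\<lambda>z. (z, \<Phi> z)) k"
    unfolding has_local_index_graph using R(1) transverse_count[OF R] by blast
next
  assume "has_local_index (\<lambda>z. (z, 0)) (\<lambda>z. (z, \<Phi> z)) k"
  then obtain \<epsilon>0 where \<epsilon>0: "\<epsilon>0 > 0" "\<And>\<epsilon>. 0 < \<epsilon> \<Longrightarrow> \<epsilon> < \<epsilon>0 \<Longrightarrow> \<exists>\<delta>>0. graph_index_at \<Phi> \<epsilon> \<delta> k"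
    unfolding has_local_index_graph by blast
  define \<epsilon> where "\<epsilon> = min \<epsilon>0 R / 2"
  have \<epsilon>: "0 < \<epsilon>" "\<epsilon> < \<epsilon>0" "\<epsilon> < R" using \<epsilon>0(1) R(1) by (auto simp: \<epsilon>_def)
  obtain \<delta>1 where \<delta>1: "\<delta>1 > 0" "graph_index_at \<Phi> \<epsilon> \<delta>1 k" using \<epsilon>0(2)[OF \<epsilon>(1,2)] by blast
  obtain \<delta>2 where \<delta>2: "\<delta>2 > 0" "graph_index_at \<Phi> \<epsilon> \<delta>2 (int d)" using transverse_count[OF R \<epsilon>(1,3)] by blast
  have 1: "continuous_on (cball 0 \<epsilon>) \<Phi>" by (rule continuous_on_subset[OF R(2)]) (use \<epsilon> in auto)
  have 2: "log_equiv (cball 0 \<epsilon> - {0}) \<Phi> (\<lambda>z. z ^ d)"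
    by (rule log_equiv_subset[OF R(4)]) (use \<epsilon> in auto)
  have 3: "min \<delta>1 \<delta>2 > 0" using \<delta>1 \<delta>2 by simp
  obtain q D where q: "smooth_on UNIV q" "\<And>z. z \<in> cball 0 \<epsilon> \<Longrightarrow> dist (q z) (\<Phi> z) < min \<delta>1 \<delta>2"
    "\<And>b. q b = 0 \<Longrightarrow> (q has_derivative D b) (at b)" "\<And>b. q b = 0 \<Longrightarrow> cdet (D b 1) (D b \<i>) \<noteq> 0"
    using transverse_perturbation[OF \<epsilon>(1) 1 R(3) 2 \<open>d > 0\<close> 3] by blast
  define h where "h z = (z, q z)" for z
  define X where "X = {(a, b). a \<in> ball 0 \<epsilon> \<and> b \<in> ball 0 \<epsilon> \<and> (a, 0) = h b}"
  have h: "smooth_on (ball 0 \<epsilon>) h"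
    unfolding h_def by (intro smooth_on_Pair smooth_on_bounded_linear bounded_linear_ident
        smooth_on_subset[OF q(1)]) auto
  have dist: "dist (h b) (b, \<Phi> b) < min \<delta>1 \<delta>2" if "b \<in> ball 0 \<epsilon>" for b
    using q(2)[of b] that by (simp add: h_def dist_Pair_Pair)
  have nz: "\<forall>(a, b)\<in>X. intersection_sign (\<lambda>z. (z, 0)) h a b \<noteq> 0"
  proof clarify
    fix a b assume "(a, b) \<in> X" "intersection_sign (\<lambda>z. (z, 0)) h a b = 0"
    then have qb: "q b = 0" by (simp add: X_def h_def)
    have "(h has_derivative (\<lambda>v. (v, D b v))) (at b)"
      unfolding h_def by (intro has_derivative_Pair has_derivative_ident q(3) qb)
    then have "intersection_sign (\<lambda>z. (z, 0)) h a b = sgn (cdet (D b 1) (D b \<i>))"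
      by (simp add: intersection_sign_flat)
    then show False using \<open>intersection_sign (\<lambda>z. (z, 0)) h a b = 0\<close> q(4)[OF qb] by (simp add: sgn_zero_iff)
  qed
  have d1: "\<forall>b\<in>ball 0 \<epsilon>. dist (h b) (b, \<Phi> b) < \<delta>1" and d2: "\<forall>b\<in>ball 0 \<epsilon>. dist (h b) (b, \<Phi> b) < \<delta>2"
    using dist by auto
  have "real_of_int k = real d"
    using graph_index_atD[OF \<delta>1(2) h d1 X_def nz] graph_index_atD[OF \<delta>2(2) h d2 X_def nz] by simp
  then show "k = int d" by linarith
qed

subsection \<open>Extension across the edge, orientation\<close>

text \<open>Although 0 is a boundary point, the half-disk contains small positive multiples of both
  1 and \<open>\<i>\<close>, which determine a real-linear map.\<close>

lemma half_disk_has_derivative_unique: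
  assumes "(u has_derivative D) (at 0 within \<Delta>plus)" "(u has_derivative D') (at 0 within \<Delta>plus)"
  shows "D = D'"
proof (rule frechet_derivative_unique_within[OF assms])
  fix i :: complex and e :: real assume "i \<in> Basis" "e > 0"
  then show "\<exists>d. 0 < \<bar>d\<bar> \<and> \<bar>d\<bar> < e \<and> 0 + d *\<^sub>R i \<in> \<Delta>plus"
    by (intro exI[of _ "min (e / 2) (1 / 2)"])
      (auto simp: Basis_complex_def half_disk_def norm_mult min_def)
qed

text \<open>The extension is holomorphic only above the edge, but its derivative at 0 is complex
  linear because the Cauchy-Riemann equations persist there by continuity. The embedding condition
  makes the tangent vector nonzero.\<close>

lemma analytic_half_disk_extension:
  assumes "analytic_half_disk u" "u 0 = 0"
  obtains V g where "smooth_on V g" "\<Delta>plus \<subseteq> V" "\<And>z. z \<in> \<Delta>plus \<Longrightarrow> g z = u z"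
    "(\<lambda>z. fst (g z)) holomorphic_on {z\<in>V. norm z < 1 \<and> Im z > 0}"
    "(\<lambda>z. snd (g z)) holomorphic_on {z\<in>V. norm z < 1 \<and> Im z > 0}"
    "\<And>z. frechet_derivative g (at 0) z = cscale z (diff0 u 1)"
    "diff0 u = frechet_derivative g (at 0)" "diff0 u 1 \<noteq> 0"
proof -
  obtain V g where g: "smooth_on V g" "\<Delta>plus \<subseteq> V" "\<And>z. z \<in> \<Delta>plus \<Longrightarrow> g z = u z"
    using assms(1) by (auto simp: analytic_half_disk_def embedded_half_disk_def smooth_up_to_def)
  have 0: "0 \<in> \<Delta>plus" by (simp add: half_disk_def)
  let ?W = "{z\<in>V. norm z < 1 \<and> Im z > 0}"
  let ?D = "\<lambda>z. frechet_derivative g (at z)"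
  have W: "?W = {z. norm z < 1 \<and> 0 < Im z}" using g(2) by (auto simp: half_disk_def)
  have Wop: "open ?W"
  proof -
    have "?W = ball 0 1 \<inter> {z. Im z > 0}" unfolding W by auto
    then show ?thesis using open_halfspace_Im_gt by (metis open_Int open_ball)
  qed
  have eqW: "g z = u z" if "z \<in> ?W" for z using that g(3) by (auto simp: half_disk_def)
  have hol: "(\<lambda>z. fst (g z)) holomorphic_on ?W" "(\<lambda>z. snd (g z)) holomorphic_on ?W"
    using assms(1) eqW unfolding analytic_half_disk_def W by (auto intro: holomorphic_transform)
  have dg: "(g has_derivative ?D z) (at z)" if "z \<in> V" for z
    using smooth_on_has_derivative[OF g(1) that] .
  have "?D z \<i> - cscale \<i> (?D z 1) = 0" if z: "z \<in> ?W" for z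
  proof -
    have "((\<lambda>z. fst (g z)) has_derivative (*) (deriv (\<lambda>z. fst (g z)) z)) (at z)"
      "((\<lambda>z. snd (g z)) has_derivative (*) (deriv (\<lambda>z. snd (g z)) z)) (at z)"
      using holomorphic_derivI[OF hol(1) Wop z] holomorphic_derivI[OF hol(2) Wop z]
      by (simp_all add: has_field_derivative_def)
    moreover have "((\<lambda>z. fst (g z)) has_derivative (\<lambda>v. fst (?D z v))) (at z)"
      "((\<lambda>z. snd (g z)) has_derivative (\<lambda>v. snd (?D z v))) (at z)"
      using dg z by (auto intro: derivative_intros)
    ultimately have "(\<lambda>v. fst (?D z v)) = (*) (deriv (\<lambda>z. fst (g z)) z)"
      "(\<lambda>v. snd (?D z v)) = (*) (deriv (\<lambda>z. snd (g z)) z)"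
      using has_derivative_unique by blast+
    then have "fst (?D z v) = deriv (\<lambda>z. fst (g z)) z * v" "snd (?D z v) = deriv (\<lambda>z. snd (g z)) z * v" for v
      by metis+
    then show ?thesis by (simp add: prod_eq_iff cscale_def mult_ac)
  qed
  \<comment> \<open>Order one is enough: it forces the Cauchy-Riemann defect to vanish at 0
    itself.\<close>
  then have "near_O 1 (\<lambda>z. ?D z \<i> - cscale \<i> (?D z 1))"
  proof (intro near_O_vanishing_on_upper_half[where V=V and \<rho>=1])
    have bl: "bounded_linear (cscale \<i>)"
      unfolding cscale_def
      by (intro bounded_linear_Pair bounded_linear_compose[OF bounded_linear_mult_right]
          bounded_linear_fst bounded_linear_snd)
    show "smooth_on V (\<lambda>z. ?D z \<i> - cscale \<i> (?D z 1))"
      by (intro smooth_on_diff smooth_on_linear_compose[OF bl] smooth_on_frechet g(1))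
  qed (use g(2) 0 in auto)
  from near_O_tendsto(2)[OF this] have CR: "?D 0 \<i> = cscale \<i> (?D 0 1)" by simp
  have V0: "0 \<in> V" using g(2) 0 by auto
  have lin: "linear (?D 0)" using dg[OF V0] has_derivative_linear by blast
  have "(u has_derivative ?D 0) (at 0 within \<Delta>plus)"
    by (rule has_derivative_transform[OF 0 _ has_derivative_at_withinI[OF dg[OF V0]]]) (simp add: g(3))
  moreover from this have "(u has_derivative diff0 u) (at 0 within \<Delta>plus)"
    unfolding diff0_def by (metis differentiable_def frechet_derivative_works)
  ultimately have d0: "diff0 u = ?D 0" by (rule half_disk_has_derivative_unique[symmetric])
  have D: "?D 0 z = cscale z (diff0 u 1)" for z
  proof -
    have "z = Re z *\<^sub>R 1 + Im z *\<^sub>R \<i>" by (simp add: complex_eq_iff)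
    then have "?D 0 z = ?D 0 (Re z *\<^sub>R 1 + Im z *\<^sub>R \<i>)" by (rule arg_cong)
    also have "\<dots> = Re z *\<^sub>R ?D 0 1 + Im z *\<^sub>R cscale \<i> (?D 0 1)"
      by (simp only: linear_add[OF lin] linear_scale[OF lin] CR)
    also have "\<dots> = cscale z (?D 0 1)"
      by (auto simp: cscale_def prod_eq_iff complex_eq_iff)
    finally show ?thesis by (simp add: d0)
  qed
  have "inj (diff0 u)"
    using assms(1) 0 by (auto simp: analytic_half_disk_def embedded_half_disk_def diff0_def)
  then have "diff0 u 1 \<noteq> diff0 u 0" by (metis injD zero_neq_one)
  then have "diff0 u 1 \<noteq> 0" using linear_0[OF lin] by (simp add: d0)
  then show ?thesis using that[OF g hol D d0] by blast
qed

lemma near_O_2_has_derivative: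
  assumes "near_O 2 k"
  shows "(k has_derivative (\<lambda>_. 0)) (at 0)"
proof -
  obtain C where C: "C > 0" "\<forall>\<^sub>F s in nhds 0. norm (k s) \<le> C * norm s ^ 2"
    using near_OE[OF assms] .
  obtain d where d: "d > 0" "\<And>s. dist s 0 < d \<Longrightarrow> norm (k s) \<le> C * norm s ^ 2"
    using C(2) unfolding eventually_nhds_metric by blast
  have k0: "k 0 = 0" using near_O_tendsto(2)[OF assms] by simp
  show ?thesis
    unfolding has_derivative_at_alt
  proof (intro conjI allI impI bounded_linear_zero)
    fix e :: real assume e: "e > 0"
    show "\<exists>d>0. \<forall>y. norm (y - 0) < d \<longrightarrow> norm (k y - k 0 - 0) \<le> e * norm (y - 0)"
    proof (intro exI[of _ "min d (e / C)"] conjI allI impI)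
      fix y :: 'a assume y: "norm (y - 0) < min d (e / C)"
      then have "C * norm y \<le> e" using C(1) by (simp add: pos_less_divide_eq mult.commute)
      then have "C * norm y * norm y \<le> e * norm y" by (rule mult_right_mono) simp
      then have "C * norm y ^ 2 \<le> e * norm y" by (simp add: power2_eq_square)
      then show "norm (k y - k 0 - 0) \<le> e * norm (y - 0)" using d(2)[of y] y k0 by simp
    qed (use d C e in auto)
  qed
qed

section \<open>Real-linear maps, orientation and differences of powers\<close>

lemma complex_linear_expand:
  fixes D :: "complex \<Rightarrow> 'a::real_vector"
  assumes "linear D"
  shows "D w = Re w *\<^sub>R D 1 + Im w *\<^sub>R D \<i>"
proof -
  have "w = Re w *\<^sub>R 1 + Im w *\<^sub>R \<i>" by (simp add: complex_eq_iff)
  then have "D w = D (Re w *\<^sub>R 1 + Im w *\<^sub>R \<i>)" by (rule arg_cong)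
  then show ?thesis by (simp only: linear_add[OF assms] linear_scale[OF assms])
qed

text \<open>In coordinates, applying \<open>D\<close> multiplies the matrix of row vectors on the
  right by the matrix of \<open>D\<close>, so determinants multiply.\<close>

lemma det4_linear:
  assumes "linear D"
  shows "det4 (D p1) (D p2) (D p3) (D p4) =
    det4 p1 p2 p3 p4 * det4 (D (1, 0)) (D (\<i>, 0)) (D (0, 1)) (D (0, \<i>))"
proof -
  let ?M = "vector [real_coords (D (1, 0)), real_coords (D (\<i>, 0)), real_coords (D (0, 1)), real_coords (D (0, \<i>))] :: real^4^4"
  let ?P = "vector [real_coords p1, real_coords p2, real_coords p3, real_coords p4] :: real^4^4"
  have Dp: "D p = Re (fst p) *\<^sub>R D (1, 0) + Im (fst p) *\<^sub>R D (\<i>, 0) + Re (snd p) *\<^sub>R D (0, 1) + Im (snd p) *\<^sub>R D (0, \<i>)" for p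
  proof -
    have "p = Re (fst p) *\<^sub>R (1, 0) + Im (fst p) *\<^sub>R (\<i>, 0) + Re (snd p) *\<^sub>R (0, 1) + Im (snd p) *\<^sub>R (0, \<i>)"
      by (simp add: prod_eq_iff complex_eq_iff)
    then have "D p = D (Re (fst p) *\<^sub>R (1, 0) + Im (fst p) *\<^sub>R (\<i>, 0) + Re (snd p) *\<^sub>R (0, 1) + Im (snd p) *\<^sub>R (0, \<i>))"
      by (rule arg_cong)
    then show ?thesis by (simp only: linear_add[OF assms] linear_scale[OF assms])
  qed
  have "real_coords (D p) $ j = (\<Sum>k\<in>UNIV. real_coords p $ k * ?M $ k $ j)" for p j
    unfolding Dp[of p] using exhaust_4[of j]
    by (auto simp: sum_4 real_coords_def vector_4)
  then have "vector [real_coords (D p1), real_coords (D p2), real_coords (D p3), real_coords (D p4)] = ?P ** ?M"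
    unfolding vec_eq_iff matrix_matrix_mult_def
    by (auto simp: forall_4 vector_4)
  then show ?thesis unfolding det4_def by (simp add: det_mul)
qed

lemma det4_block: "det4 (a, 0) (b, 0) (c1, c2) (d1, d2) = cdet a b * cdet c2 d2"
  by (simp add: det4_expand) (simp add: cdet_def)

text \<open>The determinant is the fourth power of the length of \<open>v\<close>; a complex frame
  of this kind has the standard orientation.\<close>

lemma det4_orth_frame: "v \<noteq> 0 \<Longrightarrow> det4 (cscale 1 v) (cscale \<i> v) (cscale 1 (orth_vec v)) (cscale \<i> (orth_vec v)) > 0"
proof -
  assume v: "v \<noteq> 0"
  obtain a b c d where v': "v = (Complex a b, Complex c d)" by (metis complex_surj surj_pair)
  have "det4 (cscale 1 v) (cscale \<i> v) (cscale 1 (orth_vec v)) (cscale \<i> (orth_vec v)) = (a^2 + b^2 + c^2 + d^2)^2"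
    by (simp add: v' cscale_def orth_vec_def det4_expand cdet_def) algebra
  moreover have "a^2 + b^2 + c^2 + d^2 \<noteq> 0"
    using v by (auto simp: v' add_nonneg_eq_0_iff zero_prod_def complex_eq_iff)
  ultimately show ?thesis by simp
qed

text \<open>Induction through \<open>f * (f ^ n - g ^ n) + (f - g) * g ^ n\<close>: replacing a
  parameter by its linear part inside a monomial costs only terms of higher order.\<close>

lemma near_O_power_diff:
  fixes f g :: "'a::real_normed_vector \<Rightarrow> 'b::{real_normed_algebra_1,comm_ring_1}"
  assumes "near_O 1 f" "near_O 1 g" "near_O 2 (\<lambda>z. f z - g z)"
  shows "near_O (Suc n) (\<lambda>z. f z ^ n - g z ^ n)"
proof (induction n)
  case 0
  then show ?case by (simp add: near_O_zero)
next
  case (Suc n)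
  have g: "near_O n (\<lambda>z. g z ^ n)"
  proof (induction n)
    case 0
    show ?case by (rule near_OI[of _ 1]) auto
  next
    case (Suc n)
    then show ?case using near_O_mult[OF assms(2) Suc] by simp
  qed
  have "near_O (Suc (Suc n)) (\<lambda>z. f z * (f z ^ n - g z ^ n) + (f z - g z) * g z ^ n)"
    using near_O_mult[OF assms(1) Suc] near_O_mult[OF assms(3) g]
    by (intro near_O_add) (auto simp: numeral_2_eq_2)
  then show ?case by (simp add: algebra_simps)
qed

subsection \<open>Graph functions of normal forms\<close>

text \<open>The maps \<open>g1\<close> and \<open>g2\<close> are smooth continuations across the
  edge. Of holomorphy, the locale keeps the complex linearity of their derivatives at 0; the contact
  expansion is supplied to the lemmas that use it.\<close>

locale half_disk_pair =
  fixes u1 u2 g1 g2 :: "complex \<Rightarrow> complex \<times> complex" and V1 V2 :: "complex set"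
    and v :: "complex \<times> complex" and s :: real
  assumes emb: "embedded_half_disk u1" "embedded_half_disk u2"
    and u0: "u1 0 = 0" "u2 0 = 0"
    and g1: "smooth_on V1 g1" "\<Delta>plus \<subseteq> V1" "\<And>z. z \<in> \<Delta>plus \<Longrightarrow> g1 z = u1 z"
    and g2: "smooth_on V2 g2" "\<Delta>plus \<subseteq> V2" "\<And>z. z \<in> \<Delta>plus \<Longrightarrow> g2 z = u2 z"
    and D1: "\<And>z. frechet_derivative g1 (at 0) z = cscale z v"
    and D2: "\<And>z. frechet_derivative g2 (at 0) z = cscale (of_real s * z) v"
    and v: "v \<noteq> 0" "diff0 u1 1 = v"
    and s: "s = edge_sign u1 u2" "s = 1 \<or> s = -1"
begin

lemma zero_in: "0 \<in> \<Delta>plus" "0 \<in> V1" "0 \<in> V2"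
  using g1(2) g2(2) by (auto simp: half_disk_def)

lemma g_0: "g1 0 = 0" "g2 0 = 0"
  using g1(3) g2(3) zero_in u0 by auto

text \<open>In a given normal form, \<open>B\<close> is the derivative at 0 of the change of
  parameter on the first disk, and \<open>A\<close> measures how the direction
  \<open>orth_vec v\<close> is carried to the normal plane.\<close>

context
  fixes U F r \<phi> B A
  assumes nf: "normal_form u1 u2 U F r \<phi>"
    and B_def: "B = (\<lambda>z. fst (frechet_derivative F (at 0) (cscale z v)))"
    and A_def: "A = (\<lambda>\<eta>. snd (frechet_derivative F (at 0) (cscale \<eta> (orth_vec v))))"
begin

lemma nf_unfolded:
  shows "smooth_on U F" "inj_on F U" "smooth_on (F ` U) (inv_into U F)" "open U" "0 \<in> U" "F 0 = 0" "0 < r"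
    "F ` (u1 ` \<Delta>plus \<inter> U) = (\<lambda>z. (z, 0)) ` half_disk 1 r"
    "F ` (u2 ` \<Delta>plus \<inter> U) = (\<lambda>z. (z, \<phi> z)) ` half_disk s r"
    "smooth_up_to (half_disk s r) \<phi>" "\<phi> 0 = 0" "0 < Re (B 1)"
    "det4 (frechet_derivative F (at 0) (1, 0)) (frechet_derivative F (at 0) (\<i>, 0))
       (frechet_derivative F (at 0) (0, 1)) (frechet_derivative F (at 0) (0, \<i>)) > 0"
  using nf smooth_on_open
  unfolding normal_form_def orientation_preserving_diffeo_def Let_def u0(1) s(1)[symmetric] v(2) B_def
  by (auto simp: cscale_def)

lemma F_derivative: "(F has_derivative frechet_derivative F (at 0)) (at 0)"
  using smooth_on_has_derivative[OF nf_unfolded(1,5)] .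

lemma DF_linear: "linear (frechet_derivative F (at 0))"
  using F_derivative has_derivative_linear by blast

lemma bounded_linear_AB: "bounded_linear A" "bounded_linear B"
proof -
  have "bounded_linear (frechet_derivative F (at 0))"
    using F_derivative has_derivative_bounded_linear by blast
  note b = bounded_linear_compose[OF this bounded_linear_cscale]
  show "bounded_linear A" "bounded_linear B"
    unfolding A_def B_def
    using bounded_linear_compose[OF bounded_linear_snd b] bounded_linear_compose[OF bounded_linear_fst b] by auto
qed

lemma linear_AB: "linear A" "linear B"
  using bounded_linear_AB bounded_linear.linear by auto

lemma smooth_F_g:
  assumes "smooth_on V g" "0 \<in> V" "g 0 = 0"
  obtains W where "W \<subseteq> V" "0 \<in> W" "g ` W \<subseteq> U" "smooth_on W (\<lambda>z. F (g z))"
proof -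
  let ?W = "V \<inter> g -` U"
  have "open ?W"
    using continuous_open_preimage[OF smooth_on_continuous_on[OF assms(1)] smooth_on_open[OF assms(1)] nf_unfolded(4)] .
  then have "smooth_on ?W (\<lambda>z. F (g z))"
    by (intro smooth_on_compose[OF nf_unfolded(1)] smooth_on_subset[OF assms(1)]) auto
  then show ?thesis using that[of ?W] assms nf_unfolded(5) by auto
qed

text \<open>Above the edge the image lies in the plane, so the normal component is zero there and
  therefore flat at 0. This stands in for exact flattening below the edge.\<close>

lemma F_g1_flat: "near_O n (\<lambda>z. snd (F (g1 z)))"
proof -
  obtain W where W: "W \<subseteq> V1" "0 \<in> W" "g1 ` W \<subseteq> U" "smooth_on W (\<lambda>z. F (g1 z))"
    using smooth_F_g[OF g1(1) zero_in(2) g_0(1)] .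
  show ?thesis
  proof (rule near_O_vanishing_on_upper_half[OF smooth_on_linear_compose[OF bounded_linear_snd W(4)] W(2), of 1])
    fix z assume z: "norm z < 1" "Im z > 0" "z \<in> W"
    then have zD: "z \<in> \<Delta>plus" by (simp add: half_disk_def)
    then have "u1 z \<in> u1 ` \<Delta>plus \<inter> U" using W(3) z g1(3) by force
    then have "F (u1 z) \<in> (\<lambda>z. (z, 0)) ` half_disk 1 r" using nf_unfolded(8) by blast
    then show "snd (F (g1 z)) = 0" using g1(3)[OF zD] by auto
  qed simp
qed

lemma DF_tangent: "snd (frechet_derivative F (at 0) (cscale z v)) = 0"
proof -
  have dg: "(g1 has_derivative (\<lambda>z. cscale z v)) (at 0)"
    using smooth_on_has_derivative[OF g1(1) zero_in(2)] unfolding D1 .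
  have "((\<lambda>z. snd (F (g1 z))) has_derivative (\<lambda>z. snd (frechet_derivative F (at 0) (cscale z v)))) (at 0)"
    using has_derivative_compose[OF dg, of F] F_derivative
    by (intro bounded_linear.has_derivative[OF bounded_linear_snd]) (simp add: g_0)
  moreover have "((\<lambda>z. snd (F (g1 z))) has_derivative (\<lambda>_. 0)) (at 0)"
    by (rule near_O_2_has_derivative[OF F_g1_flat])
  ultimately have "(\<lambda>z. snd (frechet_derivative F (at 0) (cscale z v))) = (\<lambda>_. 0)"
    by (rule has_derivative_unique)
  then show ?thesis by metis
qed

text \<open>The image of the first half-disk lies above the edge. A direction \<open>w\<close> with
  negative \<open>Im (B w)\<close> would take points \<open>t *\<^sub>R w\<close> of the half-disk
  below it for small positive \<open>t\<close>.\<close>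

lemma Im_B_nonneg:
  assumes w: "Im w \<ge> 0"
  shows "Im (B w) \<ge> 0"
proof (rule ccontr)
  assume neg: "\<not> Im (B w) \<ge> 0"
  obtain W where W: "W \<subseteq> V1" "0 \<in> W" "g1 ` W \<subseteq> U" "smooth_on W (\<lambda>z. F (g1 z))"
    using smooth_F_g[OF g1(1) zero_in(2) g_0(1)] .
  have dg: "(g1 has_derivative (\<lambda>z. cscale z v)) (at 0)"
    using smooth_on_has_derivative[OF g1(1) zero_in(2)] unfolding D1 .
  have d1: "((\<lambda>z. fst (F (g1 z))) has_derivative B) (at 0)"
    unfolding B_def using has_derivative_compose[OF dg, of F] F_derivative
    by (intro bounded_linear.has_derivative[OF bounded_linear_fst]) (simp add: g_0)
  have "((\<lambda>t::real. t *\<^sub>R w) has_derivative (\<lambda>t. t *\<^sub>R w)) (at 0)"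
    by (auto intro!: derivative_eq_intros)
  from has_derivative_compose[OF this, of "\<lambda>z. fst (F (g1 z))" B] d1
  have "((\<lambda>t::real. fst (F (g1 (t *\<^sub>R w)))) has_derivative (\<lambda>t. B (t *\<^sub>R w))) (at 0)" by simp
  from bounded_linear.has_derivative[OF bounded_linear_Im this]
  have "((\<lambda>t::real. Im (fst (F (g1 (t *\<^sub>R w))))) has_derivative (\<lambda>t. Im (B (t *\<^sub>R w)))) (at 0)" .
  then have "((\<lambda>t::real. Im (fst (F (g1 (t *\<^sub>R w))))) has_real_derivative Im (B w)) (at 0)"
    unfolding has_field_derivative_def
    by (rule has_derivative_eq_rhs) (simp add: linear_scale[OF linear_AB(2)] fun_eq_iff mult.commute)
  from DERIV_neg_dec_right[OF this] neg
  obtain d where d: "d > 0" "\<And>h. 0 < h \<Longrightarrow> h < d \<Longrightarrow> Im (fst (F (g1 (h *\<^sub>R w)))) < 0"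
    by (auto simp: g_0 nf_unfolded(6))
  have "((\<lambda>t::real. t *\<^sub>R w) \<longlongrightarrow> 0) (at_right 0)" by (auto intro!: tendsto_eq_intros)
  moreover have "open (W \<inter> ball 0 1)" "0 \<in> W \<inter> ball 0 1"
    using smooth_on_open[OF W(4)] W(2) by auto
  ultimately have "\<forall>\<^sub>F t in at_right 0. t *\<^sub>R w \<in> W \<inter> ball 0 1" by (rule topological_tendstoD)
  moreover have "\<forall>\<^sub>F t in at_right (0::real). 0 < t \<and> t < d"
    using d(1) by (auto simp: eventually_at_right_field)
  ultimately have "\<forall>\<^sub>F t in at_right 0. 0 < t \<and> t < d \<and> t *\<^sub>R w \<in> W \<inter> ball 0 1"
    by eventually_elim simp
  then obtain t where t: "0 < t" "t < d" "t *\<^sub>R w \<in> W" "norm (t *\<^sub>R w) < 1"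
    by (auto dest!: eventually_happens)
  then have zD: "t *\<^sub>R w \<in> \<Delta>plus" using w by (simp add: half_disk_def)
  then have "u1 (t *\<^sub>R w) \<in> u1 ` \<Delta>plus \<inter> U" using W(3) t g1(3) by force
  then have "F (u1 (t *\<^sub>R w)) \<in> (\<lambda>z. (z, 0)) ` half_disk 1 r" using nf_unfolded(8) by blast
  then have "Im (fst (F (g1 (t *\<^sub>R w)))) \<ge> 0" using g1(3)[OF zD] by (auto simp: half_disk_def)
  then show False using d(2)[OF t(1,2)] by simp
qed

text \<open>In the frame adapted to \<open>v\<close> the derivative of \<open>F\<close> is block
  triangular with diagonal blocks \<open>B\<close> and \<open>A\<close>. The half-disk is preserved
  with its edge direction, which makes the \<open>B\<close> block positive; as the full determinant
  is positive, so is the \<open>A\<close> block.\<close>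

lemma AB_orientation:
  shows "Im (B 1) = 0" "Im (B \<i>) > 0" "cdet (A 1) (A \<i>) > 0"
proof -
  have "Im (B (-1)) = - Im (B 1)" by (simp add: linear_neg[OF linear_AB(2)])
  then show B1: "Im (B 1) = 0" using Im_B_nonneg[of 1] Im_B_nonneg[of "-1"] by simp
  let ?D = "frechet_derivative F (at 0)"
  let ?w = "orth_vec v"
  have "det4 (?D (cscale 1 v)) (?D (cscale \<i> v)) (?D (cscale 1 ?w)) (?D (cscale \<i> ?w)) > 0"
    unfolding det4_linear[OF DF_linear, of "cscale 1 v"]
    using det4_orth_frame[OF v(1)] nf_unfolded(13) by simp
  moreover have "?D (cscale z v) = (B z, 0)" for z by (simp add: prod_eq_iff B_def DF_tangent)
  moreover have "?D (cscale z ?w) = (fst (?D (cscale z ?w)), A z)" for z by (simp add: A_def)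
  ultimately have "cdet (B 1) (B \<i>) * cdet (A 1) (A \<i>) > 0"
    by (metis (no_types, lifting) det4_block)
  then have pos: "Re (B 1) * Im (B \<i>) * cdet (A 1) (A \<i>) > 0" by (simp add: cdet_def B1)
  have "Im (B \<i>) \<ge> 0" by (rule Im_B_nonneg) simp
  then have "Re (B 1) * Im (B \<i>) \<ge> 0" using nf_unfolded(12) by (intro mult_nonneg_nonneg) auto
  moreover have "Re (B 1) * Im (B \<i>) \<noteq> 0" using pos by (metis less_irrefl mult_zero_left)
  ultimately have "Re (B 1) * Im (B \<i>) > 0" by linarith
  then show "Im (B \<i>) > 0" "cdet (A 1) (A \<i>) > 0"
    by (rule zero_less_mult_pos[OF _ nf_unfolded(12)], rule zero_less_mult_pos[OF pos])
qed

text \<open>\<open>B\<close> maps the real line to itself, so it is triangular with positive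
  diagonal, and its inverse has the same shape.\<close>

lemma B_inverse:
  obtains T where "bounded_linear T" "\<And>z. T (B z) = z" "\<And>z. B (T z) = z"
    "T 1 = of_real (1 / Re (B 1))" "Im (T \<i>) > 0"
proof -
  note lin = linear_AB(2)
  have Bz: "B z = Re z *\<^sub>R B 1 + Im z *\<^sub>R B \<i>" for z by (rule complex_linear_expand[OF lin])
  have "z = 0" if "B z = 0" for z
  proof -
    have "Im (B z) = Im z * Im (B \<i>)" "Re (B z) = Re z * Re (B 1) + Im z * Re (B \<i>)"
      by (simp_all add: Bz[of z] AB_orientation(1))
    then have "Im z = 0" "Re z = 0" using that AB_orientation(2) nf_unfolded(12) by auto
    then show ?thesis by (simp add: complex_eq_iff)
  qed
  then have "inj B" using lin by (simp add: linear_injective_0)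
  then obtain T where T: "linear T" "\<And>z. T (B z) = z" "\<And>z. B (T z) = z"
    using linear_injective_isomorphism[OF lin] by blast
  have "B 1 = Re (B 1) *\<^sub>R 1" using AB_orientation(1) by (simp add: complex_eq_iff)
  then have "Re (B 1) *\<^sub>R T 1 = 1" using T(2)[of 1] linear_scale[OF T(1), of "Re (B 1)" 1] by simp
  then have "T 1 = of_real (1 / Re (B 1))"
    using nf_unfolded(12) by (simp add: scaleR_conv_of_real field_simps)
  moreover have "Im (T \<i>) * Im (B \<i>) = 1"
    using arg_cong[OF T(3)[of \<i>], of Im] by (simp add: Bz[of "T \<i>"] AB_orientation(1))
  then have "Im (T \<i>) > 0" using AB_orientation(2) by (metis zero_less_mult_pos2 zero_less_one)
  ultimately show ?thesis using that[of T] T linear_conv_bounded_linear by blast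
qed

text \<open>\<open>y z\<close> is the parameter on the second disk of the graph point over
  \<open>z\<close>. It tends to 0 because \<open>u2\<close> is a homeomorphism onto its image;
  injectivity alone would allow distant parameters to approach the same point.\<close>

lemma graph_parameter:
  obtains y where "filterlim y (nhds 0) (nhds 0)"
    "\<And>z. z \<in> half_disk s r \<Longrightarrow> F (g2 (y z)) = (z, \<phi> z)" "\<And>z. z \<notin> half_disk s r \<Longrightarrow> y z = 0"
proof -
  obtain w where w: "homeomorphism \<Delta>plus (u2 ` \<Delta>plus) u2 w"
    using emb(2) by (auto simp: embedded_half_disk_def)
  let ?H = "half_disk s r"
  define q where "q z = inv_into U F (z, \<phi> z)" for z
  have qH: "q z \<in> u2 ` \<Delta>plus" "F (q z) = (z, \<phi> z)" "(z, \<phi> z) \<in> F ` U" if "z \<in> ?H" for z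
  proof -
    have "(z, \<phi> z) \<in> F ` (u2 ` \<Delta>plus \<inter> U)" using that nf_unfolded(9) by blast
    then obtain p where "(z, \<phi> z) = F p" "p \<in> u2 ` \<Delta>plus \<inter> U" by (rule imageE)
    then have p: "p \<in> u2 ` \<Delta>plus" "p \<in> U" "F p = (z, \<phi> z)" by simp_all
    then have "q z = p" unfolding q_def using inv_into_f_f[OF nf_unfolded(2)] by metis
    then show "q z \<in> u2 ` \<Delta>plus" "F (q z) = (z, \<phi> z)" "(z, \<phi> z) \<in> F ` U"
      using p(1,3) imageI[OF p(2), of F] by simp_all
  qed
  have "continuous_on ?H \<phi>"
  proof -
    obtain V g where "?H \<subseteq> V" "smooth_on V g" "\<And>x. x \<in> ?H \<Longrightarrow> g x = \<phi> x"
      using nf_unfolded(10) by (auto simp: smooth_up_to_def)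
    then show ?thesis
      using continuous_on_subset[OF smooth_on_continuous_on] by (metis continuous_on_cong)
  qed
  then have "continuous_on ?H (\<lambda>z. (z, \<phi> z))" by (intro continuous_intros)
  then have "continuous_on ?H q"
    unfolding q_def
    by (rule continuous_on_compose2[OF smooth_on_continuous_on[OF nf_unfolded(3)]]) (use qH(3) in auto)
  then have cont: "continuous_on ?H (\<lambda>z. w (q z))"
    by (rule continuous_on_compose2[OF homeomorphism_cont2[OF w]]) (use qH(1) in auto)
  have H0: "0 \<in> ?H" using nf_unfolded(7) by (simp add: half_disk_def)
  have "q 0 = 0"
    unfolding q_def nf_unfolded(11) using inv_into_f_f[OF nf_unfolded(2,5)] nf_unfolded(6)
    by (simp add: zero_prod_def)
  then have wq0: "w (q 0) = 0" using homeomorphism_apply1[OF w zero_in(1)] u0(2) by simp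
  \<comment> \<open>The value 0 off the half-disk makes \<open>y\<close> total, so estimates on full
    neighbourhoods can be composed with it.\<close>
  define y where "y z = (if z \<in> ?H then w (q z) else 0)" for z
  show ?thesis
  proof (rule that[of y])
    show "filterlim y (nhds 0) (nhds 0)"
    proof (rule tendstoI)
      fix e :: real assume "e > 0"
      then obtain d where d: "d > 0" "\<And>z. z \<in> ?H \<Longrightarrow> dist z 0 < d \<Longrightarrow> dist (w (q z)) (w (q 0)) < e"
        using cont H0 unfolding continuous_on_iff by blast
      then show "\<forall>\<^sub>F x in nhds 0. dist (y x) 0 < e"
        unfolding eventually_nhds_metric using wq0 \<open>e > 0\<close> by (auto simp: y_def)
    qed
    fix z assume z: "z \<in> ?H"
    have "w (q z) \<in> \<Delta>plus" using homeomorphism_image2[OF w] qH(1)[OF z] by blast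
    then show "F (g2 (y z)) = (z, \<phi> z)"
      using z homeomorphism_apply2[OF w qH(1)[OF z]] qH(2)[OF z] by (simp add: y_def g2(3))
  qed (simp add: y_def)
qed

lemma F_g2_tangential: "near_O 2 (\<lambda>z. fst (F (g2 z)) - B (of_real s * z))"
proof -
  obtain W where W: "W \<subseteq> V2" "0 \<in> W" "g2 ` W \<subseteq> U" "smooth_on W (\<lambda>z. F (g2 z))"
    using smooth_F_g[OF g2(1) zero_in(3) g_0(2)] .
  have dg: "(g2 has_derivative (\<lambda>z. cscale (of_real s * z) v)) (at 0)"
    using smooth_on_has_derivative[OF g2(1) zero_in(3)] unfolding D2 .
  have "((\<lambda>z. fst (F (g2 z))) has_derivative (\<lambda>z. B (of_real s * z))) (at 0)"
    unfolding B_def using has_derivative_compose[OF dg, of F] F_derivative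
    by (intro bounded_linear.has_derivative[OF bounded_linear_fst]) (simp add: g_0)
  then have D: "frechet_derivative (\<lambda>z. fst (F (g2 z))) (at 0) = (\<lambda>z. B (of_real s * z))"
    using frechet_derivative_at by metis
  have "near_O (Suc 1) (\<lambda>z. fst (F (g2 (0 + 1 * z ^ 1))) - fst (F (g2 0))
      - frechet_derivative (\<lambda>z. fst (F (g2 z))) (at 0) (1 * z ^ 1))"
    by (rule near_O_linearization[OF smooth_on_linear_compose[OF bounded_linear_fst W(4)] W(2)
          near_O_zero near_O_power]) simp
  then show ?thesis by (simp add: D g_0 nf_unfolded(6) numeral_2_eq_2)
qed

text \<open>The normal component of \<open>F\<close> is expanded around the point
  \<open>g1 (poly \<sigma> z)\<close>, where it is flat. The linear term sends the transverse
  remainder to \<open>A (a * z ^ e)\<close>, and linearizing at 0 costs only order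
  \<open>e + 1\<close>.\<close>

lemma F_g2_normal:
  assumes \<sigma>: "near_O 1 (poly \<sigma>)" "e > 0"
    and R: "near_O (Suc e) (\<lambda>z. g2 z - g1 (poly \<sigma> z) - cscale (a * z ^ e) (orth_vec v))"
  shows "near_O (Suc e) (\<lambda>z. snd (F (g2 z)) - A (a * z ^ e))"
proof -
  let ?G = "\<lambda>p. snd (F p)"
  let ?y = "\<lambda>z. g1 (poly \<sigma> z)"
  let ?\<delta> = "\<lambda>z. g2 z - ?y z"
  have G: "smooth_on U ?G" using smooth_on_linear_compose[OF bounded_linear_snd nf_unfolded(1)] .
  have DG: "frechet_derivative ?G (at 0) = (\<lambda>p. snd (frechet_derivative F (at 0) p))"
    using bounded_linear.has_derivative[OF bounded_linear_snd F_derivative] frechet_derivative_at by metis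
  have "near_O 1 g1"
    using smooth_on_has_derivative[OF g1(1) zero_in(2)] g_0(1)
    by (intro near_O_differentiable) (auto simp: differentiable_def)
  then have y: "near_O 1 ?y" using \<sigma>(1) by (rule near_O_compose)
  have \<delta>: "near_O e ?\<delta>"
    using near_O_add[OF near_O_mono[OF R, of e] near_O_cscale_power[of e a "orth_vec v"]] by simp
  have 1: "near_O (Suc e) (\<lambda>z. ?G (?y z + ?\<delta> z) - ?G (?y z) - frechet_derivative ?G (at 0) (?\<delta> z))"
    by (rule near_O_linearization[OF G nf_unfolded(5) y \<delta> \<sigma>(2)])
  have 2: "near_O (Suc e) (\<lambda>z. ?G (?y z))" by (rule near_O_compose[OF F_g1_flat \<sigma>(1)])
  have "bounded_linear (\<lambda>p. snd (frechet_derivative F (at 0) p))"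
    using bounded_linear_compose[OF bounded_linear_snd] F_derivative has_derivative_bounded_linear by blast
  from near_O_linear[OF this R]
  have 3: "near_O (Suc e) (\<lambda>z. frechet_derivative ?G (at 0) (?\<delta> z) - A (a * z ^ e))"
    unfolding DG A_def by (simp add: linear_diff[OF DF_linear])
  from near_O_add[OF near_O_add[OF 1 2] 3] show ?thesis by simp
qed

text \<open>The first component of the graph equation determines the parameter up to second order as
  \<open>of_real s * T z\<close>; substituting it into the expansion of the normal component gives
  the graph function.\<close>

lemma phi_expansion:
  assumes \<sigma>: "near_O 1 (poly \<sigma>)" "e > 0"
    and R: "near_O (Suc e) (\<lambda>z. g2 z - g1 (poly \<sigma> z) - cscale (a * z ^ e) (orth_vec v))"
    and T: "bounded_linear T" "\<And>z. T (B z) = z"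
  shows "near_O (Suc e) (\<lambda>z. if z \<in> half_disk s r then \<phi> z - A (a * (of_real s * T z) ^ e) else 0)"
proof -
  let ?H = "half_disk s r"
  obtain y where y: "filterlim y (nhds 0) (nhds 0)"
    "\<And>z. z \<in> ?H \<Longrightarrow> F (g2 (y z)) = (z, \<phi> z)" "\<And>z. z \<notin> ?H \<Longrightarrow> y z = 0"
    using graph_parameter by metis
  define p where "p z = (if z \<in> ?H then of_real s * T z else 0)" for z
  have ss: "of_real s * (of_real s * z) = z" for z :: complex using s(2) by auto
  obtain K where K: "K > 0" "\<And>z. norm (T z) \<le> norm z * K"
    using bounded_linear.pos_bounded[OF T(1)] by auto
  have pK: "norm (p z) \<le> K * norm z" for z
    using K s(2) by (auto simp: p_def norm_mult mult.commute)
  have p1: "near_O 1 p" by (rule near_OI[of _ K]) (simp add: pK)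
  obtain C where C: "C > 0" "\<forall>\<^sub>F z in nhds 0. norm (of_real s * T (fst (F (g2 z)) - B (of_real s * z))) \<le> C * norm z ^ 2"
    using near_OE[OF near_O_linear[OF bounded_linear_mult_right[of "of_real s"] near_O_linear[OF T(1) F_g2_tangential]]] .
  \<comment> \<open>Apply \<open>of_real s * T\<close> to the tangential error at
    \<open>y z\<close>: since \<open>T\<close> inverts \<open>B\<close> and \<open>s\<close> squares
    to 1, what is left is exactly \<open>p z - y z\<close>.\<close>
  have py: "p z - y z = (if z \<in> ?H then of_real s * T (fst (F (g2 (y z))) - B (of_real s * y z)) else 0)" for z
    using bounded_linear.linear[OF T(1)] by (auto simp: p_def y linear_diff T(2) right_diff_distrib ss)
  have "\<forall>\<^sub>F z in nhds 0. norm (of_real s * T (fst (F (g2 (y z))) - B (of_real s * y z))) \<le> C * norm (y z) ^ 2"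
    using eventually_compose_filterlim[OF C(2) y(1)] .
  moreover have "\<forall>\<^sub>F z in nhds 0. norm (y z) < 1 / (2 * C)"
    using tendstoD[OF y(1), of "1 / (2 * C)"] C(1) by simp
  \<comment> \<open>So far \<open>y\<close> is only known to tend to 0. For small \<open>y z\<close>
    the quadratic error is at most half of \<open>norm (y z)\<close> and can be absorbed, which
    bounds \<open>y\<close> by a multiple of \<open>norm z\<close>.\<close>
  ultimately have "\<forall>\<^sub>F z in nhds 0. norm (y z) \<le> (2 * K) * norm z ^ 1"
  proof eventually_elim
    case (elim z)
    have "norm (p z - y z) \<le> C * norm (y z) ^ 2" using elim(1) C(1) unfolding py by simp
    also have "\<dots> = (C * norm (y z)) * norm (y z)" by (simp add: power2_eq_square)
    also have "\<dots> \<le> (1 / 2) * norm (y z)"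
      using elim(2) C(1) by (intro mult_right_mono) (auto simp: field_simps)
    finally have "norm (y z) \<le> 2 * norm (p z)"
      using norm_triangle_ineq2[of "y z" "p z"] by (simp add: norm_minus_commute)
    then show ?case using pK[of z] by simp
  qed
  then have y1: "near_O 1 y" by (rule near_OI)
  from near_O_compose[OF near_O_linear[OF bounded_linear_mult_right[of "of_real s"] near_O_linear[OF T(1) F_g2_tangential]] this]
  obtain C' where C': "\<forall>\<^sub>F z in nhds 0. norm (of_real s * T (fst (F (g2 (y z))) - B (of_real s * y z))) \<le> C' * norm z ^ 2" "C' > 0"
    using near_OE by blast
  have "near_O 2 (\<lambda>z. p z - y z)"
    by (rule near_OI[of _ C'], use C'(1) in eventually_elim) (use C'(2) in \<open>auto simp: py\<close>)
  then have "near_O 2 (\<lambda>z. y z - p z)" using near_O_minus by fastforce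
  from near_O_power_diff[OF y1 p1 this]
  have "near_O (Suc e) (\<lambda>z. A (a * (y z ^ e - p z ^ e)))"
    by (intro near_O_linear[OF bounded_linear_AB(1)] near_O_linear[OF bounded_linear_mult_right])
  from near_O_add[OF near_O_compose[OF F_g2_normal[OF \<sigma> R] y1] this]
  have *: "near_O (Suc e) (\<lambda>z. snd (F (g2 (y z))) - A (a * p z ^ e))"
    by (simp add: right_diff_distrib linear_diff[OF linear_AB(1)])
  show ?thesis
  proof (rule near_O_cong[OF *], intro always_eventually allI)
    fix z
    show "snd (F (g2 (y z))) - A (a * p z ^ e) =
      (if z \<in> ?H then \<phi> z - A (a * (of_real s * T z) ^ e) else 0)"
      using \<sigma>(2) by (auto simp: p_def y g_0 nf_unfolded(6) linear_0[OF linear_AB(1)] power_0_left)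
  qed
qed

end

end

subsection \<open>Reflection\<close>

lemma linear_cdet_nonzero_inj:
  assumes "linear A" "cdet (A 1) (A \<i>) \<noteq> 0"
  shows "inj A"
proof -
  have "z = 0" if z: "A z = 0" for z
  proof -
    have "Re z * Re (A 1) + Im z * Re (A \<i>) = 0" "Re z * Im (A 1) + Im z * Im (A \<i>) = 0"
      using arg_cong[OF z[unfolded complex_linear_expand[OF assms(1), of z]], of Re]
        arg_cong[OF z[unfolded complex_linear_expand[OF assms(1), of z]], of Im] by simp_all
    then have "Re z * cdet (A 1) (A \<i>) = 0" "Im z * cdet (A 1) (A \<i>) = 0"
      unfolding cdet_def by algebra+
    then show ?thesis using assms(2) by (simp add: complex_eq_iff)
  qed
  then show ?thesis using assms(1) by (simp add: linear_injective_0)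
qed

text \<open>Real eigenvalues of \<open>L\<close> are positive, so \<open>L y / y\<close> never meets
  the branch cut and its principal logarithm is continuous. On the real axis the quotient is the
  positive number \<open>l\<close>, hence the real logarithm.\<close>

lemma linear_orientation_log:
  assumes "bounded_linear L" "L 1 = complex_of_real l" "l > 0" "Im (L \<i>) > 0"
  obtains M where "continuous_on (- {0}) M" "\<And>y. y \<noteq> 0 \<Longrightarrow> L y = y * exp (M y)"
    "\<And>y. y \<noteq> 0 \<Longrightarrow> Im y = 0 \<Longrightarrow> Im (M y) = 0"
proof (rule that[of "\<lambda>y. Ln (L y / y)"])
  have Ly: "L y = Re y *\<^sub>R of_real l + Im y *\<^sub>R L \<i>" for y
    using complex_linear_expand[OF bounded_linear.linear[OF assms(1)], of y] assms(2) by simp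
  have nr: "L y / y \<notin> \<real>\<^sub>\<le>\<^sub>0" if y: "y \<noteq> 0" for y
  proof
    assume "L y / y \<in> \<real>\<^sub>\<le>\<^sub>0"
    then obtain k where k: "k \<le> 0" "L y / y = of_real k" by (auto elim: nonpos_Reals_cases)
    then have eq: "L y = of_real k * y" using y by (simp add: field_simps)
    have "Im y * (Im (L \<i>) - k) = 0"
      using arg_cong[OF eq, of Im] unfolding Ly[of y] by (simp add: algebra_simps)
    then have "Im y = 0" using k assms(4) by auto
    moreover from this have "Re y * (l - k) = 0"
      using arg_cong[OF eq, of Re] unfolding Ly[of y] by (simp add: algebra_simps)
    ultimately show False using k assms(3) y by (auto simp: complex_eq_iff)
  qed
  show "continuous_on (- {0}) (\<lambda>y. Ln (L y / y))"
    using nr by (intro continuous_intros linear_continuous_on assms(1)) auto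
  show "L y = y * exp (Ln (L y / y))" if "y \<noteq> 0" for y
  proof -
    have "L y / y \<noteq> 0" using nr[OF that] by auto
    then show ?thesis using that by (simp add: field_simps)
  qed
  show "Im (Ln (L y / y)) = 0" if "y \<noteq> 0" "Im y = 0" for y
  proof -
    have "y = of_real (Re y)" "L y = of_real (l * Re y)"
      unfolding Ly[of y] using that by (simp_all add: complex_eq_iff)
    then have "L y / y = of_real l" using that by (metis of_real_0 of_real_divide nonzero_mult_div_cancel_right)
    then show ?thesis using assms(3) by simp
  qed
qed

lemma reflect_ext_alt: "reflect_ext s f z = (if 0 \<le> s * Im z then f z else cnj (f (cnj z)))"
  by (simp add: reflect_ext_def complex_eq_iff)

text \<open>Being real on the axis makes the two halves agree there. Allowing \<open>X\<close> to be
  empty or \<open>{0}\<close> covers both the graph function on the full disk and its logarithm on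
  the punctured one.\<close>

lemma continuous_on_reflect:
  assumes "continuous_on {z\<in>ball 0 R - X. 0 \<le> s * Im z} f" "X \<subseteq> {0}" "s = 1 \<or> s = -1"
    "\<And>z. z \<in> ball 0 R - X \<Longrightarrow> Im z = 0 \<Longrightarrow> Im (f z) = 0"
  shows "continuous_on (ball 0 R - X) (\<lambda>z. if 0 \<le> s * Im z then f z else cnj (f (cnj z)))"
proof -
  let ?B = "ball 0 R - X"
  let ?S = "{z\<in>?B. 0 \<le> s * Im z}" and ?T = "{z\<in>?B. s * Im z \<le> 0}"
  have ST: "?S \<union> ?T = ?B" by auto
  have cl: "closed {z. 0 \<le> s * Im z}" "closed {z. s * Im z \<le> 0}"
    by (auto intro!: closed_Collect_le continuous_intros)
  have "continuous_on (?S \<union> ?T) (\<lambda>z. if 0 \<le> s * Im z then f z else cnj (f (cnj z)))"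
  proof (rule continuous_on_cases_local)
    show "closedin (top_of_set (?S \<union> ?T)) ?S"
      unfolding ST closedin_closed using cl(1) by (intro exI[of _ "{z. 0 \<le> s * Im z}"]) auto
    show "closedin (top_of_set (?S \<union> ?T)) ?T"
      unfolding ST closedin_closed using cl(2) by (intro exI[of _ "{z. s * Im z \<le> 0}"]) auto
    show "continuous_on ?T (\<lambda>z. cnj (f (cnj z)))"
    proof (intro continuous_intros continuous_on_compose2[OF assms(1), of _ cnj])
      show "cnj ` ?T \<subseteq> ?S" using assms(2) by (auto simp: complex_eq_iff)
    qed
    fix z assume "z \<in> ?S \<and> \<not> 0 \<le> s * Im z \<or> z \<in> ?T \<and> 0 \<le> s * Im z"
    then have z: "z \<in> ?B" "Im z = 0" using assms(3) by auto
    then have c: "cnj z = z" by (simp add: complex_eq_iff)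
    show "f z = cnj (f (cnj z))" unfolding c using assms(4)[OF z] by (simp add: complex_eq_iff)
  qed (rule assms(1))
  then show ?thesis unfolding ST .
qed

lemma near_O_of_real: "near_O n f \<Longrightarrow> near_O n (\<lambda>x::real. f (of_real x :: complex))"
  by (rule near_O_compose) (auto intro!: near_OI[of _ 1])

lemma near_O_monomial_coeff_zero:
  assumes "near_O (Suc d) (\<lambda>x::real. of_real x ^ d * c :: complex)"
  shows "c = 0"
  using near_O_leading_coeff_zero[OF assms, where m=d and q="\<lambda>_. c"] by (simp add: norm_mult norm_power)

text \<open>On the real axis \<open>T\<close> is multiplication by \<open>t\<close>, so the whole
  power is a real scalar and can be taken out of the real-linear map \<open>A\<close>.\<close>

lemma edge_expansion:
  fixes T A \<phi> :: "complex \<Rightarrow> complex"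
  assumes exp: "near_O (Suc d) (\<lambda>z. if z \<in> half_disk s r then \<phi> z - A (a * (of_real s * T z) ^ d) else 0)"
    and lin: "bounded_linear T" "bounded_linear A" "T 1 = of_real t" and "r > 0"
  shows "near_O (Suc d) (\<lambda>x::real. \<phi> (of_real x) - of_real x ^ d * (of_real ((s * t) ^ d) * A a))"
proof (rule near_O_cong[OF near_O_of_real[OF exp]])
  have "\<forall>\<^sub>F x::real in nhds 0. \<bar>x\<bar> < r"
    using eventually_nhds_ball[OF assms(5), of "0::real"] by (auto elim: eventually_mono)
  then show "\<forall>\<^sub>F x::real in nhds 0. (if of_real x \<in> half_disk s r then \<phi> (of_real x) - A (a * (of_real s * T (of_real x)) ^ d) else 0) =
      \<phi> (of_real x) - of_real x ^ d * (of_real ((s * t) ^ d) * A a)"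
  proof eventually_elim
    case (elim x)
    have "T (of_real x) = of_real (x * t)"
      using linear_scale[OF bounded_linear.linear[OF lin(1)], of x 1] lin(3)
      by (simp add: scaleR_conv_of_real)
    then have "a * (of_real s * T (of_real x)) ^ d = (x ^ d * (s * t) ^ d) *\<^sub>R a"
      by (simp add: scaleR_conv_of_real power_mult_distrib mult_ac)
    then have "A (a * (of_real s * T (of_real x)) ^ d) = (x ^ d * (s * t) ^ d) *\<^sub>R A a"
      by (simp only: linear_scale[OF bounded_linear.linear[OF lin(2)]])
    then show ?case using elim by (simp add: half_disk_def scaleR_conv_of_real mult_ac)
  qed
qed

text \<open>The logarithm of \<open>\<phi>(z)/z\<^sup>d\<close> on the half-disk is real on the edge, so it extends by reflection;
  this is where the orientations enter.\<close>

lemma reflect_ext_log_equiv: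
  fixes T A \<phi> :: "complex \<Rightarrow> complex"
  assumes T: "bounded_linear T" "T 1 = of_real t" "t > 0" "Im (T \<i>) > 0"
    and A: "bounded_linear A" "cdet (A 1) (A \<i>) > 0" and a: "a \<noteq> 0" and s: "s = 1 \<or> s = -1" and r: "r > 0"
    and exp: "near_O (Suc d) (\<lambda>z. if z \<in> half_disk s r then \<phi> z - A (a * (of_real s * T z) ^ d) else 0)"
    and \<phi>: "continuous_on (half_disk s r) \<phi>" "\<And>x. x \<in> {-r<..<r} \<Longrightarrow> Im (\<phi> (of_real x)) = 0"
  obtains R where "R > 0" "continuous_on (ball 0 R) (reflect_ext s \<phi>)"
    "log_equiv (ball 0 R - {0}) (reflect_ext s \<phi>) (\<lambda>z. z ^ d)"
proof -
  note linT = bounded_linear.linear[OF T(1)] and linA = bounded_linear.linear[OF A(1)]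
  have st: "s * t \<noteq> 0" using s T(3) by auto
  \<comment> \<open>The leading coefficient on the edge is a nonzero real multiple of
    \<open>A a\<close>; as \<open>\<phi>\<close> is real there, the imaginary part of this
    coefficient must vanish.\<close>
  have ImAa: "Im (A a) = 0"
  proof -
    have "near_O (Suc d) (\<lambda>x::real. Im (\<phi> (of_real x) - of_real x ^ d * (of_real ((s * t) ^ d) * A a)))"
      by (rule near_O_linear[OF bounded_linear_Im edge_expansion[OF exp T(1) A(1) T(2) r]])
    from near_O_minus[OF near_O_linear[OF bounded_linear_of_real this]]
    have "near_O (Suc d) (\<lambda>x::real. of_real x ^ d * (complex_of_real ((s * t) ^ d * Im (A a))))"
    proof (rule near_O_cong)
      have "\<forall>\<^sub>F x::real in nhds 0. \<bar>x\<bar> < r"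
        using eventually_nhds_ball[OF r, of "0::real"] by (auto elim: eventually_mono)
      then show "\<forall>\<^sub>F x::real in nhds 0. - complex_of_real (Im (\<phi> (of_real x) - of_real x ^ d * (of_real ((s * t) ^ d) * A a))) =
          of_real x ^ d * (complex_of_real ((s * t) ^ d * Im (A a)))"
      proof eventually_elim
        case (elim x)
        have "of_real x ^ d * (of_real ((s * t) ^ d) * A a) = (x ^ d * (s * t) ^ d) *\<^sub>R A a"
          by (simp add: scaleR_conv_of_real)
        then show ?case using elim \<phi>(2)[of x] by (simp add: abs_less_iff)
      qed
    qed
    from near_O_monomial_coeff_zero[OF this] show ?thesis using st by simp
  qed
  define c where "c = Re (A a)"
  have Aa: "A a = of_real c" using ImAa by (simp add: c_def complex_eq_iff)
  have injA: "inj A" using linear_cdet_nonzero_inj[OF linA] A(2) by simp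
  have c0: "c \<noteq> 0" using injA a linear_0[OF linA] Aa by (metis injD of_real_0)
  \<comment> \<open>Normalized so that \<open>A'\<close> fixes 1; dividing by the real number
    \<open>c\<close> and premultiplying by \<open>a\<close> leaves an orientation-preserving map of
    the kind that has a logarithm.\<close>
  define A' where "A' y = A (a * y) / of_real c" for y
  have A': "bounded_linear A'"
    unfolding A'_def divide_inverse
    by (intro bounded_linear_compose[OF bounded_linear_mult_left]
        bounded_linear_compose[OF A(1)] bounded_linear_mult_right)
  have "Im (A' \<i>) > 0"
  proof -
    have "cdet (A a) (A (a * \<i>)) = ((Re a)\<^sup>2 + (Im a)\<^sup>2) * cdet (A 1) (A \<i>)"
      unfolding complex_linear_expand[OF linA, of a] complex_linear_expand[OF linA, of "a * \<i>"]
      by (simp add: cdet_def) algebra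
    moreover have "(Re a)\<^sup>2 + (Im a)\<^sup>2 > 0"
      using a by (auto simp: complex_eq_iff sum_power2_gt_zero_iff)
    ultimately have "c * Im (A (a * \<i>)) > 0" using A(2) by (simp add: Aa cdet_def)
    then show ?thesis using c0 by (auto simp: A'_def zero_less_mult_iff zero_less_divide_iff)
  qed
  then obtain M2 where M2: "continuous_on (- {0}) M2" "\<And>y. y \<noteq> 0 \<Longrightarrow> A' y = y * exp (M2 y)"
    "\<And>y. y \<noteq> 0 \<Longrightarrow> Im y = 0 \<Longrightarrow> Im (M2 y) = 0"
    using linear_orientation_log[OF A', of 1] Aa c0 by (auto simp: A'_def)
  obtain M1 where M1: "continuous_on (- {0}) M1" "\<And>y. y \<noteq> 0 \<Longrightarrow> T y = y * exp (M1 y)"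
    "\<And>y. y \<noteq> 0 \<Longrightarrow> Im y = 0 \<Longrightarrow> Im (M1 y) = 0"
    using linear_orientation_log[OF T] by blast
  define p where "p z = of_real s * T z" for z
  define Q where "Q z = A (a * p z ^ d)" for z
  have p0: "p z \<noteq> 0" if "z \<noteq> 0" for z using M1(2)[OF that] that s by (auto simp: p_def)
  have Q0: "Q z \<noteq> 0" if "z \<noteq> 0" for z
    using p0[OF that] a injA linear_0[OF linA] unfolding Q_def by (metis injD mult_eq_0_iff power_not_zero)
  \<comment> \<open>The logarithm of the leading term \<open>Q\<close>, after removal of
    \<open>K * z ^ d\<close>: \<open>d\<close> times the logarithm from \<open>T\<close>, plus the
    one from \<open>A'\<close>.\<close>
  define N0 where "N0 z = of_nat d * M1 z + M2 (p z ^ d)" for z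
  define K where "K = complex_of_real (c * s ^ d)"
  have QN: "Q z = K * z ^ d * exp (N0 z)" if z: "z \<noteq> 0" for z
  proof -
    define w where "w = M2 (p z ^ d)"
    have pd: "p z ^ d = of_real (s ^ d) * z ^ d * exp (of_nat d * M1 z)"
      by (simp add: p_def M1(2)[OF z] power_mult_distrib exp_of_nat_mult)
    have "Q z = of_real c * A' (p z ^ d)" using c0 by (simp add: Q_def A'_def)
    also have "\<dots> = of_real c * (p z ^ d * exp w)" using M2(2) p0[OF z] by (simp add: w_def)
    also have "\<dots> = K * z ^ d * (exp (of_nat d * M1 z) * exp w)" unfolding pd by (simp add: K_def)
    finally show ?thesis by (simp add: N0_def exp_add w_def)
  qed
  have Qc: "continuous_on UNIV Q" "continuous_on UNIV p"
  proof -
    have pc: "continuous_on UNIV p"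
      unfolding p_def by (intro continuous_intros bounded_linear.continuous_on[OF T(1)])
    then show "continuous_on UNIV Q"
      unfolding Q_def by (intro bounded_linear.continuous_on[OF A(1)] continuous_intros)
    show "continuous_on UNIV p" by (rule pc)
  qed
  have N0c: "continuous_on (- {0}) N0"
  proof -
    have "continuous_on (- {0}) p" by (rule continuous_on_subset[OF Qc(2)]) simp
    then have "continuous_on (- {0}) (\<lambda>z. p z ^ d)" by (rule continuous_on_power)
    then have "continuous_on (- {0}) (\<lambda>z. M2 (p z ^ d))"
    proof (rule continuous_on_compose2[OF M2(1)])
      show "(\<lambda>z. p z ^ d) ` (- {0}) \<subseteq> - {0}"
      proof (rule image_subsetI)
        fix z :: complex assume "z \<in> - {0}"
        then have "z \<noteq> 0" by simp
        from p0[OF this] show "p z ^ d \<in> - {0}" by simp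
      qed
    qed
    then show ?thesis
      unfolding N0_def by (intro continuous_on_add continuous_on_mult continuous_on_const M1(1))
  qed
  have real_p: "Im (p x) = 0" if "Im x = 0" for x
    using that s complex_linear_expand[OF linT, of x] by (auto simp: p_def T(2))
  have real_N0: "Im (N0 x) = 0" if "x \<noteq> 0" "Im x = 0" for x
  proof -
    have "p x = of_real (Re (p x))" using real_p[OF that(2)] by (simp add: complex_eq_iff)
    then have "p x ^ d = of_real (Re (p x) ^ d)" by (metis of_real_power)
    then have "Im (p x ^ d) = 0" by (metis Im_complex_of_real)
    moreover have "p x ^ d \<noteq> 0" using p0[OF that(1)] by simp
    ultimately show ?thesis using M1(3)[OF that] M2(3) by (simp add: N0_def)
  qed
  obtain b1 where b1: "b1 > 0" "\<And>x. b1 * norm x \<le> norm (A x)"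
    using linear_inj_bounded_below_pos[OF linA injA] by blast
  have "inj T"
    by (rule linear_cdet_nonzero_inj[OF linT]) (use T in \<open>simp add: cdet_def\<close>)
  then obtain b2 where b2: "b2 > 0" "\<And>x. b2 * norm x \<le> norm (T x)"
    using linear_inj_bounded_below_pos[OF linT] by blast
  define b where "b = b1 * (norm a * b2 ^ d)"
  have b: "b > 0" "\<And>z. b * norm z ^ d \<le> norm (Q z)"
  proof -
    show "b > 0" using b1 b2 a by (simp add: b_def)
    fix z
    have "(b2 * norm z) ^ d \<le> norm (p z) ^ d"
      using b2 s by (intro power_mono) (auto simp: p_def norm_mult)
    then have "b1 * (norm a * (b2 * norm z) ^ d) \<le> b1 * norm (a * p z ^ d)"
      using b1(1) by (simp add: norm_mult norm_power mult_left_mono)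
    also have "\<dots> \<le> norm (Q z)" unfolding Q_def by (rule b1(2))
    finally show "b * norm z ^ d \<le> norm (Q z)" by (simp add: b_def power_mult_distrib mult_ac)
  qed
  obtain C where C: "C > 0" "\<forall>\<^sub>F z in nhds 0.
      norm (if z \<in> half_disk s r then \<phi> z - A (a * (of_real s * T z) ^ d) else 0) \<le> C * norm z ^ Suc d"
    using near_OE[OF exp] .
  obtain R0 where R0: "R0 > 0" "\<And>z. dist z 0 < R0 \<Longrightarrow>
      norm (if z \<in> half_disk s r then \<phi> z - A (a * (of_real s * T z) ^ d) else 0) \<le> C * norm z ^ Suc d"
    using C(2) unfolding eventually_nhds_metric by blast
  \<comment> \<open>Below \<open>b / C\<close> the error term of order \<open>d + 1\<close> is
    smaller than the lower bound \<open>b * norm z ^ d\<close> for the leading term, so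
    \<open>\<phi> / Q\<close> stays in the right half-plane.\<close>
  define R where "R = min (min R0 r) (b / C)"
  have R: "R > 0" "R \<le> R0" "R \<le> r" "R \<le> b / C" using R0(1) r b(1) C(1) by (auto simp: R_def)
  let ?H = "{z\<in>ball 0 R - {0}. 0 \<le> s * Im z}"
  have Hr: "?H \<subseteq> half_disk s r" using R(3) by (auto simp: half_disk_def)
  have close: "norm (\<phi> z - Q z) < norm (Q z)" if z: "z \<in> ?H" for z
  proof -
    have "norm (\<phi> z - Q z) \<le> C * norm z ^ Suc d"
      using R0(2)[of z] z Hr R(2) by (auto simp: Q_def p_def)
    also have "\<dots> = (C * norm z) * norm z ^ d" by simp
    also have "\<dots> < b * norm z ^ d"
    proof (rule mult_strict_right_mono)
      have "norm z < b / C" using z R(4) by simp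
      then show "C * norm z < b" using C(1) by (simp add: pos_less_divide_eq mult.commute)
    qed (use z in simp)
    also have "\<dots> \<le> norm (Q z)" by (rule b(2))
    finally show ?thesis .
  qed
  have pos: "Re (\<phi> z / Q z) > 0" if z: "z \<in> ?H" for z
  proof -
    have q: "Q z \<noteq> 0" using Q0 z by auto
    have "norm (\<phi> z / Q z - 1) = norm (\<phi> z - Q z) / norm (Q z)"
      using q by (simp add: diff_divide_distrib flip: norm_divide)
    also have "\<dots> < 1" using close[OF z] q by (simp add: divide_less_eq)
    finally show ?thesis using abs_Re_le_cmod[of "\<phi> z / Q z - 1"] by (simp add: abs_less_iff)
  qed
  have Hx: "\<phi> z = of_real (Re (\<phi> z))" if "z \<in> ball 0 R" "Im z = 0" for z
  proof -
    have "z = of_real (Re z)" "Re z \<in> {-r<..<r}"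
      using that R(3) abs_Re_le_cmod[of z] by (auto simp: complex_eq_iff abs_less_iff)
    then have "Im (\<phi> z) = 0" using \<phi>(2) by metis
    then show ?thesis by (simp add: complex_eq_iff)
  qed
  define N where "N z = N0 z + Ln (\<phi> z / Q z)" for z
  have \<phi>N: "\<phi> z = K * z ^ d * exp (N z)" if z: "z \<in> ?H" for z
  proof -
    have "\<phi> z / Q z \<noteq> 0" using pos[OF z] by auto
    then have "\<phi> z = Q z * exp (Ln (\<phi> z / Q z))" by auto
    moreover have "Q z = K * z ^ d * exp (N0 z)" using QN z by simp
    ultimately show ?thesis unfolding N_def exp_add by (metis mult.assoc)
  qed
  have "continuous_on ?H N"
  proof -
    have "continuous_on ?H \<phi>" "continuous_on ?H Q"
      using continuous_on_subset[OF \<phi>(1) Hr] continuous_on_subset[OF Qc(1) subset_UNIV] by auto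
    then have "continuous_on ?H (\<lambda>z. \<phi> z / Q z)"
      using Q0 by (intro continuous_on_divide) auto
    then have "continuous_on ?H (\<lambda>z. Ln (\<phi> z / Q z))"
    proof (rule continuous_on_Ln')
      show "\<phi> z / Q z \<notin> \<real>\<^sub>\<le>\<^sub>0" if "z \<in> ?H" for z
        using pos[OF that] by (auto simp: complex_nonpos_Reals_iff)
    qed
    moreover have "continuous_on ?H N0" by (rule continuous_on_subset[OF N0c]) auto
    ultimately show ?thesis unfolding N_def by (intro continuous_on_add)
  qed
  moreover have "Im (N z) = 0" if z: "z \<in> ball 0 R - {0}" "Im z = 0" for z
  proof -
    have zH: "z \<in> ?H" using z by simp
    have "Q z = K * z ^ d * exp (N0 z)" using QN z by simp
    moreover have "z = of_real (Re z)" "N0 z = of_real (Re (N0 z))"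
      using z real_N0[of z] by (simp_all add: complex_eq_iff)
    ultimately have "Q z = of_real (c * s ^ d * Re z ^ d * exp (Re (N0 z)))"
      unfolding K_def by (metis exp_of_real of_real_mult of_real_power)
    moreover have "\<phi> z = of_real (Re (\<phi> z))" using Hx z by simp
    ultimately obtain x where x: "\<phi> z / Q z = complex_of_real x" by (metis of_real_divide)
    then have "x > 0" using pos[OF zH] by simp
    then show ?thesis using real_N0[of z] z by (simp add: N_def x)
  qed
  ultimately have Nc: "continuous_on (ball 0 R - {0}) (\<lambda>z. if 0 \<le> s * Im z then N z else cnj (N (cnj z)))"
    using continuous_on_reflect[of R "{0}" s N] s by blast
  show ?thesis
  proof (rule that[OF R(1)])
    have "continuous_on (ball 0 R - {}) (\<lambda>z. if 0 \<le> s * Im z then \<phi> z else cnj (\<phi> (cnj z)))"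
    proof (rule continuous_on_reflect[OF continuous_on_subset[OF \<phi>(1)] _ s])
      show "Im (\<phi> z) = 0" if "z \<in> ball 0 R - {}" "Im z = 0" for z
        using Hx[of z] that by (metis Diff_empty Im_complex_of_real)
    qed (use R(3) in \<open>auto simp: half_disk_def\<close>)
    then show "continuous_on (ball 0 R) (reflect_ext s \<phi>)" by (simp add: reflect_ext_alt[abs_def])
    have "log_equiv (ball 0 R - {0}) (reflect_ext s \<phi>) (\<lambda>z. K * z ^ d)"
    proof (rule log_equivI[OF Nc])
      fix z :: complex assume z: "z \<in> ball 0 R - {0}"
      show "reflect_ext s \<phi> z = K * z ^ d * exp (if 0 \<le> s * Im z then N z else cnj (N (cnj z)))"
      proof (cases "0 \<le> s * Im z")
        case True
        then show ?thesis using \<phi>N[of z] z by (simp add: reflect_ext_alt)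
      next
        case False
        then have "cnj z \<in> ?H" using z by (auto simp: complex_eq_iff)
        from \<phi>N[OF this] False show ?thesis
          by (simp add: reflect_ext_alt K_def exp_cnj)
      qed
    qed
    moreover have "log_equiv (ball 0 R - {0}) (\<lambda>z. K * z ^ d) (\<lambda>z. z ^ d)"
      by (rule log_equiv_const) (use c0 s in \<open>auto simp: K_def\<close>)
    ultimately show "log_equiv (ball 0 R - {0}) (reflect_ext s \<phi>) (\<lambda>z. z ^ d)"
      by (rule log_equiv_trans)
  qed
qed

subsection \<open>Division by powers\<close>

lemma mult_unit_interval_in:
  fixes x t r :: real
  assumes "x \<in> {-r<..<r}" "t \<in> {0..1}"
  shows "t * x \<in> {-r<..<r}"
proof -
  have "\<bar>t * x\<bar> \<le> 1 * \<bar>x\<bar>" unfolding abs_mult using assms(2) by (intro mult_right_mono) auto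
  then show ?thesis using assms(1) by (auto simp: abs_le_iff)
qed

lemma smooth_on_real_vector_derivative:
  fixes h :: "real \<Rightarrow> 'a::real_normed_vector"
  assumes "smooth_on S h" "x \<in> S"
  shows "(h has_vector_derivative frechet_derivative h (at x) 1) (at x)"
proof -
  have h: "(h has_derivative frechet_derivative h (at x)) (at x)"
    by (rule smooth_on_has_derivative[OF assms])
  have "frechet_derivative h (at x) v = v *\<^sub>R frechet_derivative h (at x) 1" for v
    using linear_scale[OF has_derivative_linear[OF h], of v 1] by simp
  then show ?thesis
    unfolding has_vector_derivative_def using has_derivative_eq_rhs[OF h] by (metis ext)
qed

text \<open>Differentiation in \<open>x\<close> under the integral produces a factor
  \<open>t\<close>. The weight \<open>t ^ j\<close> keeps the family closed under this operation, so
  that smoothness follows by induction.\<close>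

lemma has_vector_derivative_parameter_integral:
  fixes h :: "real \<Rightarrow> 'a::euclidean_space"
  assumes h: "smooth_on {-r<..<r} h" and x: "x \<in> {-r<..<r}"
  shows "((\<lambda>x. integral {0..1} (\<lambda>t. t ^ j *\<^sub>R h (t * x))) has_vector_derivative
    integral {0..1} (\<lambda>t. t ^ Suc j *\<^sub>R frechet_derivative h (at (t * x)) 1)) (at x)"
proof -
  let ?I = "{-r<..<r}"
  let ?h' = "\<lambda>x. frechet_derivative h (at x) 1"
  have hc: "continuous_on ?I h" and hc': "continuous_on ?I ?h'"
    using smooth_on_continuous_on[OF h] smooth_on_continuous_on[OF smooth_on_frechet[OF h]] by auto
  have "((\<lambda>x. integral (cbox 0 1) (\<lambda>t. t ^ j *\<^sub>R h (t * x))) has_vector_derivative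
    integral (cbox 0 1) (\<lambda>t. t ^ Suc j *\<^sub>R ?h' (t * x))) (at x within ?I)"
  proof (rule leibniz_rule_vector_derivative[OF _ _ _ x])
    fix y t :: real assume y: "y \<in> ?I" and t: "t \<in> cbox 0 1"
    have "(h has_vector_derivative ?h' (t * y)) (at (t * y))"
      using smooth_on_real_vector_derivative[OF h] mult_unit_interval_in[OF y] t by simp
    moreover have "((\<lambda>y. t * y) has_real_derivative t) (at y within ?I)"
      by (auto intro!: derivative_eq_intros)
    ultimately have "((\<lambda>y. h (t * y)) has_vector_derivative t *\<^sub>R ?h' (t * y)) (at y within ?I)"
      using vector_diff_chain_within[of "\<lambda>y. t * y" t y ?I h "?h' (t * y)"]
      by (simp add: o_def has_real_derivative_iff_has_vector_derivative has_vector_derivative_at_within)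
    from bounded_linear.has_vector_derivative[OF bounded_linear_scaleR_right this, of "t ^ j"]
    show "((\<lambda>y. t ^ j *\<^sub>R h (t * y)) has_vector_derivative t ^ Suc j *\<^sub>R ?h' (t * y)) (at y within ?I)"
      by (simp add: mult.commute)
  next
    fix y assume y: "y \<in> ?I"
    have "continuous_on (cbox 0 1) (\<lambda>t. h (t * y))"
      by (rule continuous_on_compose2[OF hc])
        (use mult_unit_interval_in[OF y] in \<open>auto intro!: continuous_intros\<close>)
    then show "(\<lambda>t. t ^ j *\<^sub>R h (t * y)) integrable_on cbox 0 1"
      by (intro integrable_continuous continuous_intros)
  next
    have "continuous_on (?I \<times> cbox 0 1) (\<lambda>p. ?h' (snd p * fst p))"
      by (rule continuous_on_compose2[OF hc'])
        (use mult_unit_interval_in in \<open>auto intro!: continuous_intros\<close>)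
    then show "continuous_on (?I \<times> cbox 0 1) (\<lambda>(y, t). t ^ Suc j *\<^sub>R ?h' (t * y))"
      unfolding case_prod_beta by (intro continuous_intros)
  qed auto
  then show ?thesis using x by (simp add: at_within_open[OF x])
qed

lemma smooth_on_parameter_integral:
  fixes h :: "real \<Rightarrow> 'a::euclidean_space"
  assumes "smooth_on {-r<..<r} h"
  shows "smooth_on {-r<..<r} (\<lambda>x. integral {0..1} (\<lambda>t. t ^ j *\<^sub>R h (t * x)))"
proof -
  have "Ck_on k {-r<..<r} (\<lambda>x. integral {0..1} (\<lambda>t. t ^ j *\<^sub>R h (t * x)))" for k
    using assms
  proof (induction k arbitrary: h j)
    case 0
    show ?case
      using has_vector_derivative_continuous[OF has_vector_derivative_parameter_integral[OF 0]]
      by (simp add: continuous_at_imp_continuous_on)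
  next
    case (Suc k)
    show ?case
    proof (rule Ck_on_SucI)
      show "((\<lambda>x. integral {0..1} (\<lambda>t. t ^ j *\<^sub>R h (t * x))) has_derivative
        (\<lambda>v. v *\<^sub>R integral {0..1} (\<lambda>t. t ^ Suc j *\<^sub>R frechet_derivative h (at (t * x)) 1))) (at x)"
        if "x \<in> {-r<..<r}" for x
        using has_vector_derivative_parameter_integral[OF Suc.prems that] by (simp add: has_vector_derivative_def)
      show "Ck_on k {-r<..<r} (\<lambda>x. v *\<^sub>R integral {0..1} (\<lambda>t. t ^ Suc j *\<^sub>R frechet_derivative h (at (t * x)) 1))" for v
        by (intro Ck_on_linear_compose[OF _ bounded_linear_scaleR_right] Suc.IH smooth_on_frechet Suc.prems) auto
    qed auto
  qed
  then show ?thesis by (simp add: smooth_on_def)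
qed

text \<open>Hadamard's lemma: the quotient is the integral of the derivative of \<open>f\<close> at
  \<open>t * x\<close> over the unit interval, by the fundamental theorem along the segment from 0
  to \<open>x\<close>.\<close>

lemma hadamard_division:
  fixes f :: "real \<Rightarrow> 'a::euclidean_space"
  assumes f: "smooth_on {-r<..<r} f" "f 0 = 0"
  shows "\<exists>g. smooth_on {-r<..<r} g \<and> (\<forall>x\<in>{-r<..<r}. f x = x *\<^sub>R g x)"
proof -
  let ?f' = "\<lambda>x. frechet_derivative f (at x) 1"
  define g where "g x = integral {0..1} (\<lambda>t. t ^ 0 *\<^sub>R ?f' (t * x))" for x
  have "smooth_on {-r<..<r} g"
    unfolding g_def by (intro smooth_on_parameter_integral smooth_on_frechet f(1))
  moreover have "f x = x *\<^sub>R g x" if x: "x \<in> {-r<..<r}" for x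
  proof -
    have "((\<lambda>t. x *\<^sub>R ?f' (t * x)) has_integral (f (1 * x) - f (0 * x))) {0..1}"
    proof (rule fundamental_theorem_of_calculus)
      fix t :: real assume t: "t \<in> {0..1}"
      have "(f has_vector_derivative ?f' (t * x)) (at (t * x))"
        using smooth_on_real_vector_derivative[OF f(1)] mult_unit_interval_in[OF x t] by simp
      moreover have "((\<lambda>t. t * x) has_real_derivative x) (at t within {0..1})"
        by (auto intro!: derivative_eq_intros)
      ultimately show "((\<lambda>t. f (t * x)) has_vector_derivative x *\<^sub>R ?f' (t * x)) (at t within {0..1})"
        using vector_diff_chain_within[of "\<lambda>t. t * x" x t "{0..1}" f "?f' (t * x)"]
        by (simp add: o_def has_real_derivative_iff_has_vector_derivative has_vector_derivative_at_within)
    qed simp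
    from integral_unique[OF this] show ?thesis using f(2) by (simp add: g_def)
  qed
  ultimately show ?thesis by blast
qed

lemma smooth_divide_power:
  fixes f :: "real \<Rightarrow> 'a::euclidean_space"
  assumes "r > 0" "smooth_on {-r<..<r} f" "\<forall>\<^sub>F x in at 0. norm (f x) \<le> C * \<bar>x\<bar> ^ d"
  shows "\<exists>g. smooth_on {-r<..<r} g \<and> (\<forall>x\<in>{-r<..<r}. f x = x ^ d *\<^sub>R g x)"
  using assms(2,3)
proof (induction d arbitrary: f)
  case 0
  then show ?case by auto
next
  case (Suc d)
  have I: "\<forall>\<^sub>F x in at (0::real). x \<in> {-r<..<r} \<and> x \<noteq> 0"
    using assms(1) eventually_at_ball[of r "0::real" UNIV] by (auto simp: eventually_at_filter elim!: eventually_mono)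
  have "((\<lambda>x::real. C * \<bar>x\<bar> ^ Suc d) \<longlongrightarrow> 0) (at 0)"
    by (auto intro!: tendsto_eq_intros)
  then have "(f \<longlongrightarrow> 0) (at 0)"
    by (rule Lim_null_comparison[OF Suc.prems(2)])
  moreover have "isCont f 0"
    using smooth_on_has_derivative[OF Suc.prems(1), of 0] assms(1) has_derivative_continuous by auto
  then have "(f \<longlongrightarrow> f 0) (at 0)" by (simp add: isCont_def)
  ultimately have "f 0 = 0" using tendsto_unique trivial_limit_at by blast
  then obtain g where g: "smooth_on {-r<..<r} g" "\<And>x. x \<in> {-r<..<r} \<Longrightarrow> f x = x *\<^sub>R g x"
    using hadamard_division[OF Suc.prems(1)] by blast
  have "\<forall>\<^sub>F x in at 0. norm (g x) \<le> C * \<bar>x\<bar> ^ d"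
    using I Suc.prems(2)
  proof eventually_elim
    case (elim x)
    then have "\<bar>x\<bar> * norm (g x) \<le> \<bar>x\<bar> * (C * \<bar>x\<bar> ^ d)" using g(2)[of x] by (simp add: mult_ac)
    then show ?case by (rule mult_left_le_imp_le) (use elim in simp)
  qed
  from Suc.IH[OF g(1) this] obtain h where "smooth_on {-r<..<r} h" "\<And>x. x \<in> {-r<..<r} \<Longrightarrow> g x = x ^ d *\<^sub>R h x"
    by blast
  then show ?case using g(2) by (intro exI[of _ h]) simp
qed

subsection \<open>Shears of normal forms\<close>

text \<open>A concrete choice for the local diffeomorphism \<open>\<Psi>\<close> of the index: for
  real normal coordinate \<open>\<alpha>\<close> it parametrizes the surface spanned by
  \<open>\<rho>\<close>, and being fibrewise complex multiplication it preserves
  orientation.\<close>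

definition shear :: "(real \<Rightarrow> complex) \<Rightarrow> complex \<times> complex \<Rightarrow> complex \<times> complex" where
  "shear \<rho> p = (fst p, snd p * \<rho> (Re (fst p)))"

text \<open>A shear fixes the first coordinate, so this set is invariant under it, and over it
  \<open>\<rho>\<close> is only evaluated between \<open>-r\<close> and \<open>r\<close>.\<close>

definition tube :: "real \<Rightarrow> (complex \<times> complex) set" where
  "tube r = {p. norm (fst p) < r}"

lemma open_tube: "open (tube r)"
  unfolding tube_def by (auto intro!: open_Collect_less continuous_intros)

lemma Re_fst_tube: "p \<in> tube r \<Longrightarrow> Re (fst p) \<in> {-r<..<r}"
  using abs_Re_le_cmod[of "fst p"] by (auto simp: tube_def abs_le_iff)

lemma smooth_on_shear:
  assumes "smooth_on {-r<..<r} \<rho>"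
  shows "smooth_on (tube r) (shear \<rho>)"
proof -
  have "smooth_on (tube r) (\<lambda>p. \<rho> (Re (fst p)))"
    by (rule smooth_on_compose[OF assms])
      (use Re_fst_tube in \<open>auto intro!: smooth_on_bounded_linear open_tube
        bounded_linear_compose[OF bounded_linear_Re bounded_linear_fst]\<close>)
  then show ?thesis
    unfolding shear_def[abs_def]
    by (rule smooth_on_Pair[OF smooth_on_bounded_linear[OF open_tube bounded_linear_fst]
          smooth_on_mult[OF smooth_on_bounded_linear[OF open_tube bounded_linear_snd]]])
qed

text \<open>The derivative is block triangular with the identity and multiplication by
  \<open>\<rho> (Re (fst p))\<close> on the diagonal; its determinant is the squared modulus of the
  latter.\<close>

lemma shear_orientation:
  assumes "smooth_on {-r<..<r} \<rho>" "p \<in> tube r" "\<rho> (Re (fst p)) \<noteq> 0"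
  shows "let D = frechet_derivative (shear \<rho>) (at p) in
    det4 (D (1, 0)) (D (\<i>, 0)) (D (0, 1)) (D (0, \<i>)) > 0"
proof -
  let ?x = "Re (fst p)"
  define D where "D = frechet_derivative \<rho> (at ?x)"
  have d: "(\<rho> has_derivative D) (at ?x)"
    unfolding D_def by (rule smooth_on_has_derivative[OF assms(1) Re_fst_tube[OF assms(2)]])
  have D0: "D 0 = 0" using linear_0[OF has_derivative_linear[OF d]] .
  have "((\<lambda>p. Re (fst p)) has_derivative (\<lambda>h. Re (fst h))) (at p)"
    by (intro bounded_linear_imp_has_derivative bounded_linear_compose[OF bounded_linear_Re bounded_linear_fst])
  from has_derivative_compose[OF this d]
  have "((\<lambda>p. \<rho> (Re (fst p))) has_derivative (\<lambda>h. D (Re (fst h)))) (at p)" .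
  then have "(shear \<rho> has_derivative (\<lambda>h. (fst h, snd p * D (Re (fst h)) + snd h * \<rho> ?x))) (at p)"
    unfolding shear_def[abs_def]
    by (rule has_derivative_Pair[OF bounded_linear_imp_has_derivative[OF bounded_linear_fst]
          has_derivative_mult[OF bounded_linear_imp_has_derivative[OF bounded_linear_snd]]])
  then have "frechet_derivative (shear \<rho>) (at p) = (\<lambda>h. (fst h, snd p * D (Re (fst h)) + snd h * \<rho> ?x))"
    by (rule frechet_derivative_at[symmetric])
  moreover have "det4 (1, a) (\<i>, b) (0, c) (0, \<i> * c) = (norm c)\<^sup>2" for a b c
    unfolding cmod_power2 by (simp add: det4_expand cdet_def) (simp add: power2_eq_square)
  ultimately show ?thesis using assms(3) by (simp add: Let_def D0)
qed

lemma shear_inverse: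
  assumes "\<forall>x\<in>{-r<..<r}. \<rho> x \<noteq> 0"
  shows "p \<in> tube r \<Longrightarrow> shear (\<lambda>x. 1 / \<rho> x) (shear \<rho> p) = p"
    "p \<in> tube r \<Longrightarrow> shear \<rho> (shear (\<lambda>x. 1 / \<rho> x) p) = p"
    "p \<in> tube r \<Longrightarrow> shear \<rho>' p \<in> tube r"
    "shear \<rho> ` tube r = tube r" "inj_on (shear \<rho>) (tube r)"
    "p \<in> tube r \<Longrightarrow> inv_into (tube r) (shear \<rho>) p = shear (\<lambda>x. 1 / \<rho> x) p"
proof -
  show 1: "shear (\<lambda>x. 1 / \<rho> x) (shear \<rho> p) = p" if "p \<in> tube r" for p
    using bspec[OF assms Re_fst_tube[OF that]] by (simp add: shear_def)
  show 2: "shear \<rho> (shear (\<lambda>x. 1 / \<rho> x) p) = p" if "p \<in> tube r" for p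
    using bspec[OF assms Re_fst_tube[OF that]] by (simp add: shear_def)
  show 3: "shear \<rho>' p \<in> tube r" if "p \<in> tube r" for p \<rho>'
    using that by (simp add: shear_def tube_def)
  show 4: "inj_on (shear \<rho>) (tube r)" using 1 by (metis inj_onI)
  show "shear \<rho> ` tube r = tube r"
    using 2 3 by (metis (no_types, lifting) image_eqI image_subsetI subset_antisym subsetI)
  show "inv_into (tube r) (shear \<rho>) p = shear (\<lambda>x. 1 / \<rho> x) p" if "p \<in> tube r"
    by (rule inv_into_f_eq[OF 4 3[OF that] 2[OF that]])
qed

lemma orientation_preserving_diffeo_shear:
  assumes "smooth_on {-r<..<r} \<rho>" "\<And>x. x \<in> {-r<..<r} \<Longrightarrow> \<rho> x \<noteq> 0"
  shows "orientation_preserving_diffeo (tube r) (shear \<rho>)"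
proof -
  have nz: "\<forall>x\<in>{-r<..<r}. \<rho> x \<noteq> 0" using assms(2) by blast
  note inv = shear_inverse[OF nz]
  have "smooth_on {-r<..<r} (\<lambda>x. 1 / \<rho> x)"
    by (intro smooth_on_divide assms smooth_on_const) auto
  then have "smooth_on (tube r) (shear (\<lambda>x. 1 / \<rho> x))" by (rule smooth_on_shear)
  then have "smooth_on (tube r) (inv_into (tube r) (shear \<rho>))"
    by (rule smooth_on_cong) (rule inv(6)[symmetric])
  then show ?thesis
    unfolding orientation_preserving_diffeo_def inv(4)
    using smooth_on_shear[OF assms(1)] inv(5) shear_orientation[OF assms(1) _ assms(2)[OF Re_fst_tube]] by blast
qed

lemma orientation_preserving_diffeo_shear_compose:
  assumes F: "orientation_preserving_diffeo U F"
    and \<rho>: "smooth_on {-r<..<r} \<rho>" "\<And>x. x \<in> {-r<..<r} \<Longrightarrow> \<rho> x \<noteq> 0"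
    and U': "U' = U \<inter> F -` tube r"
  shows "orientation_preserving_diffeo U' (\<lambda>p. shear \<rho> (F p))"
proof -
  let ?\<rho>' = "\<lambda>x. 1 / \<rho> x"
  have nz: "\<forall>x\<in>{-r<..<r}. \<rho> x \<noteq> 0" using \<rho>(2) by blast
  note inv = shear_inverse[OF nz]
  have F': "smooth_on U F" "inj_on F U" "smooth_on (F ` U) (inv_into U F)"
    using F by (auto simp: orientation_preserving_diffeo_def)
  have U'op: "open U'"
    unfolding U' by (rule continuous_open_preimage[OF smooth_on_continuous_on[OF F'(1)] smooth_on_open[OF F'(1)] open_tube])
  have FU': "smooth_on U' F" by (rule smooth_on_subset[OF F'(1) _ U'op]) (simp add: U')
  have sub: "F ` U' \<subseteq> tube r" by (auto simp: U')
  have smooth: "smooth_on U' (\<lambda>p. shear \<rho> (F p))"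
    by (rule smooth_on_compose[OF smooth_on_shear[OF \<rho>(1)] FU' sub])
  have inj: "inj_on (\<lambda>p. shear \<rho> (F p)) U'"
    by (rule inj_onI) (use inv(1) F'(2) in \<open>metis IntD1 IntD2 U' inj_onD vimageE\<close>)
  let ?W = "tube r \<inter> shear ?\<rho>' -` (F ` U)"
  have s\<rho>': "smooth_on {-r<..<r} ?\<rho>'"
    by (intro smooth_on_divide \<rho> smooth_on_const) auto
  \<comment> \<open>Writing the image as a preimage under the inverse shear shows that it is open
    and gives the formula for the inverse on it.\<close>
  have im: "(\<lambda>p. shear \<rho> (F p)) ` U' = ?W"
  proof (intro set_eqI iffI)
    fix q assume "q \<in> (\<lambda>p. shear \<rho> (F p)) ` U'"
    then obtain p where "p \<in> U" "F p \<in> tube r" "q = shear \<rho> (F p)" by (auto simp: U')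
    then show "q \<in> ?W" using inv(1)[of "F p"] inv(3)[of "F p"] by auto
  next
    fix q assume q: "q \<in> ?W"
    then obtain p where p: "p \<in> U" "shear ?\<rho>' q = F p" by auto
    have "F p \<in> tube r" using q inv(3)[of q ?\<rho>'] p(2) by simp
    moreover have "q = shear \<rho> (F p)" using inv(2)[of q] q p(2) by simp
    ultimately show "q \<in> (\<lambda>p. shear \<rho> (F p)) ` U'" using p(1) by (auto simp: U')
  qed
  have Wop: "open ?W"
    by (rule continuous_open_preimage[OF smooth_on_continuous_on[OF smooth_on_shear[OF s\<rho>']] open_tube smooth_on_open[OF F'(3)]])
  have "smooth_on ?W (\<lambda>q. inv_into U F (shear ?\<rho>' q))"
    by (rule smooth_on_compose[OF F'(3) smooth_on_subset[OF smooth_on_shear[OF s\<rho>'] _ Wop]]) auto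
  then have smooth_inv: "smooth_on ?W (inv_into U' (\<lambda>p. shear \<rho> (F p)))"
  proof (rule smooth_on_cong)
    fix q assume q: "q \<in> ?W"
    then obtain p where p: "p \<in> U'" "q = shear \<rho> (F p)" unfolding im[symmetric] by auto
    then have "inv_into U' (\<lambda>p. shear \<rho> (F p)) q = p" using inv_into_f_f[OF inj p(1)] by simp
    moreover have "F p \<in> tube r" using sub p(1) by blast
    then have "shear ?\<rho>' q = F p" unfolding p(2) by (rule inv(1))
    then have "inv_into U F (shear ?\<rho>' q) = p" using inv_into_f_f[OF F'(2)] p(1) by (simp add: U')
    ultimately show "inv_into U F (shear ?\<rho>' q) = inv_into U' (\<lambda>p. shear \<rho> (F p)) q" by simp
  qed
  have "let D = frechet_derivative (\<lambda>p. shear \<rho> (F p)) (at p) in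
      det4 (D (1, 0)) (D (\<i>, 0)) (D (0, 1)) (D (0, \<i>)) > 0" if p: "p \<in> U'" for p
  proof -
    let ?DF = "frechet_derivative F (at p)" and ?DS = "frechet_derivative (shear \<rho>) (at (F p))"
    have Fp: "F p \<in> tube r" "p \<in> U" using p by (auto simp: U')
    have dS: "(shear \<rho> has_derivative ?DS) (at (F p))"
      by (rule smooth_on_has_derivative[OF smooth_on_shear[OF \<rho>(1)] Fp(1)])
    have "((\<lambda>p. shear \<rho> (F p)) has_derivative (\<lambda>h. ?DS (?DF h))) (at p)"
      by (rule has_derivative_compose[OF smooth_on_has_derivative[OF F'(1) Fp(2)] dS])
    then have D: "frechet_derivative (\<lambda>p. shear \<rho> (F p)) (at p) = (\<lambda>h. ?DS (?DF h))"
      by (rule frechet_derivative_at[symmetric])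
    show ?thesis
      using shear_orientation[OF \<rho>(1) Fp(1) \<rho>(2)[OF Re_fst_tube[OF Fp(1)]]] F Fp(2)
      unfolding Let_def D det4_linear[OF has_derivative_linear[OF dS], of "?DF (1, 0)"]
        orientation_preserving_diffeo_def by (metis mult_pos_pos)
  qed
  then show ?thesis
    unfolding orientation_preserving_diffeo_def im using smooth inj smooth_inv by blast
qed

text \<open>First coordinates and the zero section are fixed, so the flat half-disk and its edge
  direction survive, while the graph function is multiplied by \<open>\<rho> (Re z)\<close>.\<close>

lemma normal_form_shear:
  assumes nf: "normal_form u1 u2 U F r \<phi>" and r': "0 < r'" "r' \<le> r"
    and \<rho>: "smooth_on {-r'<..<r'} \<rho>" "\<And>x. x \<in> {-r'<..<r'} \<Longrightarrow> \<rho> x \<noteq> 0"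
    and U': "U' = U \<inter> F -` tube r'"
    and F': "orientation_preserving_diffeo U' F'" "\<And>p. p \<in> U' \<Longrightarrow> F' p = shear \<rho> (F p)"
  shows "normal_form u1 u2 U' F' r' (\<lambda>z. \<phi> z * \<rho> (Re z))"
proof -
  let ?s = "edge_sign u1 u2"
  have F: "smooth_on U F" "u1 0 \<in> U" "F (u1 0) = 0"
    "F ` (u1 ` \<Delta>plus \<inter> U) = (\<lambda>z. (z, 0)) ` half_disk 1 r"
    "F ` (u2 ` \<Delta>plus \<inter> U) = (\<lambda>z. (z, \<phi> z)) ` half_disk ?s r"
    "0 < Re (fst (frechet_derivative F (at (u1 0)) (diff0 u1 1)))"
    "smooth_up_to (half_disk ?s r) \<phi>" "\<phi> 0 = 0"
    using nf by (auto simp: normal_form_def orientation_preserving_diffeo_def)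
  have u0: "u1 0 \<in> U'" using F(2,3) r' by (simp add: U' tube_def)
  have image: "F' ` (C \<inter> U') = (\<lambda>z. (z, f z * \<rho> (Re z))) ` half_disk t r'"
    if "F ` (C \<inter> U) = (\<lambda>z. (z, f z)) ` half_disk t r" for C f t
  proof -
    have "F' ` (C \<inter> U') = shear \<rho> ` (F ` (C \<inter> U'))" using F'(2) by (auto simp: image_iff)
    also have "F ` (C \<inter> U') = F ` (C \<inter> U) \<inter> tube r'" by (auto simp: U')
    also have "\<dots> = (\<lambda>z. (z, f z)) ` half_disk t r'"
      unfolding that using r' by (auto simp: tube_def half_disk_def)
    also have "shear \<rho> ` \<dots> = (\<lambda>z. (z, f z * \<rho> (Re z))) ` half_disk t r'"
      by (auto simp: image_image shear_def)
    finally show ?thesis .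
  qed
  have deriv: "fst (frechet_derivative F' (at (u1 0)) h) = fst (frechet_derivative F (at (u1 0)) h)" for h
  proof -
    have sF': "smooth_on U' F'" using F'(1) by (simp add: orientation_preserving_diffeo_def)
    have "((\<lambda>p. fst (F' p)) has_derivative (\<lambda>h. fst (frechet_derivative F' (at (u1 0)) h))) (at (u1 0))"
      by (rule bounded_linear.has_derivative[OF bounded_linear_fst smooth_on_has_derivative[OF sF' u0]])
    then have "((\<lambda>p. fst (F p)) has_derivative (\<lambda>h. fst (frechet_derivative F' (at (u1 0)) h))) (at (u1 0))"
      by (rule has_derivative_transform_within_open[OF _ smooth_on_open[OF sF'] u0]) (simp add: F'(2) shear_def)
    moreover have "((\<lambda>p. fst (F p)) has_derivative (\<lambda>h. fst (frechet_derivative F (at (u1 0)) h))) (at (u1 0))"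
      by (rule bounded_linear.has_derivative[OF bounded_linear_fst smooth_on_has_derivative[OF F(1,2)]])
    ultimately show ?thesis using has_derivative_unique by metis
  qed
  have "smooth_up_to (half_disk ?s r') (\<lambda>z. \<phi> z * \<rho> (Re z))"
  proof -
    obtain V g where g: "half_disk ?s r \<subseteq> V" "smooth_on V g" "\<And>z. z \<in> half_disk ?s r \<Longrightarrow> g z = \<phi> z"
      using F(7) by (auto simp: smooth_up_to_def)
    let ?V = "V \<inter> ball 0 r'"
    have op: "open ?V" using smooth_on_open[OF g(2)] by auto
    have "smooth_on ?V (\<lambda>z. \<rho> (Re z))"
    proof (rule smooth_on_compose[OF \<rho>(1) smooth_on_bounded_linear[OF op bounded_linear_Re]])
      show "Re ` ?V \<subseteq> {-r'<..<r'}"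
      proof (rule image_subsetI)
        fix z assume "z \<in> ?V"
        then show "Re z \<in> {-r'<..<r'}" using abs_Re_le_cmod[of z] by auto
      qed
    qed
    then have "smooth_on ?V (\<lambda>z. g z * \<rho> (Re z))"
      by (intro smooth_on_mult smooth_on_subset[OF g(2)] op) auto
    then show ?thesis
      unfolding smooth_up_to_def using g(1,3) r'
      by (intro exI[of _ ?V] exI[of _ "\<lambda>z. g z * \<rho> (Re z)"]) (auto simp: half_disk_def)
  qed
  then show ?thesis
    unfolding normal_form_def
    using F'(1) F'(2)[OF u0] u0 F(3,6,8) r'(1) image[OF F(5)] image[of "u1 ` \<Delta>plus" "\<lambda>_. 0" 1] F(4)
    by (simp add: deriv shear_def zero_prod_def)
qed

subsection \<open>The index of intersection\<close>

lemma near_O_bigo: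
  assumes "f \<in> O[at 0](\<lambda>x::real. of_real x ^ n :: complex)" "f 0 = 0"
  shows "near_O n f"
proof -
  obtain C where "\<forall>\<^sub>F x in at 0. norm (f x) \<le> C * norm (of_real x ^ n :: complex)"
    using landau_o.bigE[OF assms(1)] by blast
  then have "\<forall>\<^sub>F x in at 0. norm (f x) \<le> max C 0 * norm x ^ n"
    by eventually_elim (simp add: norm_power, smt (verit) mult_right_mono zero_le_power)
  then show ?thesis
    by (intro near_OI[of _ "max C 0"]) (simp add: eventually_nhds_conv_at assms(2))
qed

text \<open>Needed because the chart in the definition of the index is written with
  \<open>inv_into\<close>, which agrees with the explicit inverse shear only on the tube.\<close>

lemma orientation_preserving_diffeo_cong:
  assumes "orientation_preserving_diffeo U F" "\<And>p. p \<in> U \<Longrightarrow> G p = F p"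
  shows "orientation_preserving_diffeo U G"
proof -
  have F: "smooth_on U F" "inj_on F U" "smooth_on (F ` U) (inv_into U F)"
    using assms(1) by (auto simp: orientation_preserving_diffeo_def)
  have im: "G ` U = F ` U" using assms(2) by (auto simp: image_iff)
  have inj: "inj_on G U" using F(2) assms(2) by (metis inj_on_cong)
  have "frechet_derivative G (at p) = frechet_derivative F (at p)" if p: "p \<in> U" for p
  proof -
    have "(G has_derivative frechet_derivative F (at p)) (at p)"
      by (rule has_derivative_transform_within_open[OF smooth_on_has_derivative[OF F(1) p] smooth_on_open[OF F(1)] p])
        (simp add: assms(2))
    from frechet_derivative_at[OF this] show ?thesis by simp
  qed
  moreover have "smooth_on (G ` U) (inv_into U G)"
    unfolding im
  proof (rule smooth_on_cong[OF F(3)])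
    fix q assume "q \<in> F ` U"
    then obtain p where p: "p \<in> U" "q = F p" by blast
    then show "inv_into U F q = inv_into U G q"
      using inv_into_f_f[OF F(2) p(1)] inv_into_f_f[OF inj p(1)] assms(2)[OF p(1)] by simp
  qed
  moreover have "smooth_on U G" by (rule smooth_on_cong[OF F(1)]) (simp add: assms(2))
  ultimately show ?thesis
    using assms(1) inj unfolding orientation_preserving_diffeo_def Let_def by simp
qed

lemma det4_complex_dependent:
  "det4 (cscale 1 v) (cscale \<i> v) (cscale 1 (cscale c v)) (cscale \<i> (cscale c v)) = 0"
proof -
  obtain x y z w where v: "v = (Complex x y, Complex z w)" by (metis complex_surj surj_pair)
  obtain p q where c: "c = Complex p q" by (metis complex_surj)
  show ?thesis
    by (simp add: v c cscale_def det4_expand cdet_def) algebra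
qed

context half_disk_pair
begin

text \<open>Transfers the intrinsic contact data to an arbitrary normal form: the maps vary with the
  chart, but the order does not, nor does the vanishing of the leading coefficient on the
  edge.\<close>

lemma normal_form_jet:
  assumes nf: "normal_form u1 u2 U F r \<phi>"
    and \<sigma>: "near_O 1 (poly \<sigma>)" "e > 0"
      "near_O (Suc e) (\<lambda>z. g2 z - g1 (poly \<sigma> z) - cscale (a * z ^ e) (orth_vec v))"
  obtains T A t where "bounded_linear T" "T 1 = of_real t" "t > 0" "Im (T \<i>) > 0"
    "bounded_linear A" "cdet (A 1) (A \<i>) > 0" "r > 0" "\<phi> 0 = 0"
    "near_O (Suc e) (\<lambda>z. if z \<in> half_disk s r then \<phi> z - A (a * (of_real s * T z) ^ e) else 0)"
    "near_O (Suc e) (\<lambda>x::real. \<phi> (of_real x) - of_real x ^ e * (of_real ((s * t) ^ e) * A a))"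
    "of_real ((s * t) ^ e) * A a = 0 \<longleftrightarrow> a = 0"
proof -
  define B where "B = (\<lambda>z. fst (frechet_derivative F (at 0) (cscale z v)))"
  define A where "A = (\<lambda>\<eta>. snd (frechet_derivative F (at 0) (cscale \<eta> (orth_vec v))))"
  note nfs = nf B_def A_def
  obtain T where T: "bounded_linear T" "\<And>z. T (B z) = z" "T 1 = of_real (1 / Re (B 1))" "Im (T \<i>) > 0"
    using B_inverse[OF nfs] by metis
  have t: "1 / Re (B 1) > 0" using nf_unfolded(12)[OF nfs] by simp
  have r: "r > 0" using nf_unfolded(7)[OF nfs] .
  have "inj A" by (rule linear_cdet_nonzero_inj[OF linear_AB(1)[OF nfs]]) (use AB_orientation(3)[OF nfs] in simp)
  then have "A a = 0 \<longleftrightarrow> a = 0" using linear_0[OF linear_AB(1)[OF nfs]] by (metis injD)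
  then have "of_real ((s * (1 / Re (B 1))) ^ e) * A a = 0 \<longleftrightarrow> a = 0" using s(2) t by auto
  note exp = phi_expansion[OF nfs \<sigma> T(1,2)]
  show ?thesis
    by (rule that[OF T(1,3) t T(4) bounded_linear_AB(1)[OF nfs] AB_orientation(3)[OF nfs] r
          nf_unfolded(11)[OF nfs] exp edge_expansion[OF exp T(1) bounded_linear_AB(1)[OF nfs] T(3) r]]) fact
qed

text \<open>Compares the leading term on the edge in the chart witnessing the order of tangency with
  the one predicted by contact. Equal tangent lines exclude order one, whence the bound 2.\<close>

lemma tangency_contact:
  assumes hol: "(\<lambda>z. fst (g1 z)) holomorphic_on {z\<in>V1. norm z < 1 \<and> Im z > 0}"
      "(\<lambda>z. snd (g1 z)) holomorphic_on {z\<in>V1. norm z < 1 \<and> Im z > 0}"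
      "(\<lambda>z. fst (g2 z)) holomorphic_on {z\<in>V2. norm z < 1 \<and> Im z > 0}"
      "(\<lambda>z. snd (g2 z)) holomorphic_on {z\<in>V2. norm z < 1 \<and> Im z > 0}"
    and tan: "has_tangency_order u1 u2 d"
  obtains \<sigma> a where "near_O 1 (poly \<sigma>)" "a \<noteq> 0" "2 \<le> d"
    "near_O (Suc d) (\<lambda>z. g2 z - g1 (poly \<sigma> z) - cscale (a * z ^ d) (orth_vec v))"
proof -
  \<comment> \<open>\<open>max d 1\<close> is used because the contact expansion starts at order one
    while \<open>d = 0\<close> is not yet excluded.\<close>
  obtain \<sigma> a e where \<sigma>: "near_O 1 (poly \<sigma>)" "1 \<le> e" "e \<le> max d 1" "a \<noteq> 0 \<or> e = max d 1" "max d 1 = 1 \<Longrightarrow> a = 0"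
    "near_O (Suc e) (\<lambda>z. g2 z - g1 (poly \<sigma> z) - cscale (a * z ^ e) (orth_vec v))"
    by (rule contact_expansion[OF g1(1) zero_in(2) g_0(1) g2(1) zero_in(3) g_0(2) zero_less_one hol v(1) D1 D2,
          where d="max d 1"]) (simp, rule that)
  obtain U F r \<phi> c where nf: "normal_form u1 u2 U F r \<phi>" and c: "c \<noteq> 0"
    "(\<lambda>x::real. \<phi> (of_real x) - of_real x ^ d * c) \<in> O[at 0](\<lambda>x. of_real x ^ (d + 1))"
    using tan by (auto simp: has_tangency_order_def)
  have e0: "e > 0" using \<sigma>(2) by simp
  obtain T A t where jet: "near_O (Suc e) (\<lambda>x::real. \<phi> (of_real x) - of_real x ^ e * (of_real ((s * t) ^ e) * A a))"
    "of_real ((s * t) ^ e) * A a = 0 \<longleftrightarrow> a = 0" and \<phi>0: "\<phi> 0 = 0"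
    by (rule normal_form_jet[OF nf \<sigma>(1) e0 \<sigma>(6)])
  define a' where "a' = of_real ((s * t) ^ e) * A a"
  note edge = jet(1)[folded a'_def] and a'0 = jet(2)[folded a'_def]
  have pow: "near_O n (\<lambda>x::real. of_real x ^ n * w)" for n and w :: complex
    by (rule near_OI[of _ "norm w"]) (simp add: norm_mult norm_power)
  \<comment> \<open>The estimate in the order of tangency ignores the point 0, so
    \<open>\<phi> 0 = 0\<close> does not settle this directly: for \<open>d = 0\<close>,
    \<open>\<phi>\<close> would have limit \<open>c\<close> along the edge, but its expansion gives
    limit 0.\<close>
  have d0: "d > 0"
  proof (rule ccontr)
    assume "\<not> d > 0"
    then have d: "d = 0" by simp
    have "near_O 1 (\<lambda>x::real. of_real x ^ e * a')"
      using near_O_mono[OF pow[of e a']] e0 by simp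
    from near_O_add[OF near_O_mono[OF edge, of 1] this]
    have "near_O 1 (\<lambda>x::real. \<phi> (of_real x))" by simp
    from near_O_tendsto(1)[OF this] have t1: "((\<lambda>x::real. \<phi> (of_real x)) \<longlongrightarrow> 0) (at 0)"
      using tendsto_mono[OF at_within_le_nhds] by simp
    obtain C where "\<forall>\<^sub>F x::real in at 0. norm (\<phi> (of_real x) - c) \<le> C * norm (of_real x :: complex)"
      using landau_o.bigE[OF c(2)] by (auto simp: d)
    moreover have "((\<lambda>x::real. C * norm (of_real x :: complex)) \<longlongrightarrow> 0) (at 0)"
      by (auto intro!: tendsto_eq_intros)
    ultimately have "((\<lambda>x::real. \<phi> (of_real x) - c) \<longlongrightarrow> 0) (at 0)" by (rule Lim_null_comparison)
    from tendsto_diff[OF t1 this] have "((\<lambda>x::real. c) \<longlongrightarrow> 0) (at 0)" by simp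
    then show False using c(1) by (simp add: tendsto_const_iff)
  qed
  have tang: "near_O (Suc d) (\<lambda>x::real. \<phi> (of_real x) - of_real x ^ d * c)"
    by (rule near_O_bigo) (use c(2) d0 in \<open>auto simp: \<phi>0\<close>)
  \<comment> \<open>A nonzero transverse term at a lower order would be the leading term on the
    edge, where everything below order \<open>d\<close> vanishes.\<close>
  have ed: "e = d"
  proof (rule ccontr)
    assume "e \<noteq> d"
    then have lt: "Suc e \<le> d" and "a \<noteq> 0" using \<sigma>(3,4) d0 by auto
    have "near_O (Suc e) (\<lambda>x::real. \<phi> (of_real x))"
      using near_O_add[OF near_O_mono[OF tang, of "Suc e"] near_O_mono[OF pow[of d c] lt]] lt by simp
    from near_O_diff[OF this edge] have "near_O (Suc e) (\<lambda>x::real. of_real x ^ e * a')" by simp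
    then show False using near_O_monomial_coeff_zero a'0 \<open>a \<noteq> 0\<close> by blast
  qed
  from near_O_diff[OF tang edge[unfolded ed]]
  have "near_O (Suc d) (\<lambda>x::real. of_real x ^ d * (a' - c))" by (simp add: algebra_simps)
  then have "a' = c" using near_O_monomial_coeff_zero by fastforce
  then have a: "a \<noteq> 0" using c(1) a'0 by simp
  moreover from this have "d \<noteq> 1" using \<sigma>(5) by auto
  ultimately show ?thesis using that[OF \<sigma>(1) a] \<sigma>(6) d0 ed by simp
qed

context
  fixes \<sigma> a d
  assumes contact: "near_O 1 (poly \<sigma>)" "a \<noteq> 0" "2 \<le> d"
    "near_O (Suc d) (\<lambda>z. g2 z - g1 (poly \<sigma> z) - cscale (a * z ^ d) (orth_vec v))"
begin

lemma local_index_iff: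
  assumes nf: "normal_form u1 u2 U F r \<phi>" and real: "\<forall>x\<in>{-r<..<r}. Im (\<phi> (of_real x)) = 0"
  shows "has_local_index (\<lambda>z. (z, 0)) (\<lambda>z. (z, reflect_ext s \<phi> z)) k \<longleftrightarrow> k = int d"
proof -
  have d0: "d > 0" using contact(3) by simp
  have \<phi>: "continuous_on (half_disk s r) \<phi>"
    using nf smooth_on_continuous_on continuous_on_subset
    unfolding normal_form_def s(1)[symmetric] smooth_up_to_def by (metis continuous_on_cong)
  obtain T A t where jet: "bounded_linear T" "T 1 = of_real t" "t > 0" "Im (T \<i>) > 0"
    "bounded_linear A" "cdet (A 1) (A \<i>) > 0" "r > 0"
    "near_O (Suc d) (\<lambda>z. if z \<in> half_disk s r then \<phi> z - A (a * (of_real s * T z) ^ d) else 0)"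
    by (rule normal_form_jet[OF nf contact(1) d0 contact(4)])
  obtain R where "R > 0" "continuous_on (ball 0 R) (reflect_ext s \<phi>)"
    "log_equiv (ball 0 R - {0}) (reflect_ext s \<phi>) (\<lambda>z. z ^ d)"
    by (rule reflect_ext_log_equiv[OF jet(1-6) contact(2) s(2) jet(7,8) \<phi>]) (use real in simp, rule that)
  moreover have "reflect_ext s \<phi> 0 = 0" using nf by (simp add: reflect_ext_def normal_form_def)
  ultimately show ?thesis using has_local_index_graph_iff d0 by blast
qed

text \<open>Any admissible choice of data ends in a normal form whose graph function is real on the
  edge, and all such normal forms have local index \<open>d\<close>.\<close>

lemma has_intersection_index_imp:
  assumes "has_intersection_index u1 u2 k"
  shows "k = int d"
  using assms unfolding has_intersection_index_def s(1)[symmetric]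
  by (elim exE conjE) (rule iffD1[OF local_index_iff])

text \<open>On the edge the graph function is smooth and of order \<open>d\<close>, so repeated
  Hadamard division yields a smooth quotient; its value at 0 is the nonzero leading
  coefficient.\<close>

lemma edge_quotient:
  assumes nf: "normal_form u1 u2 U F r \<phi>"
  obtains \<rho> where "smooth_on {-r<..<r} \<rho>" "\<rho> 0 \<noteq> 0"
    "\<And>x. x \<in> {-r<..<r} \<Longrightarrow> \<phi> (of_real x) = of_real x ^ d * \<rho> x"
proof -
  have d0: "d > 0" using contact(3) by simp
  obtain T A t where jet: "near_O (Suc d) (\<lambda>x::real. \<phi> (of_real x) - of_real x ^ d * (of_real ((s * t) ^ d) * A a))"
    "of_real ((s * t) ^ d) * A a = 0 \<longleftrightarrow> a = 0" and r: "r > 0"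
    by (rule normal_form_jet[OF nf contact(1) d0 contact(4)])
  define c where "c = of_real ((s * t) ^ d) * A a"
  note edge = jet(1)[folded c_def]
  have c0: "c \<noteq> 0" using jet(2)[folded c_def] contact(2) by simp
  have smooth: "smooth_on {-r<..<r} (\<lambda>x. \<phi> (of_real x))"
  proof -
    have "smooth_up_to (half_disk s r) \<phi>" using nf by (simp add: normal_form_def s(1))
    then obtain V g where g: "half_disk s r \<subseteq> V" "smooth_on V g" "\<And>z. z \<in> half_disk s r \<Longrightarrow> g z = \<phi> z"
      by (auto simp: smooth_up_to_def)
    have H: "complex_of_real x \<in> half_disk s r" if "x \<in> {-r<..<r}" for x
      using that by (auto simp: half_disk_def)
    have "smooth_on {-r<..<r} (\<lambda>x. g (of_real x))"
      by (rule smooth_on_compose[OF g(2) smooth_on_bounded_linear[OF _ bounded_linear_of_real]])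
        (use H g(1) in auto)
    then show ?thesis by (rule smooth_on_cong) (use H g(3) in auto)
  qed
  have "near_O d (\<lambda>x::real. of_real x ^ d * c)"
    by (rule near_OI[of _ "norm c"]) (simp add: norm_mult norm_power)
  from near_O_add[OF near_O_mono[OF edge, of d] this] have "near_O d (\<lambda>x::real. \<phi> (of_real x))" by simp
  then obtain C where "\<forall>\<^sub>F x in nhds 0. norm (\<phi> (of_real x)) \<le> C * norm x ^ d" by (auto simp: near_O_def)
  then have "\<forall>\<^sub>F x in at 0. norm (\<phi> (of_real x)) \<le> C * \<bar>x\<bar> ^ d" by (simp add: eventually_nhds_conv_at)
  from smooth_divide_power[OF r smooth this]
  obtain \<rho> where \<rho>: "smooth_on {-r<..<r} \<rho>" "\<And>x. x \<in> {-r<..<r} \<Longrightarrow> \<phi> (of_real x) = x ^ d *\<^sub>R \<rho> x"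
    by blast
  have "\<rho> 0 - c = 0"
  proof (rule near_O_leading_coeff_zero[OF edge, where m=d])
    have "\<forall>\<^sub>F x in at (0::real). x \<in> {-r<..<r}"
      using r eventually_at_in_open'[of "{-r<..<r}" 0] by auto
    then show "\<forall>\<^sub>F x in at 0. norm x ^ d * norm (\<rho> x - c) \<le> norm (\<phi> (of_real x) - of_real x ^ d * c)"
    proof eventually_elim
      case (elim x)
      have "\<phi> (of_real x) - of_real x ^ d * c = of_real x ^ d * (\<rho> x - c)"
        using \<rho>(2)[OF elim] by (simp add: scaleR_conv_of_real right_diff_distrib)
      then show ?case by (simp add: norm_mult norm_power)
    qed
    show "isCont (\<lambda>x. \<rho> x - c) 0"
      using smooth_on_has_derivative[OF \<rho>(1), of 0] r has_derivative_continuous by (intro continuous_intros) auto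
  qed simp
  then show ?thesis using that[OF \<rho>(1)] \<rho>(2) c0 by (simp add: scaleR_conv_of_real)
qed

text \<open>With the shear by \<open>\<rho>\<close> as the diffeomorphism, the new graph function is
  \<open>\<phi> z / \<rho> (Re z)\<close>, which on the edge is the real number
  \<open>x ^ d\<close>.\<close>

lemma has_intersection_index_exists:
  assumes nf: "normal_form u1 u2 U F r \<phi>"
  shows "has_intersection_index u1 u2 (int d)"
proof -
  have r: "r > 0" and F: "orientation_preserving_diffeo U F" using nf by (auto simp: normal_form_def)
  obtain \<rho> where \<rho>: "smooth_on {-r<..<r} \<rho>" "\<rho> 0 \<noteq> 0"
    "\<And>x. x \<in> {-r<..<r} \<Longrightarrow> \<phi> (of_real x) = of_real x ^ d * \<rho> x"
    by (rule edge_quotient[OF nf]) (rule that)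
  have "open ({-r<..<r} \<inter> \<rho> -` (- {0}))"
    by (rule continuous_open_preimage[OF smooth_on_continuous_on[OF \<rho>(1)]]) auto
  moreover have "0 \<in> {-r<..<r} \<inter> \<rho> -` (- {0})" using r \<rho>(2) by auto
  \<comment> \<open>The radius is shrunk until \<open>\<rho>\<close> has no zeros, as the inverse
    shear divides by it.\<close>
  ultimately obtain r' where r': "r' > 0" "ball 0 r' \<subseteq> {-r<..<r} \<inter> \<rho> -` (- {0})"
    using open_contains_ball by blast
  have sub: "{-r'<..<r'} \<subseteq> {-r<..<r}" "\<And>x. x \<in> {-r'<..<r'} \<Longrightarrow> \<rho> x \<noteq> 0"
    using r'(2) by (auto simp: ball_def dist_real_def subset_iff)
  have r'r: "r' \<le> r"
    using sub(1) r'(1) by (simp add: greaterThanLessThan_subseteq_greaterThanLessThan)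
  have s\<rho>: "smooth_on {-r'<..<r'} \<rho>" using smooth_on_subset[OF \<rho>(1) sub(1)] by simp
  define \<rho>' where "\<rho>' x = 1 / \<rho> x" for x
  have \<rho>': "smooth_on {-r'<..<r'} \<rho>'" "\<And>x. x \<in> {-r'<..<r'} \<Longrightarrow> \<rho>' x \<noteq> 0"
    unfolding \<rho>'_def[abs_def] using sub(2) s\<rho> by (auto intro!: smooth_on_divide smooth_on_const)
  define U' where "U' = U \<inter> F -` tube r'"
  have nz: "\<forall>x\<in>{-r'<..<r'}. \<rho> x \<noteq> 0" using sub(2) by blast
  note inv = shear_inverse[OF nz]
  define F' where "F' = inv_into (tube r') (shear \<rho>) \<circ> F"
  have F'eq: "F' p = shear \<rho>' (F p)" if "p \<in> U'" for p
    using inv(6)[of "F p"] that by (simp add: F'_def U'_def \<rho>'_def[abs_def])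
  have op: "orientation_preserving_diffeo U' (\<lambda>p. shear \<rho>' (F p))"
    by (rule orientation_preserving_diffeo_shear_compose[OF F \<rho>' U'_def])
  have "orientation_preserving_diffeo U' F'"
    by (rule orientation_preserving_diffeo_cong[OF op]) (simp add: F'eq)
  then have nf': "normal_form u1 u2 U' F' r' (\<lambda>z. \<phi> z * \<rho>' (Re z))"
    using normal_form_shear[OF nf r'(1) r'r \<rho>' U'_def _ F'eq] by blast
  have edge: "\<forall>x\<in>{-r'<..<r'}. Im (\<phi> (of_real x) * \<rho>' (Re (of_real x))) = 0"
  proof
    fix x assume x: "x \<in> {-r'<..<r'}"
    then have "\<phi> (of_real x) * \<rho>' (Re (of_real x)) = of_real (x ^ d)"
      using \<rho>(3)[of x] sub by (auto simp: \<rho>'_def)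
    then show "Im (\<phi> (of_real x) * \<rho>' (Re (of_real x))) = 0" by (metis Im_complex_of_real)
  qed
  have "has_local_index (\<lambda>z. (z, 0)) (\<lambda>z. (z, reflect_ext s (\<lambda>z. \<phi> z * \<rho>' (Re z)) z)) (int d)"
    using local_index_iff[OF nf' edge] by simp
  moreover have "orientation_preserving_diffeo (tube r') (shear \<rho>)"
    by (rule orientation_preserving_diffeo_shear[OF s\<rho> sub(2)])
  moreover have "0 \<in> tube r'" "shear \<rho> 0 = 0" using r'(1) by (auto simp: tube_def shear_def zero_prod_def)
  moreover have "\<forall>t \<tau> \<alpha>. t \<in> {-r<..<r} \<and> (Complex t \<tau>, of_real \<alpha>) \<in> tube r' \<longrightarrow>
           shear \<rho> (Complex t \<tau>, of_real \<alpha>) = (Complex t \<tau>, of_real \<alpha> * \<rho> t)"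
    by (simp add: shear_def)
  moreover have "U' \<subseteq> U" "F ` U' \<subseteq> shear \<rho> ` tube r'" unfolding inv(4) by (auto simp: U'_def)
  ultimately show ?thesis
    unfolding has_intersection_index_def s(1)[symmetric]
    using nf \<rho> nf'[unfolded F'_def] edge by blast
qed

end

end

text \<open>Unique existence is part of the claim because \<open>intersection_index\<close> is a
  definite description, whose value carries information only when exactly one index exists.\<close>

theorem theorem2:
  fixes u1 u2 :: "complex \<Rightarrow> complex \<times> complex" and d :: nat
  assumes "analytic_half_disk u1" and "analytic_half_disk u2"
    and "u1 0 = 0" and "u2 0 = 0"
    and "diff0 u1 1 = diff0 u2 1 \<or> diff0 u1 1 = - diff0 u2 1"
    and "has_tangency_order u1 u2 d"
  shows "(\<exists>!k. has_intersection_index u1 u2 k) \<and>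
         intersection_index u1 u2 = int d \<and>
         intersection_index u1 u2 > 0 \<and>
         (intersection_index u1 u2 = 1 \<longleftrightarrow> transverse_at_0 u1 u2)"
proof -
  obtain V1 g1 where ext1: "smooth_on V1 g1" "\<Delta>plus \<subseteq> V1" "\<And>z. z \<in> \<Delta>plus \<Longrightarrow> g1 z = u1 z"
    "(\<lambda>z. fst (g1 z)) holomorphic_on {z\<in>V1. norm z < 1 \<and> Im z > 0}"
    "(\<lambda>z. snd (g1 z)) holomorphic_on {z\<in>V1. norm z < 1 \<and> Im z > 0}"
    "\<And>z. frechet_derivative g1 (at 0) z = cscale z (diff0 u1 1)"
    "diff0 u1 = frechet_derivative g1 (at 0)" "diff0 u1 1 \<noteq> 0"
    by (rule analytic_half_disk_extension[OF assms(1,3)]) (rule that)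
  obtain V2 g2 where ext2: "smooth_on V2 g2" "\<Delta>plus \<subseteq> V2" "\<And>z. z \<in> \<Delta>plus \<Longrightarrow> g2 z = u2 z"
    "(\<lambda>z. fst (g2 z)) holomorphic_on {z\<in>V2. norm z < 1 \<and> Im z > 0}"
    "(\<lambda>z. snd (g2 z)) holomorphic_on {z\<in>V2. norm z < 1 \<and> Im z > 0}"
    "\<And>z. frechet_derivative g2 (at 0) z = cscale z (diff0 u2 1)"
    "diff0 u2 = frechet_derivative g2 (at 0)" "diff0 u2 1 \<noteq> 0"
    by (rule analytic_half_disk_extension[OF assms(2,4)]) (rule that)
  define v where "v = diff0 u1 1"
  define s where "s = edge_sign u1 u2"
  have s: "diff0 u2 1 = s *\<^sub>R v" "s = 1 \<or> s = -1"
  proof -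
    show "s = 1 \<or> s = -1" by (simp add: s_def edge_sign_def)
    show "diff0 u2 1 = s *\<^sub>R v"
    proof (cases "diff0 u2 1 = v")
      case True
      then have "\<exists>c>0. diff0 u2 1 = c *\<^sub>R diff0 u1 1" by (intro exI[of _ 1]) (simp add: v_def)
      then show ?thesis using True by (simp add: s_def edge_sign_def)
    next
      case False
      then have minus: "diff0 u2 1 = - v" using assms(5) by (auto simp: v_def)
      \<comment> \<open>The sign -1 is the default value of \<open>edge_sign\<close>, so it must be
        checked that the opposite vector is not also a positive multiple of
        \<open>v\<close>.\<close>
      have "\<not> (\<exists>c>0. diff0 u2 1 = c *\<^sub>R diff0 u1 1)"
      proof clarify
        fix c :: real assume "c > 0" and eq: "diff0 u2 1 = c *\<^sub>R diff0 u1 1"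
        have "(c + 1) *\<^sub>R v = diff0 u2 1 + v" unfolding eq by (simp add: v_def scaleR_left_distrib)
        then have "(c + 1) *\<^sub>R v = 0" using minus by simp
        then show False using ext1(8) \<open>c > 0\<close> by (simp add: v_def)
      qed
      then have "s = -1" unfolding s_def edge_sign_def by (rule if_not_P)
      then show ?thesis using minus by simp
    qed
  qed
  have D2: "frechet_derivative g2 (at 0) z = cscale (of_real s * z) v" for z
    unfolding ext2(6) s(1) by (simp add: cscale_def scaleR_conv_of_real mult_ac)
  interpret half_disk_pair u1 u2 g1 g2 V1 V2 v s
  proof
    show "embedded_half_disk u1" "embedded_half_disk u2"
      using assms(1,2) by (simp_all add: analytic_half_disk_def)
  qed (fact assms(3,4) ext1(1-3) ext2(1-3) D2 s(2) s_def v_def[symmetric] ext1(6)[folded v_def] ext1(8)[folded v_def])+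
  obtain \<sigma> a where c: "near_O 1 (poly \<sigma>)" "a \<noteq> 0" "2 \<le> d"
    "near_O (Suc d) (\<lambda>z. g2 z - g1 (poly \<sigma> z) - cscale (a * z ^ d) (orth_vec v))"
    by (rule tangency_contact[OF ext1(4,5) ext2(4,5) assms(6)]) (rule that)
  obtain U F r \<phi> where "normal_form u1 u2 U F r \<phi>" using assms(6) by (auto simp: has_tangency_order_def)
  then have ex: "has_intersection_index u1 u2 (int d)" by (rule has_intersection_index_exists[OF c])
  have uniq: "k = int d" if "has_intersection_index u1 u2 k" for k
    by (rule has_intersection_index_imp[OF c that])
  have idx: "intersection_index u1 u2 = int d"
    unfolding intersection_index_def using ex uniq by (rule the_equality)
  \<comment> \<open>Both tangent planes are the complex line through \<open>v\<close>, so their sum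
    misses the orthogonal direction; otherwise the positive frame determinant would be that of
    vectors in one complex line.\<close>
  have "\<not> transverse_at_0 u1 u2"
  proof
    assume "transverse_at_0 u1 u2"
    then have "orth_vec v \<in> {x + y |x y. x \<in> range (diff0 u1) \<and> y \<in> range (diff0 u2)}"
      by (simp add: transverse_at_0_def)
    then obtain p q where "orth_vec v = diff0 u1 p + diff0 u2 q" by blast
    then have "orth_vec v = cscale p v + cscale (of_real s * q) v"
      unfolding ext1(7) ext2(7) D1 D2 .
    then have "orth_vec v = cscale (p + of_real s * q) v" by (simp add: cscale_def algebra_simps)
    then have "det4 (cscale 1 v) (cscale \<i> v) (cscale 1 (orth_vec v)) (cscale \<i> (orth_vec v)) = 0"
      by (simp only: det4_complex_dependent)
    then show False using det4_orth_frame[OF v(1)] by simp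
  qed
  moreover have "\<exists>!k. has_intersection_index u1 u2 k" using ex uniq by (rule ex1I)
  ultimately show ?thesis using idx c(3) by simp
qed

end
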